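(* Let $R>0$ and $a>0$. Fix an integer $k\ge 2$, and set $$\lambda_k:=R\sqrt{k^2-1},\qquad \Omega_k:=\frac{a^2}{\lambda_k},\qquad \omega_k:=\frac{\Omega_k}{a}=\frac{a}{\lambda_k}.$$ Then there exist $\delta>0$, a smooth function $\Lambda_k:(-\delta,\delta)\to(0,+\infty)$ with $\Lambda_k(0)=\lambda_k$, and a smooth two-parameter family $$\Psi_k:(-\delta,\delta)\times\mathbb T\longrightarrow H^2_{\mathrm{loc}}(\mathbb R,\mathbb R^3),\qquad (t,\varphi)\longmapsto \mathbf x_{t,\varphi},$$ with the following properties. (i) For every $(t,\varphi)\in(-\delta,\delta)\times\mathbb T$, the curve $\mathbf x_{t,\varphi}$ is a $T_\xi(t)$-periodic solution of $$\mathbf x\times\mathbf x''-\Omega(t)\, e_3\times\mathbf x+a\,\mathbf x'=0$$ with $$\Omega(t):=\frac{a^2}{\Lambda_k(t)},\qquad \omega(t):=\frac{\Omega(t)}{a}=\frac{a}{\Lambda_k(t)},\qquad T_\xi(t):=\frac{2\pi}{\omega(t)}=\frac{2\pi\Lambda_k(t)}{a},$$ and satisfies $\|\mathbf x_{t,\varphi}(\xi)\|\equiv R$. (ii) At $t=0$, $\mathbf x_{0,\varphi}(\xi)=\big(R\cos(\omega_k\xi),R\sin(\omega_k\xi),0\big)$ for every $\varphi\in\mathbb T$. (iii) As $t\to0$, one has $\Lambda_k(t)=\lambda_k+o(1)$ and, uniformly with respect to $\varphi\in\mathbb T$, $$\mathbf x_{t,\varphi}(\xi)=\begin{pmatrix}R\cos(\omega(t)\xi)\\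 R\sin(\omega(t)\xi)\\ 0\end{pmatrix}+t\begin{pmatrix}-\sin\big(k(\omega(t)\xi-\varphi)\big)\sin(\omega(t)\xi)\\ \sin\big(k(\omega(t)\xi-\varphi)\big)\cos(\omega(t)\xi)\\ -\dfrac{k}{\sqrt{k^2-1}}\cos\big(k(\omega(t)\xi-\varphi)\big)\end{pmatrix}+o(t)$$ in $H^2_{\mathrm{loc}}(\mathbb R,\mathbb R^3)$. (iv) The map $(t,\varphi)\mapsto(\Omega(t),\mathbf x_{t,\varphi})$ parametrizes a two-dimensional smooth family of nontrivial profiles, with the trivial equatorial phase fixed, issuing from $\big(\Omega_k,\,(R\cos(\omega_k\xi),R\sin(\omega_k\xi),0)\big)$.
   Context: $\mathbb T=\mathbb R/2\pi\mathbb Z$, $e_3=(0,0,1)$, $\times$ is the cross product in $\mathbb R^3$, and primes denote derivatives with respect to $\xi\in\mathbb R$. The equatorial (trivial) profiles are the solutions $\xi\mapsto (R\cos(\omega\xi+\phi_0),R\sin(\omega\xi+\phi_0),0)$ with $\omega=\Omega/a$; "with the trivial equatorial phase fixed" means that the reference equatorial profile is the one with $\phi_0=0$, and "nontrivial" (for $t\ne0$) means not an equatorial profile. A statement "$=o(t)$ in $H^2_{\mathrm{loc}}$" means that the $H^2$-norm on every fixed bounded interval is $o(t)$. *)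

theory Defs
  imports "HOL-Analysis.Analysis"
begin

section \<open>Smooth real functions and weak derivatives\<close>

text \<open>Only meant for open sets \<open>S\<close>.\<close>

definition smooth_real_on :: "real set \<Rightarrow> (real \<Rightarrow> real) \<Rightarrow> bool" where
  "smooth_real_on S f \<longleftrightarrow> (\<forall>n. \<forall>s\<in>S. (deriv ^^ n) f differentiable (at s))"

definition test_function :: "real set \<Rightarrow> (real \<Rightarrow> real) \<Rightarrow> bool" where
  "test_function I \<psi> \<longleftrightarrow>
     smooth_real_on UNIV \<psi> \<and> (\<exists>K. compact K \<and> K \<subseteq> I \<and> (\<forall>s. s \<notin> K \<longrightarrow> \<psi> s = 0))"

definition L2_on :: "real set \<Rightarrow> (real \<Rightarrow> real^3) \<Rightarrow> bool" where
  "L2_on I u \<longleftrightarrow> u \<in> borel_measurable (lebesgue_on I)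
     \<and> set_integrable lebesgue I (\<lambda>s. (norm (u s))\<^sup>2)"

definition weak_deriv_on :: "real set \<Rightarrow> (real \<Rightarrow> real^3) \<Rightarrow> (real \<Rightarrow> real^3) \<Rightarrow> bool" where
  "weak_deriv_on I u v \<longleftrightarrow> (\<forall>\<psi>. test_function I \<psi> \<longrightarrow>
     (LINT s:I|lebesgue. deriv \<psi> s *\<^sub>R u s) = - (LINT s:I|lebesgue. \<psi> s *\<^sub>R v s))"

definition H2_derivs_on ::
  "real set \<Rightarrow> (real \<Rightarrow> real^3) \<Rightarrow> (real \<Rightarrow> real^3) \<Rightarrow> (real \<Rightarrow> real^3) \<Rightarrow> bool" where
  "H2_derivs_on I u v w \<longleftrightarrow>
     L2_on I u \<and> L2_on I v \<and> L2_on I w \<and> weak_deriv_on I u v \<and> weak_deriv_on I v w"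


section \<open>The spaces \<open>H\<^sup>2(I)\<close> and \<open>H\<^sup>2_loc\<close>\<close>

text \<open>Elements of these spaces are represented by functions; two functions that agree almost
  everywhere represent the same element.\<close>

definition H2_on :: "real set \<Rightarrow> (real \<Rightarrow> real^3) \<Rightarrow> bool" where
  "H2_on I u \<longleftrightarrow> (\<exists>v w. H2_derivs_on I u v w)"

text \<open>For open \<open>I\<close>, weak derivatives are unique up to null sets, so for \<open>u\<close> in \<open>H\<^sup>2(I)\<close> the set below
  has exactly one element and the infimum merely selects it. The value is meaningless
  for other \<open>u\<close>.\<close>

definition H2_norm :: "real set \<Rightarrow> (real \<Rightarrow> real^3) \<Rightarrow> real" where
  "H2_norm I u = Inf {sqrt (LINT s:I|lebesgue. (norm (u s))\<^sup>2 + (norm (v s))\<^sup>2 + (norm (w s))\<^sup>2)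
                      | v w. H2_derivs_on I u v w}"

definition H2_loc :: "(real \<Rightarrow> real^3) \<Rightarrow> bool" where
  "H2_loc u \<longleftrightarrow> (\<forall>c d. c < d \<longrightarrow> H2_on {c<..<d} u)"


section \<open>Smooth maps from the plane into \<open>H\<^sup>2_loc\<close>\<close>

text \<open>\<open>H\<^sup>2_loc\<close> is a Frechet space whose topology is given by the seminorms
  \<^term>\<open>H2_norm {c<..<d}\<close>; limits are limits for each seminorm.\<close>

definition H2_loc_continuous_on ::
  "(real \<times> real) set \<Rightarrow> (real \<times> real \<Rightarrow> real \<Rightarrow> real^3) \<Rightarrow> bool" where
  "H2_loc_continuous_on U F \<longleftrightarrow> (\<forall>p\<in>U. H2_loc (F p)) \<and>
     (\<forall>p\<in>U. \<forall>c d. c < d \<longrightarrow>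
        ((\<lambda>q. H2_norm {c<..<d} (\<lambda>\<xi>. F q \<xi> - F p \<xi>)) \<longlongrightarrow> 0) (at p within U))"

text \<open>Total differentiability at \<open>p\<close>, with \<open>D\<^sub>1\<close>, \<open>D\<^sub>2\<close> the two partial derivatives.\<close>

definition has_H2_loc_derivs ::
  "(real \<times> real \<Rightarrow> real \<Rightarrow> real^3) \<Rightarrow> (real \<Rightarrow> real^3) \<Rightarrow> (real \<Rightarrow> real^3) \<Rightarrow> real \<times> real \<Rightarrow> bool" where
  "has_H2_loc_derivs F D\<^sub>1 D\<^sub>2 p \<longleftrightarrow> H2_loc D\<^sub>1 \<and> H2_loc D\<^sub>2 \<and>
     (\<forall>c d. c < d \<longrightarrow>
        ((\<lambda>q. H2_norm {c<..<d}
                 (\<lambda>\<xi>. F q \<xi> - F p \<xi> - (fst q - fst p) *\<^sub>R D\<^sub>1 \<xi> - (snd q - snd p) *\<^sub>R D\<^sub>2 \<xi>)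
               / norm (q - p)) \<longlongrightarrow> 0) (at p))"

text \<open>\<open>C\<^sup>n\<close> maps on an open set \<open>U\<close>.\<close>

primrec H2_loc_Cn_on ::
  "nat \<Rightarrow> (real \<times> real) set \<Rightarrow> (real \<times> real \<Rightarrow> real \<Rightarrow> real^3) \<Rightarrow> bool" where
  "H2_loc_Cn_on 0 U F \<longleftrightarrow> H2_loc_continuous_on U F"
| "H2_loc_Cn_on (Suc n) U F \<longleftrightarrow> H2_loc_continuous_on U F \<and>
     (\<exists>F\<^sub>1 F\<^sub>2. (\<forall>p\<in>U. has_H2_loc_derivs F (F\<^sub>1 p) (F\<^sub>2 p) p) \<and>
               H2_loc_Cn_on n U F\<^sub>1 \<and> H2_loc_Cn_on n U F\<^sub>2)"

definition H2_loc_smooth_on ::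
  "(real \<times> real) set \<Rightarrow> (real \<times> real \<Rightarrow> real \<Rightarrow> real^3) \<Rightarrow> bool" where
  "H2_loc_smooth_on U F \<longleftrightarrow> (\<forall>n. H2_loc_Cn_on n U F)"

text \<open>The map \<open>(t, \<phi>) \<mapsto> (W t, F (t, \<phi>))\<close> into \<open>\<real> \<times> H\<^sup>2_loc\<close> has an injective derivative at \<open>p\<close>.\<close>

definition immersive_at ::
  "(real \<Rightarrow> real) \<Rightarrow> (real \<times> real \<Rightarrow> real \<Rightarrow> real^3) \<Rightarrow> real \<times> real \<Rightarrow> bool" where
  "immersive_at W F p \<longleftrightarrow> W differentiable (at (fst p)) \<and>
     (\<exists>D\<^sub>1 D\<^sub>2. has_H2_loc_derivs F D\<^sub>1 D\<^sub>2 p \<and>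
        (\<forall>\<alpha> \<beta>. \<alpha> * deriv W (fst p) = 0 \<and> (AE \<xi> in lebesgue. \<alpha> *\<^sub>R D\<^sub>1 \<xi> + \<beta> *\<^sub>R D\<^sub>2 \<xi> = 0)
           \<longrightarrow> \<alpha> = 0 \<and> \<beta> = 0))"


section \<open>Profiles\<close>

text \<open>Classical solutions of \<open>x \<times> x'' - \<Omega> e\<^sub>3 \<times> x + a x' = 0\<close> on the whole line.\<close>

definition solves_profile_eq :: "real \<Rightarrow> real \<Rightarrow> (real \<Rightarrow> real^3) \<Rightarrow> bool" where
  "solves_profile_eq a \<Omega> x \<longleftrightarrow> (\<exists>x' x''.
     (\<forall>\<xi>. (x has_vector_derivative x' \<xi>) (at \<xi>)) \<and>
     (\<forall>\<xi>. (x' has_vector_derivative x'' \<xi>) (at \<xi>)) \<and>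
     (\<forall>\<xi>. cross3 (x \<xi>) (x'' \<xi>) - \<Omega> *\<^sub>R cross3 (axis 3 1) (x \<xi>) + a *\<^sub>R x' \<xi> = 0))"

definition equatorial :: "real \<Rightarrow> real \<Rightarrow> real \<Rightarrow> real \<Rightarrow> real^3" where
  "equatorial R \<omega> \<phi>\<^sub>0 \<xi> = vector [R * cos (\<omega> * \<xi> + \<phi>\<^sub>0), R * sin (\<omega> * \<xi> + \<phi>\<^sub>0), 0]"

definition first_order_mode :: "nat \<Rightarrow> real \<Rightarrow> real \<Rightarrow> real \<Rightarrow> real^3" where
  "first_order_mode k \<omega> \<phi> \<xi> = vector
     [- sin (real k * (\<omega> * \<xi> - \<phi>)) * sin (\<omega> * \<xi>),
      sin (real k * (\<omega> * \<xi> - \<phi>)) * cos (\<omega> * \<xi>),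
      - (real k / sqrt ((real k)\<^sup>2 - 1)) * cos (real k * (\<omega> * \<xi> - \<phi>))]"

definition crit_lambda :: "real \<Rightarrow> nat \<Rightarrow> real" where
  "crit_lambda R k = R * sqrt ((real k)\<^sup>2 - 1)"

end

(*
  Rescaling time by omega = Omega/a and space by R turns the equation into
  u x u'' = mu (e3 x u - u') with mu = Lambda/R. This is a spherical pendulum in the field of a
  magnetic monopole, hence integrable: the vertical component of u x u' + mu u and an energy are
  conserved, and the height z satisfies z'^2 = P(z) with P cubic. In terms of the two small roots
  m - b, m + b of P one has z = m + b cos psi with psi' = kappa J(e) sqrt(1 - e cos psi); here e is
  the small parameter (b vanishes with e), and J(e) is chosen such that psi advances by 2 pi in
  the time 2 pi/kappa, kappa = k. What remains are two scalar equations for m and mu: the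
  compatibility of the coefficients of P, and the requirement that the longitude also advances by
  2 pi/kappa per oscillation. At e = 0 they are solvable by the implicit function theorem.
  The phase phi acts by a simultaneous time shift and rotation.
*)
theory Submission
  imports Defs
begin

section \<open>Smooth maps\<close>

text \<open>The obstacle is smoothness at the bifurcation point: as the oscillation shrinks, the two
  turning points of the height merge, and integrals between turning points become singular. The
  substitution z = m + b cos \<psi> absorbs the square roots of the cubic at both turning points,
  and e is chosen so that the phase equation depends on e alone; it is smooth through e = 0,
  negative e included. The factor J(e) fixes the oscillation period in advance, so the period is not
  a third unknown. Since \<kappa> = k is an integer, the closing condition makes the orbit close
  after k oscillations, that is after rescaled time 2 pi. At e = m = 0 compatibility reads 1 +
  \<mu>^2 = k^2, which is the origin of \<lambda>_k. Compatibility determines \<mu>, then closing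
  determines m; m has zero derivative at e = 0, so no constant vertical shift appears at first
  order. As the family is a smooth function of three real variables, smoothness into H^2_loc and the
  uniform remainder reduce to estimates on compact sets with classical derivatives.\<close>

text \<open>The recursion runs over derivatives in a fixed direction h, so each derivative has the
  type of f again and no spaces of multilinear maps occur. Derivatives are taken \<open>at p\<close>
  in the whole space, which makes the condition pointwise in U; openness of U enters with
  \<open>smooth_on\<close>.\<close>

primrec Cn_on :: "nat \<Rightarrow> 'a::real_normed_vector set \<Rightarrow> ('a \<Rightarrow> 'b::real_normed_vector) \<Rightarrow> bool" where
  "Cn_on 0 U f \<longleftrightarrow> (\<forall>p\<in>U. isCont f p)"
| "Cn_on (Suc n) U f \<longleftrightarrow> (\<forall>p\<in>U. f differentiable (at p)) \<and>
     (\<forall>h. Cn_on n U (\<lambda>p. frechet_derivative f (at p) h))"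

definition smooth_on :: "'a::real_normed_vector set \<Rightarrow> ('a \<Rightarrow> 'b::real_normed_vector) \<Rightarrow> bool" where
  "smooth_on U f \<longleftrightarrow> open U \<and> (\<forall>n. Cn_on n U f)"

lemma Cn_on_SucD: "Cn_on (Suc n) U f \<Longrightarrow> Cn_on n U f"
proof (induction n arbitrary: f)
  case 0
  then show ?case
    by (auto intro: differentiable_imp_continuous_within)
next
  case (Suc n)
  then show ?case by (metis Cn_on.simps(2))
qed

lemma Cn_on_subset: "Cn_on n U f \<Longrightarrow> V \<subseteq> U \<Longrightarrow> Cn_on n V f"
  by (induction n arbitrary: f) auto

lemma Cn_on_local: "(\<And>p. p \<in> U \<Longrightarrow> \<exists>V. p \<in> V \<and> Cn_on n V f) \<Longrightarrow> Cn_on n U f"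
proof (induction n arbitrary: f)
  case 0
  then show ?case by fastforce
next
  case (Suc n)
  have "Cn_on n U (\<lambda>p. frechet_derivative f (at p) h)" for h
    by (rule Suc.IH) (use Suc.prems in fastforce)
  then show ?case using Suc.prems by fastforce
qed

lemma frechet_derivative_cong_open:
  assumes "open U" "p \<in> U" "\<And>q. q \<in> U \<Longrightarrow> f q = g q" "f differentiable (at p)"
  shows "g differentiable (at p)" "frechet_derivative g (at p) = frechet_derivative f (at p)"
proof -
  have "(g has_derivative frechet_derivative f (at p)) (at p)"
    using has_derivative_transform_within_open[OF _ assms(1,2,3)] assms(4)
    by (simp add: frechet_derivative_works)
  then show "g differentiable (at p)" "frechet_derivative g (at p) = frechet_derivative f (at p)"
    by (auto simp: differentiable_def frechet_derivative_at[symmetric])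
qed

lemma Cn_on_cong:
  assumes "open U" "\<And>q. q \<in> U \<Longrightarrow> f q = g q" "Cn_on n U f"
  shows "Cn_on n U g"
  using assms(2,3)
proof (induction n arbitrary: f g)
  case 0
  have "isCont g p" if "p \<in> U" for p
  proof -
    have "eventually (\<lambda>q. f q = g q) (nhds p)"
      using 0(1) \<open>open U\<close> that eventually_nhds by blast
    then show ?thesis using 0 that isCont_cong by fastforce
  qed
  then show ?case by simp
next
  case (Suc n)
  have "Cn_on n U (\<lambda>p. frechet_derivative g (at p) h)" for h
    by (rule Suc.IH[where f = "\<lambda>p. frechet_derivative f (at p) h"])
      (use Suc.prems frechet_derivative_cong_open[OF \<open>open U\<close>, of _ f g] in auto)
  then show ?case
    using Suc.prems frechet_derivative_cong_open[OF \<open>open U\<close>, of _ f g] by auto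
qed

text \<open>Once a formula f' for the derivative is known, only f' in each fixed direction has to be
  examined one order lower. Most closure rules below are inductions through this rule.\<close>

lemma Cn_on_SucI:
  assumes "open U" "\<And>p. p \<in> U \<Longrightarrow> (f has_derivative f' p) (at p)"
    and "\<And>h. Cn_on n U (\<lambda>p. f' p h)"
  shows "Cn_on (Suc n) U f"
proof -
  have eq: "frechet_derivative f (at p) = f' p" if "p \<in> U" for p
    using assms(2)[OF that] frechet_derivative_at by fastforce
  have "Cn_on n U (\<lambda>p. frechet_derivative f (at p) h)" for h
    by (rule Cn_on_cong[OF assms(1) _ assms(3)[of h]]) (simp add: eq)
  moreover have "\<forall>p\<in>U. f differentiable (at p)"
    using assms(2) differentiable_def by blast
  ultimately show ?thesis by simp
qed

lemma Cn_on_has_derivative: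
  "Cn_on (Suc n) U f \<Longrightarrow> p \<in> U \<Longrightarrow> (f has_derivative frechet_derivative f (at p)) (at p)"
  using frechet_derivative_works by auto

lemma smooth_on_open: "smooth_on U f \<Longrightarrow> open U"
  by (simp add: smooth_on_def)

lemma smooth_on_Cn_on: "smooth_on U f \<Longrightarrow> Cn_on n U f"
  by (simp add: smooth_on_def)

lemma smooth_on_differentiable: "smooth_on U f \<Longrightarrow> p \<in> U \<Longrightarrow> f differentiable (at p)"
  using smooth_on_Cn_on[of U f 1] by simp

lemma smooth_on_has_derivative:
  "smooth_on U f \<Longrightarrow> p \<in> U \<Longrightarrow> (f has_derivative frechet_derivative f (at p)) (at p)"
  using smooth_on_differentiable frechet_derivative_works by blast

lemma smooth_on_isCont: "smooth_on U f \<Longrightarrow> p \<in> U \<Longrightarrow> isCont f p"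
  using smooth_on_Cn_on[of U f 0] by simp

lemma smooth_on_continuous_on: "smooth_on U f \<Longrightarrow> continuous_on U f"
  using smooth_on_isCont continuous_at_imp_continuous_on by blast

lemma smooth_on_frechet_derivative:
  "smooth_on U f \<Longrightarrow> smooth_on U (\<lambda>p. frechet_derivative f (at p) h)"
  unfolding smooth_on_def using Cn_on.simps(2) by blast

lemma smooth_on_subset: "smooth_on U f \<Longrightarrow> V \<subseteq> U \<Longrightarrow> open V \<Longrightarrow> smooth_on V f"
  unfolding smooth_on_def using Cn_on_subset by blast

lemma smooth_on_cong:
  "smooth_on U f \<Longrightarrow> (\<And>q. q \<in> U \<Longrightarrow> f q = g q) \<Longrightarrow> smooth_on U g"
  unfolding smooth_on_def using Cn_on_cong by blast

lemma smooth_on_local: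
  assumes "\<And>p. p \<in> U \<Longrightarrow> \<exists>V. p \<in> V \<and> smooth_on V f" "open U"
  shows "smooth_on U f"
  unfolding smooth_on_def
proof (intro conjI allI assms(2))
  show "Cn_on n U f" for n
    by (rule Cn_on_local) (use assms(1) smooth_on_Cn_on in blast)
qed

section \<open>Closure of smooth maps under linear and bilinear operations and composition\<close>

lemma Cn_on_const: "open U \<Longrightarrow> Cn_on n U (\<lambda>p. c)"
proof (induction n arbitrary: c)
  case (Suc n)
  show ?case
    by (rule Cn_on_SucI[OF Suc.prems, where f' = "\<lambda>p h. 0"]) (use Suc in auto)
qed simp

lemma Cn_on_bounded_linear_compose:
  assumes "bounded_linear L" "open U" "Cn_on n U f"
  shows "Cn_on n U (\<lambda>p. L (f p))"
  using assms(3)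
proof (induction n arbitrary: f)
  case 0
  then show ?case using bounded_linear.isCont[OF assms(1)] by auto
next
  case (Suc n)
  show ?case
  proof (rule Cn_on_SucI[OF assms(2), where f' = "\<lambda>p h. L (frechet_derivative f (at p) h)"])
    show "((\<lambda>p. L (f p)) has_derivative (\<lambda>h. L (frechet_derivative f (at p) h))) (at p)"
      if "p \<in> U" for p
      by (rule bounded_linear.has_derivative[OF assms(1)])
        (use Cn_on_has_derivative Suc.prems that in blast)
  qed (use Suc in auto)
qed

lemma Cn_on_id: "open U \<Longrightarrow> Cn_on n U (\<lambda>p. p)"
proof (cases n)
  case (Suc m)
  assume "open U"
  then show ?thesis unfolding Suc
    by (intro Cn_on_SucI[where f' = "\<lambda>p h. h"]) (auto intro: Cn_on_const)
qed simp

lemma Cn_on_add: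
  assumes "open U" "Cn_on n U f" "Cn_on n U g"
  shows "Cn_on n U (\<lambda>p. f p + g p)"
  using assms(2,3)
proof (induction n arbitrary: f g)
  case (Suc n)
  show ?case
    by (rule Cn_on_SucI[OF assms(1), where f' = "\<lambda>p h. frechet_derivative f (at p) h + frechet_derivative g (at p) h"])
      (use Suc Cn_on_has_derivative[OF Suc.prems(1)] Cn_on_has_derivative[OF Suc.prems(2)]
        in \<open>auto intro!: has_derivative_add\<close>)
qed auto

lemma Cn_on_sum:
  assumes "open U" "\<And>i. i \<in> I \<Longrightarrow> Cn_on n U (f i)"
  shows "Cn_on n U (\<lambda>p. \<Sum>i\<in>I. f i p)"
  using assms by (induction I rule: infinite_finite_induct) (auto intro: Cn_on_add Cn_on_const)

text \<open>Both terms of the product rule are again B of a derivative and an undifferentiated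
  factor, so the induction hypothesis applies after lowering the order of the latter with
  \<open>Cn_on_SucD\<close>.\<close>

lemma Cn_on_bounded_bilinear:
  assumes "bounded_bilinear B" "open U" "Cn_on n U f" "Cn_on n U g"
  shows "Cn_on n U (\<lambda>p. B (f p) (g p))"
  using assms(3,4)
proof (induction n arbitrary: f g)
  case 0
  then show ?case by (auto intro!: bounded_bilinear.isCont[OF assms(1)])
next
  case (Suc n)
  show ?case
  proof (rule Cn_on_SucI[OF assms(2), where f' = "\<lambda>p h. B (f p) (frechet_derivative g (at p) h) +
      B (frechet_derivative f (at p) h) (g p)"])
    show "((\<lambda>p. B (f p) (g p)) has_derivative (\<lambda>h. B (f p) (frechet_derivative g (at p) h) +
      B (frechet_derivative f (at p) h) (g p))) (at p)" if "p \<in> U" for p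
      by (rule bounded_bilinear.FDERIV[OF assms(1)])
        (use Cn_on_has_derivative Suc.prems that in blast)+
    show "Cn_on n U (\<lambda>p. B (f p) (frechet_derivative g (at p) h) + B (frechet_derivative f (at p) h) (g p))" for h
      using Suc.prems Suc.prems[THEN Cn_on_SucD] by (intro Cn_on_add[OF assms(2)] Suc.IH) auto
  qed
qed

lemma Cn_on_Pair:
  assumes "open U" "Cn_on n U f" "Cn_on n U g"
  shows "Cn_on n U (\<lambda>p. (f p, g p))"
proof -
  have "bounded_linear (\<lambda>x. (x, 0))" "bounded_linear (\<lambda>y. (0, y))"
    by (intro bounded_linear_Pair bounded_linear_ident bounded_linear_zero)+
  from Cn_on_add[OF assms(1) Cn_on_bounded_linear_compose[OF this(1) assms(1,2)]
      Cn_on_bounded_linear_compose[OF this(2) assms(1,3)]]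
  show ?thesis by simp
qed

text \<open>In the chain rule the direction Dg(p) h moves with p, whereas C^n speaks of fixed
  directions only. Expanding Dg(p) h in the basis of the middle space gives fixed directions with
  scalar coefficients, to which the product rule and the induction hypothesis apply; hence the
  Euclidean middle space.\<close>

lemma Cn_on_compose:
  fixes f :: "'b::euclidean_space \<Rightarrow> 'c::real_normed_vector" and g :: "'a::real_normed_vector \<Rightarrow> 'b"
  assumes "open U" "Cn_on n U g" "Cn_on n V f" "\<And>p. p \<in> U \<Longrightarrow> g p \<in> V"
  shows "Cn_on n U (\<lambda>p. f (g p))"
  using assms(2,3)
proof (induction n arbitrary: f)
  case 0
  then show ?case using assms(4) by (auto intro: isCont_o2)
next
  case (Suc n)
  let ?f' = "\<lambda>q. frechet_derivative f (at q)" and ?g' = "\<lambda>q. frechet_derivative g (at q)"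
  show ?case
  proof (rule Cn_on_SucI[OF assms(1), where f' = "\<lambda>p h. \<Sum>b\<in>Basis. (?g' p h \<bullet> b) *\<^sub>R ?f' (g p) b"])
    fix p assume p: "p \<in> U"
    have f: "(f has_derivative ?f' (g p)) (at (g p))" and g: "(g has_derivative ?g' p) (at p)"
      using Cn_on_has_derivative Suc.prems p assms(4) by blast+
    interpret bounded_linear "?f' (g p)" using f has_derivative_bounded_linear by blast
    have "(\<lambda>h. \<Sum>b\<in>Basis. (?g' p h \<bullet> b) *\<^sub>R ?f' (g p) b) = (\<lambda>h. ?f' (g p) (?g' p h))"
      by (metis (mono_tags, lifting) euclidean_representation scaleR sum sum.cong)
    then show "((\<lambda>p. f (g p)) has_derivative (\<lambda>h. \<Sum>b\<in>Basis. (?g' p h \<bullet> b) *\<^sub>R ?f' (g p) b)) (at p)"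
      using has_derivative_compose[OF g f] by simp
  next
    fix h
    show "Cn_on n U (\<lambda>p. \<Sum>b\<in>Basis. (?g' p h \<bullet> b) *\<^sub>R ?f' (g p) b)"
      using Suc.prems Cn_on_SucD[OF Suc.prems(1)]
      by (intro Cn_on_sum assms(1) Cn_on_bounded_bilinear[OF bounded_bilinear_scaleR]
          Cn_on_bounded_linear_compose[OF bounded_linear_inner_left] Suc.IH) auto
  qed
qed

lemma smooth_on_compose:
  fixes f :: "'b::euclidean_space \<Rightarrow> 'c::real_normed_vector"
  assumes "smooth_on V f" "smooth_on U g" "\<And>p. p \<in> U \<Longrightarrow> g p \<in> V"
  shows "smooth_on U (\<lambda>p. f (g p))"
  using assms unfolding smooth_on_def by (auto intro: Cn_on_compose)

named_theorems smooth_intros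

lemma smooth_on_const [smooth_intros]: "open U \<Longrightarrow> smooth_on U (\<lambda>p. c)"
  by (simp add: smooth_on_def Cn_on_const)

lemma smooth_on_id [smooth_intros]: "open U \<Longrightarrow> smooth_on U (\<lambda>p. p)"
  by (simp add: smooth_on_def Cn_on_id)

lemma smooth_on_bounded_linear:
  "bounded_linear L \<Longrightarrow> smooth_on U f \<Longrightarrow> smooth_on U (\<lambda>p. L (f p))"
  by (simp add: smooth_on_def Cn_on_bounded_linear_compose)

lemma smooth_on_bounded_bilinear:
  "bounded_bilinear B \<Longrightarrow> smooth_on U f \<Longrightarrow> smooth_on U g \<Longrightarrow> smooth_on U (\<lambda>p. B (f p) (g p))"
  by (simp add: smooth_on_def Cn_on_bounded_bilinear)

lemmas smooth_on_fst [smooth_intros] = smooth_on_bounded_linear[OF bounded_linear_fst]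
lemmas smooth_on_snd [smooth_intros] = smooth_on_bounded_linear[OF bounded_linear_snd]
lemmas smooth_on_minus [smooth_intros] =
  smooth_on_bounded_linear[OF bounded_linear_minus[OF bounded_linear_ident]]
lemmas smooth_on_scaleR [smooth_intros] = smooth_on_bounded_bilinear[OF bounded_bilinear_scaleR]

lemma smooth_on_mult [smooth_intros]:
  fixes f g :: "'a::real_normed_vector \<Rightarrow> 'b::real_normed_algebra"
  shows "smooth_on U f \<Longrightarrow> smooth_on U g \<Longrightarrow> smooth_on U (\<lambda>p. f p * g p)"
  by (rule smooth_on_bounded_bilinear[OF bounded_bilinear_mult])

lemma smooth_on_add [smooth_intros]:
  "smooth_on U f \<Longrightarrow> smooth_on U g \<Longrightarrow> smooth_on U (\<lambda>p. f p + g p)"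
  by (simp add: smooth_on_def Cn_on_add)

lemma smooth_on_diff [smooth_intros]:
  "smooth_on U f \<Longrightarrow> smooth_on U g \<Longrightarrow> smooth_on U (\<lambda>p. f p - g p)"
  using smooth_on_add[OF _ smooth_on_minus, of U f g] by simp

lemma smooth_on_power [smooth_intros]:
  fixes f :: "'a::real_normed_vector \<Rightarrow> 'b::real_normed_algebra_1"
  shows "smooth_on U f \<Longrightarrow> smooth_on U (\<lambda>p. f p ^ n)"
  by (induction n) (auto intro: smooth_on_const smooth_on_mult smooth_on_open)

lemma smooth_on_Pair [smooth_intros]:
  "smooth_on U f \<Longrightarrow> smooth_on U g \<Longrightarrow> smooth_on U (\<lambda>p. (f p, g p))"
  by (simp add: smooth_on_def Cn_on_Pair)

lemma smooth_on_vector3 [smooth_intros]: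
  fixes f g h :: "'a::real_normed_vector \<Rightarrow> real"
  assumes "smooth_on U f" "smooth_on U g" "smooth_on U h"
  shows "smooth_on U (\<lambda>p. vector [f p, g p, h p] :: real^3)"
proof -
  have "(\<lambda>p. vector [f p, g p, h p] :: real^3) =
      (\<lambda>p. f p *\<^sub>R axis 1 1 + g p *\<^sub>R axis 2 1 + h p *\<^sub>R axis 3 1)"
    by (auto simp: vec_eq_iff forall_3 axis_def)
  then show ?thesis using assms
    by (auto intro!: smooth_intros intro: smooth_on_open)
qed

section \<open>Smoothness of the elementary functions on their domains\<close>

text \<open>The two functions are each other's derivatives up to sign, hence one joint
  induction.\<close>

lemma Cn_on_sin_cos: "Cn_on n UNIV (sin :: real \<Rightarrow> real) \<and> Cn_on n UNIV (cos :: real \<Rightarrow> real)"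
proof (induction n)
  case (Suc n)
  show ?case
  proof
    show "Cn_on (Suc n) UNIV (sin :: real \<Rightarrow> real)"
      by (rule Cn_on_SucI[where f' = "\<lambda>p h. h * cos p"])
        (use Suc in \<open>auto intro!: derivative_eq_intros Cn_on_bounded_linear_compose[OF bounded_linear_mult_right]\<close>)
    show "Cn_on (Suc n) UNIV (cos :: real \<Rightarrow> real)"
      by (rule Cn_on_SucI[where f' = "\<lambda>p h. - (h * sin p)"])
        (use Suc in \<open>auto intro!: derivative_eq_intros Cn_on_bounded_linear_compose[OF bounded_linear_mult_right]
           Cn_on_bounded_linear_compose[OF bounded_linear_minus[OF bounded_linear_ident]]\<close>)
  qed
qed auto

lemma smooth_on_sin [smooth_intros]:
  fixes f :: "'a::real_normed_vector \<Rightarrow> real"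
  shows "smooth_on U f \<Longrightarrow> smooth_on U (\<lambda>p. sin (f p))"
  by (rule smooth_on_compose[of UNIV]) (auto simp: smooth_on_def Cn_on_sin_cos)

lemma smooth_on_cos [smooth_intros]:
  fixes f :: "'a::real_normed_vector \<Rightarrow> real"
  shows "smooth_on U f \<Longrightarrow> smooth_on U (\<lambda>p. cos (f p))"
  by (rule smooth_on_compose[of UNIV]) (auto simp: smooth_on_def Cn_on_sin_cos)

text \<open>Writing the derivative as a product of inverses lets the induction hypothesis cover
  it.\<close>

lemma Cn_on_inverse: "Cn_on n (- {0}) (inverse :: real \<Rightarrow> real)"
proof (induction n)
  case (Suc n)
  show ?case
    by (rule Cn_on_SucI[where f' = "\<lambda>p h. - (inverse p * h * inverse p)"])
      (use Suc in \<open>auto intro!: derivative_eq_intros Cn_on_bounded_bilinear[OF bounded_bilinear_mult]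
          Cn_on_bounded_linear_compose[OF bounded_linear_minus[OF bounded_linear_ident]] Cn_on_const\<close>)
qed (auto intro: continuous_at_within_inverse)

lemma smooth_on_inverse [smooth_intros]:
  fixes f :: "'a::real_normed_vector \<Rightarrow> real"
  assumes "smooth_on U f" "\<And>p. p \<in> U \<Longrightarrow> f p \<noteq> 0"
  shows "smooth_on U (\<lambda>p. inverse (f p))"
  by (rule smooth_on_compose[of "- {0}", OF _ assms(1)]) (use assms in \<open>auto simp: smooth_on_def Cn_on_inverse\<close>)

lemma smooth_on_divide [smooth_intros]:
  fixes f g :: "'a::real_normed_vector \<Rightarrow> real"
  assumes "smooth_on U f" "smooth_on U g" "\<And>p. p \<in> U \<Longrightarrow> g p \<noteq> 0"
  shows "smooth_on U (\<lambda>p. f p / g p)"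
  unfolding divide_inverse by (intro smooth_intros assms)

lemma Cn_on_sqrt: "Cn_on n {0<..} sqrt"
proof (induction n)
  case (Suc n)
  show ?case
  proof (rule Cn_on_SucI[where f' = "\<lambda>p h. h / 2 * inverse (sqrt p)"])
    show "Cn_on n {0<..} (\<lambda>p. h / 2 * inverse (sqrt p))" for h
      by (rule Cn_on_bounded_linear_compose[OF bounded_linear_mult_right],
        simp, rule Cn_on_compose[OF _ Suc Cn_on_inverse]) auto
  qed (auto intro!: derivative_eq_intros simp: field_simps)
qed (auto intro: isCont_real_sqrt)

lemma smooth_on_sqrt [smooth_intros]:
  assumes "smooth_on U f" "\<And>p. p \<in> U \<Longrightarrow> f p > 0"
  shows "smooth_on U (\<lambda>p. sqrt (f p))"
  by (rule smooth_on_compose[of "{0<..}", OF _ assms(1)]) (use assms in \<open>auto simp: smooth_on_def Cn_on_sqrt\<close>)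

text \<open>The bridge to the iterated \<open>deriv\<close>. Since \<open>deriv\<close> at a point
  depends only on values near it, it suffices that on the open set S every iterate agrees with some
  smooth g, whose own derivative then represents the next iterate.\<close>

lemma smooth_on_imp_smooth_real_on:
  assumes "smooth_on S f"
  shows "smooth_real_on S f"
proof -
  have "\<exists>g. smooth_on S g \<and> (\<forall>s\<in>S. (deriv ^^ n) f s = g s)" for n
  proof (induction n)
    case 0
    then show ?case using assms by auto
  next
    case (Suc n)
    then obtain g where g: "smooth_on S g" "\<forall>s\<in>S. (deriv ^^ n) f s = g s" by blast
    have "deriv ((deriv ^^ n) f) s = frechet_derivative g (at s) 1" if "s \<in> S" for s
    proof -
      have "(g has_field_derivative frechet_derivative g (at s) 1) (at s)"
        using smooth_on_has_derivative[OF g(1) that] linear_times_of_real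
        by (metis DERIV_deriv_iff_real_differentiable frechet_derivative_at has_field_derivative_def
            lambda_one mult.right_neutral smooth_on_differentiable[OF g(1) that])
      then have "((deriv ^^ n) f has_field_derivative frechet_derivative g (at s) 1) (at s)"
        by (rule has_field_derivative_transform_within_open[OF _ smooth_on_open[OF g(1)] that]) (use g in auto)
      then show ?thesis by (rule DERIV_imp_deriv)
    qed
    then show ?case using smooth_on_frechet_derivative[OF g(1)] by auto
  qed
  then show ?thesis unfolding smooth_real_on_def
    by (metis frechet_derivative_cong_open(1) smooth_on_differentiable smooth_on_open)
qed

section \<open>Second derivatives, parameter integrals and implicit functions\<close>

lemma has_derivative_along_line:
  assumes "(f has_derivative f') (at (q + r *\<^sub>R h))"
  shows "((\<lambda>r. f (q + r *\<^sub>R h)) has_vector_derivative f' h) (at r)"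
proof -
  have "((\<lambda>r. q + r *\<^sub>R h) has_derivative (\<lambda>s. s *\<^sub>R h)) (at r)"
    by (auto intro!: derivative_eq_intros)
  from has_derivative_compose[OF this assms] show ?thesis
    unfolding has_vector_derivative_def
    using linear_scale[OF has_derivative_linear[OF assms]] by simp
qed

text \<open>The mixed second difference is the increment over [0, s] of g, the difference of f along
  two parallel segments. One mean value step in direction h and one in direction k turn it into s^2
  times a second derivative nearby.\<close>

lemma mixed_difference_mean_value:
  fixes f :: "'a::real_normed_vector \<Rightarrow> real"
  assumes f: "smooth_on U f" and \<rho>: "ball p \<rho> \<subseteq> U" and s: "s > 0" "s * (norm h + norm k) < \<rho>"
  shows "\<exists>x\<in>ball p \<rho>. f (p + s *\<^sub>R h + s *\<^sub>R k) - f (p + s *\<^sub>R h) - f (p + s *\<^sub>R k) + f p =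
    s\<^sup>2 * frechet_derivative (\<lambda>q. frechet_derivative f (at q) h) (at x) k"
proof -
  let ?f' = "\<lambda>q. frechet_derivative f (at q) h"
  have in_ball: "p + r *\<^sub>R h + r' *\<^sub>R k \<in> ball p \<rho>" if "0 \<le> r" "r \<le> s" "0 \<le> r'" "r' \<le> s" for r r'
  proof -
    have "norm (r *\<^sub>R h + r' *\<^sub>R k) \<le> r * norm h + r' * norm k"
      using that by (intro order.trans[OF norm_triangle_ineq]) auto
    also have "\<dots> \<le> s * norm h + s * norm k"
      using that by (intro add_mono mult_right_mono) auto
    finally show ?thesis using s by (simp add: dist_norm algebra_simps norm_minus_commute)
  qed
  define g where "g r = f (p + s *\<^sub>R k + r *\<^sub>R h) - f (p + r *\<^sub>R h)" for r
  have "\<exists>z>0. z < s \<and> g s - g 0 = (s - 0) * (?f' (p + s *\<^sub>R k + z *\<^sub>R h) - ?f' (p + z *\<^sub>R h))"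
  proof (rule MVT2[OF s(1)])
    fix r assume r: "0 \<le> r" "r \<le> s"
    have "p + s *\<^sub>R k + r *\<^sub>R h \<in> U" "p + r *\<^sub>R h \<in> U"
      using in_ball[of r s] in_ball[of r 0] r s \<rho> by (auto simp: algebra_simps)
    then show "(g has_real_derivative ?f' (p + s *\<^sub>R k + r *\<^sub>R h) - ?f' (p + r *\<^sub>R h)) (at r)"
      unfolding g_def has_real_derivative_iff_has_vector_derivative
      by (intro has_vector_derivative_diff has_derivative_along_line smooth_on_has_derivative[OF f])
  qed
  then obtain z where z: "0 < z" "z < s"
    and gz: "g s - g 0 = s * (?f' (p + z *\<^sub>R h + s *\<^sub>R k) - ?f' (p + z *\<^sub>R h))"
    by (auto simp: algebra_simps)
  have "\<exists>y>0. y < s \<and> ?f' (p + z *\<^sub>R h + s *\<^sub>R k) - ?f' (p + z *\<^sub>R h + 0 *\<^sub>R k) =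
      (s - 0) * frechet_derivative ?f' (at (p + z *\<^sub>R h + y *\<^sub>R k)) k"
  proof (rule MVT2[OF s(1)])
    fix r assume r: "0 \<le> r" "r \<le> s"
    have "p + z *\<^sub>R h + r *\<^sub>R k \<in> U" using in_ball[of z r] r z \<rho> by auto
    then show "((\<lambda>r. ?f' (p + z *\<^sub>R h + r *\<^sub>R k)) has_real_derivative
        frechet_derivative ?f' (at (p + z *\<^sub>R h + r *\<^sub>R k)) k) (at r)"
      unfolding has_real_derivative_iff_has_vector_derivative
      by (intro has_derivative_along_line
          smooth_on_has_derivative[OF smooth_on_frechet_derivative[OF f]])
  qed
  then obtain y where y: "0 < y" "y < s" and fy: "?f' (p + z *\<^sub>R h + s *\<^sub>R k) - ?f' (p + z *\<^sub>R h) =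
      s * frechet_derivative ?f' (at (p + z *\<^sub>R h + y *\<^sub>R k)) k"
    by auto
  show ?thesis
  proof (intro bexI)
    show "p + z *\<^sub>R h + y *\<^sub>R k \<in> ball p \<rho>" using in_ball[of z y] y z by auto
    show "f (p + s *\<^sub>R h + s *\<^sub>R k) - f (p + s *\<^sub>R h) - f (p + s *\<^sub>R k) + f p =
      s\<^sup>2 * frechet_derivative ?f' (at (p + z *\<^sub>R h + y *\<^sub>R k)) k"
      using gz unfolding fy g_def by (simp add: power2_eq_square algebra_simps)
  qed
qed

text \<open>The mixed second difference is symmetric in h and k, so
  \<open>mixed_difference_mean_value\<close> in both orders equates the two mixed derivatives, each
  at its own point near p. Continuity of both at p then leaves no gap.\<close>

lemma symmetric_frechet_derivative_real:
  fixes f :: "'a::real_normed_vector \<Rightarrow> real"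
  assumes f: "smooth_on U f" and p: "p \<in> U"
  shows "frechet_derivative (\<lambda>q. frechet_derivative f (at q) h) (at p) k =
    frechet_derivative (\<lambda>q. frechet_derivative f (at q) k) (at p) h"
proof -
  define A where "A x = frechet_derivative (\<lambda>q. frechet_derivative f (at q) h) (at x) k" for x
  define B where "B x = frechet_derivative (\<lambda>q. frechet_derivative f (at q) k) (at x) h" for x
  have cont: "isCont A p" "isCont B p"
    unfolding A_def B_def
    by (intro smooth_on_isCont[OF _ p] smooth_on_frechet_derivative f)+
  have "\<bar>A p - B p\<bar> \<le> e" if "e > 0" for e
  proof -
    obtain d1 where d1: "d1 > 0" "\<And>x. dist x p < d1 \<Longrightarrow> \<bar>A x - A p\<bar> < e / 2"
      using cont(1)[unfolded continuous_at_eps_delta, rule_format, OF half_gt_zero[OF \<open>e > 0\<close>]]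
      by (auto simp: dist_real_def)
    obtain d2 where d2: "d2 > 0" "\<And>x. dist x p < d2 \<Longrightarrow> \<bar>B x - B p\<bar> < e / 2"
      using cont(2)[unfolded continuous_at_eps_delta, rule_format, OF half_gt_zero[OF \<open>e > 0\<close>]]
      by (auto simp: dist_real_def)
    obtain d3 where d3: "d3 > 0" "ball p d3 \<subseteq> U"
      using p smooth_on_open[OF f] openE by blast
    define \<rho> where "\<rho> = min d1 (min d2 d3)"
    have \<rho>: "\<rho> > 0" "ball p \<rho> \<subseteq> U" using d1 d2 d3 by (auto simp: \<rho>_def)
    \<comment> \<open>The summand 1 keeps the denominator positive when h = k = 0, and the factor 2
      gives the strict inequality that the mean value step asks for.\<close>
    define s where "s = \<rho> / (2 * (norm h + norm k + 1))"
    have s: "s > 0" using \<rho> by (auto simp: s_def intro!: divide_pos_pos add_nonneg_pos)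
    have "s * (norm h + norm k) < \<rho>"
    proof -
      have "s * (norm h + norm k) \<le> s * (norm h + norm k + 1)" using s by simp
      also have "\<dots> = \<rho> / 2"
        using norm_ge_zero[of h] norm_ge_zero[of k] by (simp add: s_def field_simps add_nonneg_eq_0_iff)
      finally show ?thesis using \<rho> by simp
    qed
    note mv = mixed_difference_mean_value[OF f \<rho>(2) s]
    obtain x where x: "x \<in> ball p \<rho>"
      "f (p + s *\<^sub>R h + s *\<^sub>R k) - f (p + s *\<^sub>R h) - f (p + s *\<^sub>R k) + f p = s\<^sup>2 * A x"
      using mv[of h k] \<open>s * (norm h + norm k) < \<rho>\<close> unfolding A_def by blast
    obtain y where y: "y \<in> ball p \<rho>"
      "f (p + s *\<^sub>R k + s *\<^sub>R h) - f (p + s *\<^sub>R k) - f (p + s *\<^sub>R h) + f p = s\<^sup>2 * B y"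
      using mv[of k h] \<open>s * (norm h + norm k) < \<rho>\<close> unfolding B_def by (metis add.commute)
    have "s\<^sup>2 * A x = s\<^sup>2 * B y"
      using x(2) y(2) by (simp add: algebra_simps)
    then have "A x = B y" using s by simp
    moreover have "\<bar>A x - A p\<bar> < e / 2" "\<bar>B y - B p\<bar> < e / 2"
      using d1 d2 x y by (auto simp: \<rho>_def dist_commute)
    ultimately show ?thesis by linarith
  qed
  then have "\<bar>A p - B p\<bar> \<le> 0" by (rule field_le_epsilon) simp
  then show ?thesis by (simp add: A_def B_def)
qed

lemma frechet_derivative_inner:
  assumes "f differentiable (at p)"
  shows "frechet_derivative (\<lambda>q. f q \<bullet> b) (at p) h = frechet_derivative f (at p) h \<bullet> b"
proof -
  have "((\<lambda>q. f q \<bullet> b) has_derivative (\<lambda>h. frechet_derivative f (at p) h \<bullet> b)) (at p)"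
    using assms by (intro has_derivative_inner_left) (simp add: frechet_derivative_works)
  from frechet_derivative_at[OF this] show ?thesis by metis
qed

text \<open>The mean value theorem is scalar, so vector values are treated by pairing with each
  basis vector.\<close>

lemma symmetric_frechet_derivative:
  fixes f :: "'a::real_normed_vector \<Rightarrow> 'b::euclidean_space"
  assumes f: "smooth_on U f" and p: "p \<in> U"
  shows "frechet_derivative (\<lambda>q. frechet_derivative f (at q) h) (at p) k =
    frechet_derivative (\<lambda>q. frechet_derivative f (at q) k) (at p) h"
proof (rule euclidean_eqI)
  fix b :: 'b
  have sm: "smooth_on U (\<lambda>q. f q \<bullet> b)"
    by (rule smooth_on_bounded_linear[OF bounded_linear_inner_left f])
  have *: "frechet_derivative (\<lambda>q. frechet_derivative f (at q) u) (at p) v \<bullet> b =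
     frechet_derivative (\<lambda>q. frechet_derivative (\<lambda>q. f q \<bullet> b) (at q) u) (at p) v" for u v
  proof -
    have "frechet_derivative (\<lambda>q. frechet_derivative f (at q) u) (at p) v \<bullet> b =
       frechet_derivative (\<lambda>q. frechet_derivative f (at q) u \<bullet> b) (at p) v"
      by (rule frechet_derivative_inner[symmetric])
        (rule smooth_on_differentiable[OF smooth_on_frechet_derivative[OF f] p])
    also have "\<dots> = frechet_derivative (\<lambda>q. frechet_derivative (\<lambda>q. f q \<bullet> b) (at q) u) (at p) v"
    proof (rule fun_cong[OF frechet_derivative_cong_open(2)[OF smooth_on_open[OF f] p,
        where f = "\<lambda>q. frechet_derivative (\<lambda>q. f q \<bullet> b) (at q) u"
          and g = "\<lambda>q. frechet_derivative f (at q) u \<bullet> b"]])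
      show "frechet_derivative (\<lambda>q. f q \<bullet> b) (at q) u = frechet_derivative f (at q) u \<bullet> b" if "q \<in> U" for q
        by (rule frechet_derivative_inner[OF smooth_on_differentiable[OF f that]])
      show "(\<lambda>q. frechet_derivative (\<lambda>q. f q \<bullet> b) (at q) u) differentiable at p"
        by (rule smooth_on_differentiable[OF smooth_on_frechet_derivative[OF sm] p])
    qed
    finally show ?thesis .
  qed
  show "frechet_derivative (\<lambda>q. frechet_derivative f (at q) h) (at p) k \<bullet> b =
    frechet_derivative (\<lambda>q. frechet_derivative f (at q) k) (at p) h \<bullet> b"
    unfolding * by (rule symmetric_frechet_derivative_real[OF sm p])
qed

section \<open>Operator-valued derivatives and integrals depending on a parameter\<close>

text \<open>The inverse function theorem and differentiation under the integral take the derivative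
  as a bounded operator varying continuously in operator norm. On a finite-dimensional domain this
  follows from continuity in each fixed direction.\<close>

lemma smooth_on_has_blinfun_derivative:
  fixes f :: "'a::euclidean_space \<Rightarrow> 'b::real_normed_vector"
  assumes "smooth_on U f"
  obtains f' :: "'a \<Rightarrow> 'a \<Rightarrow>\<^sub>L 'b" where "\<And>p. p \<in> U \<Longrightarrow> (f has_derivative f' p) (at p)"
    "continuous_on U f'" "\<And>p. p \<in> U \<Longrightarrow> blinfun_apply (f' p) = frechet_derivative f (at p)"
proof
  let ?f' = "\<lambda>p. Blinfun (frechet_derivative f (at p))"
  have ap: "blinfun_apply (?f' p) = frechet_derivative f (at p)" if "p \<in> U" for p
    by (rule bounded_linear_Blinfun_apply)
      (rule has_derivative_bounded_linear[OF smooth_on_has_derivative[OF assms that]])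
  then show "\<And>p. p \<in> U \<Longrightarrow> blinfun_apply (?f' p) = frechet_derivative f (at p)" .
  show "(f has_derivative ?f' p) (at p)" if "p \<in> U" for p
    unfolding ap[OF that] by (rule smooth_on_has_derivative[OF assms that])
  show "continuous_on U ?f'"
  proof (rule continuous_on_blinfun_componentwise)
    show "continuous_on U (\<lambda>x. ?f' x i)" for i
      using smooth_on_continuous_on[OF smooth_on_frechet_derivative[OF assms, of i]]
      by (rule continuous_on_eq) (simp add: ap)
  qed
qed

text \<open>Differentiation under the integral sign replaces the integrand by a partial derivative
  in p, which is smooth on the same W; so the induction generalises over f.\<close>

lemma Cn_on_integral:
  fixes f :: "'a::euclidean_space \<times> real \<Rightarrow> 'b::banach"
  assumes "smooth_on W f" "open U" "\<And>p r. p \<in> U \<Longrightarrow> r \<in> {0..1} \<Longrightarrow> (p, r) \<in> W"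
  shows "Cn_on n U (\<lambda>p. integral {0..1} (\<lambda>r. f (p, r)))"
  using assms(1)
proof (induction n arbitrary: f)
  case (0 f)
  have "continuous_on U (\<lambda>p. integral (cbox 0 1) (\<lambda>r. f (p, r)))"
    by (rule integral_continuous_on_param)
      (use assms(3) in \<open>auto intro!: continuous_on_subset[OF smooth_on_continuous_on[OF 0]]\<close>)
  then show ?case using assms(2) by (simp add: continuous_on_eq_continuous_at)
next
  case (Suc n f)
  show ?case
  proof (rule Cn_on_SucI[OF assms(2)])
    show "Cn_on n U (\<lambda>p. integral {0..1} (\<lambda>r. frechet_derivative f (at (p, r)) (h, 0)))" for h
      by (rule Suc.IH) (rule smooth_on_frechet_derivative[OF Suc.prems])
  next
    fix p assume p: "p \<in> U"
    obtain \<rho> where \<rho>: "\<rho> > 0" "ball p \<rho> \<subseteq> U" using p assms(2) openE by blast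
    obtain f' where f': "\<And>q. q \<in> W \<Longrightarrow> (f has_derivative blinfun_apply (f' q)) (at q)"
      "continuous_on W f'" "\<And>q. q \<in> W \<Longrightarrow> blinfun_apply (f' q) = frechet_derivative f (at q)"
      using smooth_on_has_blinfun_derivative[OF Suc.prems] by blast
    \<comment> \<open>The embedding of the parameter space as an operator: composing the full
      derivative with it gives the partial derivative in p.\<close>
    define i :: "'a \<Rightarrow>\<^sub>L ('a \<times> real)" where "i = Blinfun (\<lambda>h. (h, 0))"
    have i: "blinfun_apply i h = (h, 0)" for h
      unfolding i_def by (subst bounded_linear_Blinfun_apply)
        (auto intro!: bounded_linear_Pair bounded_linear_ident bounded_linear_zero)
    have W: "(q, r) \<in> W" if "q \<in> ball p \<rho>" "r \<in> {0..1}" for q r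
      using that \<rho> assms(3) by blast
    have cont: "continuous_on (ball p \<rho> \<times> cbox 0 1) (\<lambda>(q, r). f' (q, r) o\<^sub>L i)"
      unfolding case_prod_unfold
      by (intro continuous_intros continuous_on_compose2[OF f'(2)]) (use W in auto)
    have "((\<lambda>q. integral (cbox 0 1) (\<lambda>r. f (q, r))) has_derivative
       integral (cbox 0 1) (\<lambda>r. f' (p, r) o\<^sub>L i)) (at p within ball p \<rho>)"
    proof (rule leibniz_rule[OF _ _ cont])
      show "((\<lambda>q. f (q, r)) has_derivative (f' (q, r) o\<^sub>L i)) (at q within ball p \<rho>)"
        if "q \<in> ball p \<rho>" "r \<in> cbox 0 1" for q r
      proof -
        have "((\<lambda>q. (q, r)) has_derivative i) (at q within ball p \<rho>)"
          unfolding i[abs_def] by (auto intro!: derivative_eq_intros)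
        from has_derivative_compose[OF this f'(1)[OF W]] show ?thesis
          using that by (simp add: blinfun_compose.rep_eq o_def)
      qed
      show "(\<lambda>r. f (q, r)) integrable_on cbox 0 1" if "q \<in> ball p \<rho>" for q
        by (rule integrable_continuous)
          (use W that in \<open>auto intro!: continuous_on_compose2[OF smooth_on_continuous_on[OF Suc.prems]] continuous_intros\<close>)
    qed (use \<rho> in auto)
    moreover have "blinfun_apply (integral (cbox 0 1) (\<lambda>r. f' (p, r) o\<^sub>L i)) h =
        integral {0..1} (\<lambda>r. frechet_derivative f (at (p, r)) (h, 0))" for h
    proof -
      have int: "(\<lambda>r. f' (p, r) o\<^sub>L i) integrable_on cbox 0 1"
      proof (rule integrable_continuous)
        have "continuous_on (cbox 0 1) (\<lambda>r. (p, r))" by (intro continuous_intros)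
        from continuous_on_compose2[OF cont this] show "continuous_on (cbox 0 1) (\<lambda>r. f' (p, r) o\<^sub>L i)"
          using \<rho>(1) by (auto simp: case_prod_unfold image_subset_iff)
      qed
      have "blinfun_apply (integral (cbox 0 1) (\<lambda>r. f' (p, r) o\<^sub>L i)) h =
          integral (cbox 0 1) (\<lambda>r. blinfun_apply (f' (p, r) o\<^sub>L i) h)"
        by (rule blinfun_apply_integral[OF int])
      also have "\<dots> = integral (cbox 0 1) (\<lambda>r. frechet_derivative f (at (p, r)) (h, 0))"
        by (rule integral_cong) (use p assms(3) in \<open>simp add: i f'(3)\<close>)
      finally show ?thesis by simp
    qed
    then have "blinfun_apply (integral (cbox 0 1) (\<lambda>r. f' (p, r) o\<^sub>L i)) =
        (\<lambda>h. integral {0..1} (\<lambda>r. frechet_derivative f (at (p, r)) (h, 0)))" ..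
    ultimately show "((\<lambda>p. integral {0..1} (\<lambda>r. f (p, r))) has_derivative
        (\<lambda>h. integral {0..1} (\<lambda>r. frechet_derivative f (at (p, r)) (h, 0)))) (at p)"
      using \<rho> at_within_open[of p "ball p \<rho>"] by simp
  qed
qed

text \<open>Written as s times the integral of f(p, s r) over r in [0, 1], the antiderivative has a
  fixed interval of integration, and s becomes one more parameter for
  \<open>Cn_on_integral\<close>.\<close>

lemma smooth_on_antiderivative:
  fixes f :: "'a::euclidean_space \<times> real \<Rightarrow> real"
  assumes f: "smooth_on (U \<times> UNIV) f" and U: "open U"
  obtains F where "smooth_on (U \<times> UNIV) F" "\<And>p. F (p, 0) = 0"
    "\<And>p s. p \<in> U \<Longrightarrow> ((\<lambda>s. F (p, s)) has_real_derivative f (p, s)) (at s)"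
proof
  let ?I = "\<lambda>q. integral {0..1} (\<lambda>r. f (fst q, snd q * r))"
  let ?F = "\<lambda>q. snd q * ?I q"
  have opn: "open (U \<times> (UNIV::real set))" using U by (intro open_Times) auto
  have sm: "smooth_on (U \<times> UNIV) ?I"
    unfolding smooth_on_def
  proof (intro conjI allI opn)
    fix n
    show "Cn_on n (U \<times> UNIV) ?I"
    proof -
      have "open ((U \<times> (UNIV :: real set)) \<times> (UNIV :: real set))"
        by (intro open_Times U open_UNIV)
      then have "smooth_on ((U \<times> UNIV) \<times> UNIV) (\<lambda>x. f (fst (fst x), snd (fst x) * snd x))"
        by (intro smooth_on_compose[OF f, where g = "\<lambda>x. (fst (fst x), snd (fst x) * snd x)"] smooth_intros) auto
      from Cn_on_integral[OF this opn] show ?thesis by simp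
    qed
  qed
  show "smooth_on (U \<times> UNIV) ?F"
    by (intro smooth_intros sm opn)
  show "?F (p, 0) = 0" for p by simp
  show "((\<lambda>s. ?F (p, s)) has_real_derivative f (p, s)) (at s)" if p: "p \<in> U" for p s
  proof -
    \<comment> \<open>The margin 1 puts s into the interior of [-N, N], where the derivative of G
      within the interval is a two-sided one.\<close>
    define N where "N = \<bar>s\<bar> + 1"
    have cont: "continuous_on A (\<lambda>r. f (p, r))" for A
    proof (rule continuous_on_compose2[OF smooth_on_continuous_on[OF f], where f = "\<lambda>r. (p, r)"])
      show "continuous_on A (\<lambda>r. (p, r))" by (intro continuous_intros)
    qed (use p in auto)
    obtain G where G: "\<And>r. r \<in> {-N..N} \<Longrightarrow> (G has_vector_derivative f (p, r)) (at r within {-N..N})"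
      using antiderivative_continuous[OF cont] by blast
    have eq: "?F (p, s') = G s' - G 0" if s': "s' \<in> {-N<..<N}" for s'
    proof -
      have in_N: "s' * r \<in> {-N..N}" if "r \<in> {0..1}" for r
      proof -
        have "\<bar>s' * r\<bar> \<le> \<bar>s'\<bar> * 1" unfolding abs_mult using that by (intro mult_left_mono) auto
        then show ?thesis using s' by auto
      qed
      have "((\<lambda>r. s' * f (p, s' * r)) has_integral G (s' * 1) - G (s' * 0)) {0..1}"
      proof (rule fundamental_theorem_of_calculus)
        fix r :: real assume r: "r \<in> {0..1}"
        have "((\<lambda>r. s' * r) has_vector_derivative s') (at r within {0..1})"
          by (auto intro!: derivative_eq_intros)
        moreover have "(G has_vector_derivative f (p, s' * r)) (at (s' * r) within (\<lambda>r. s' * r) ` {0..1})"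
          by (rule has_vector_derivative_within_subset[OF G[OF in_N[OF r]]]) (use in_N in auto)
        ultimately have "(G \<circ> (\<lambda>r. s' * r) has_vector_derivative s' *\<^sub>R f (p, s' * r)) (at r within {0..1})"
          by (rule vector_diff_chain_within)
        then show "((\<lambda>r. G (s' * r)) has_vector_derivative s' * f (p, s' * r)) (at r within {0..1})"
          by (simp add: o_def)
      qed simp
      from integral_unique[OF this] show ?thesis by simp
    qed
    have "s \<in> {-N<..<N}" by (auto simp: N_def)
    then have "(G has_vector_derivative f (p, s)) (at s)"
      using G[of s] at_within_interior[of s "{-N..N}"] by (simp add: interior_atLeastAtMost_real)
    then have "((\<lambda>s. G s - G 0) has_real_derivative f (p, s)) (at s)"
      unfolding has_real_derivative_iff_has_vector_derivative by (auto intro!: derivative_eq_intros)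
    then show ?thesis
      by (rule has_field_derivative_transform_within_open[where S = "{-N<..<N}"])
        (use eq \<open>s \<in> {-N<..<N}\<close> in auto)
  qed
qed

section \<open>The implicit function theorem with smoothness of all orders\<close>

text \<open>Inverting (p, y) \<mapsto> (p, F(p, y)) gives a differentiable Y. Higher smoothness is a
  bootstrap: DY = - F_p / F_y at (p, Y p) is C^n whenever Y is, and then Y is of class n +
  1.\<close>

lemma implicit_function_smooth:
  fixes F :: "'a::euclidean_space \<times> real \<Rightarrow> real"
  assumes F: "smooth_on U F" and in_U: "(p0, y0) \<in> U" and "F (p0, y0) = 0"
    and ndeg: "frechet_derivative F (at (p0, y0)) (0, 1) \<noteq> 0"
  obtains V Y where "open V" "p0 \<in> V" "smooth_on V Y" "Y p0 = y0"
    "\<And>p. p \<in> V \<Longrightarrow> (p, Y p) \<in> U \<and> F (p, Y p) = 0"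
proof -
  \<comment> \<open>On U1 the y-derivative does not vanish, so the quotient formula for DY makes
    sense on the whole neighbourhood and not just at the base point.\<close>
  define U1 where "U1 = {q\<in>U. frechet_derivative F (at q) (0, 1) \<in> - {0}}"
  have "open U1"
  proof -
    have "open (U \<inter> (\<lambda>q. frechet_derivative F (at q) (0, 1)) -` (- {0}))"
      by (intro continuous_open_preimage smooth_on_continuous_on[OF smooth_on_frechet_derivative[OF F]]
          smooth_on_open[OF F]) auto
    then show ?thesis by (simp add: U1_def vimage_def Int_def)
  qed
  have F1: "smooth_on U1 F" by (rule smooth_on_subset[OF F _ \<open>open U1\<close>]) (auto simp: U1_def)
  have sm: "smooth_on U1 (\<lambda>q. (fst q, F q))"
    by (intro smooth_intros F1 \<open>open U1\<close>)
  let ?D = "\<lambda>q. frechet_derivative F (at q)"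
  let ?\<Phi> = "\<lambda>q. (fst q, F q)"
  obtain f' where f': "\<And>q. q \<in> U1 \<Longrightarrow> (?\<Phi> has_derivative blinfun_apply (f' q)) (at q)"
      "continuous_on U1 f'"
    using smooth_on_has_blinfun_derivative[OF sm] by metis
  have f'_eq: "f' q (h, v) = (h, ?D q (h, 0) + v * ?D q (0, 1))" if "q \<in> U1" for q h v
  proof -
    have DF: "(F has_derivative ?D q) (at q)" by (rule smooth_on_has_derivative[OF F1 that])
    then have "(?\<Phi> has_derivative (\<lambda>h. (fst h, ?D q h))) (at q)"
      by (intro has_derivative_Pair has_derivative_fst has_derivative_ident)
    then have "blinfun_apply (f' q) = (\<lambda>h. (fst h, ?D q h))"
      using f'(1)[OF that] has_derivative_unique by blast
    moreover have "?D q (h, v) = ?D q (h, 0) + v * ?D q (0, 1)"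
    proof -
      interpret bounded_linear "?D q" using DF has_derivative_bounded_linear by blast
      show ?thesis using add[of "(h, 0)" "v *\<^sub>R (0, 1)"] scaleR[of v "(0,1)"] by simp
    qed
    ultimately show ?thesis by simp
  qed
  have in_U1: "(p0, y0) \<in> U1" using in_U ndeg by (simp add: U1_def)
  let ?d = "?D (p0, y0)"
  \<comment> \<open>The inverse of the block triangular derivative of (p, y) \<mapsto> (p, F(p, y))
    at the base point.\<close>
  define g0 where "g0 = (\<lambda>x :: 'a \<times> real. (fst x, (snd x - ?d (fst x, 0)) / ?d (0, 1)))"
  have "bounded_linear g0"
  proof -
    have *: "(F has_derivative ?d) (at (p0, y0))" by (rule smooth_on_has_derivative[OF F in_U])
    interpret bounded_linear ?d using * has_derivative_bounded_linear by blast
    have "bounded_linear (\<lambda>x :: 'a \<times> real. ?d (fst x, 0))"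
      by (rule bounded_linear_compose[OF bounded_linear_axioms])
        (intro bounded_linear_Pair bounded_linear_fst bounded_linear_zero)
    then show ?thesis unfolding g0_def
      by (intro bounded_linear_Pair bounded_linear_fst bounded_linear_divide
          bounded_linear_sub bounded_linear_snd bounded_linear_compose[OF bounded_linear_divide])
  qed
  then have g0: "blinfun_apply (Blinfun g0) = g0" by (rule bounded_linear_Blinfun_apply)
  have "Blinfun g0 o\<^sub>L f' (p0, y0) = id_blinfun"
  proof (rule blinfun_eqI)
    fix x :: "'a \<times> real"
    show "blinfun_apply (Blinfun g0 o\<^sub>L f' (p0, y0)) x = blinfun_apply id_blinfun x"
      using f'_eq[OF in_U1, of "fst x" "snd x"] ndeg by (simp add: g0) (simp add: g0_def)
  qed
  from inverse_function_theorem[OF \<open>open U1\<close> f' in_U1 this]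
  obtain U' V g g' where UV: "open U'" "U' \<subseteq> U1" "(p0, y0) \<in> U'" "open V" "?\<Phi> (p0, y0) \<in> V"
    and hom: "homeomorphism U' V ?\<Phi> g"
    and g': "\<And>y. y \<in> V \<Longrightarrow> (g has_derivative g' y) (at y)"
      "\<And>y. y \<in> V \<Longrightarrow> g' y = inv (blinfun_apply (f' (g y)))"
      "\<And>y. y \<in> V \<Longrightarrow> bij (blinfun_apply (f' (g y)))"
    by (metis (no_types, lifting))
  define V' where "V' = {p. (p, 0::real) \<in> V}"
  define Y where "Y p = snd (g (p, 0))" for p
  have "open V'"
    unfolding V'_def using open_vimage[OF UV(4), of "\<lambda>p. (p, 0)"]
    by (simp add: vimage_def continuous_on_Pair)
  have gY: "g (p, 0) = (p, Y p)" "(p, Y p) \<in> U1" "F (p, Y p) = 0" if "p \<in> V'" for p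
  proof -
    have "(p, 0) \<in> V" using that by (simp add: V'_def)
    then have *: "?\<Phi> (g (p, 0)) = (p, 0)" "g (p, 0) \<in> U'"
      using homeomorphism_apply2[OF hom] homeomorphism_image2[OF hom] by auto
    then show "g (p, 0) = (p, Y p)" unfolding Y_def by (metis fst_conv prod.collapse)
    with * show "(p, Y p) \<in> U1" "F (p, Y p) = 0" using UV(2) by auto
  qed
  have DY: "(Y has_derivative (\<lambda>h. - ?D (p, Y p) (h, 0) / ?D (p, Y p) (0, 1))) (at p)" if "p \<in> V'" for p
  proof -
    let ?q = "(p, Y p)"
    have V: "(p, 0) \<in> V" using that by (simp add: V'_def)
    have "((\<lambda>p. (p, 0 :: real)) has_derivative (\<lambda>h. (h, 0))) (at p)"
      by (auto intro!: derivative_eq_intros)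
    from has_derivative_snd[OF has_derivative_compose[OF this g'(1)[OF V]]]
    have "(Y has_derivative (\<lambda>h. snd (g' (p, 0) (h, 0)))) (at p)" by (simp add: Y_def[abs_def])
    moreover have "g' (p, 0) (h, 0) = (h, - ?D ?q (h, 0) / ?D ?q (0, 1))" for h
    proof -
      have "blinfun_apply (f' ?q) (h, - ?D ?q (h, 0) / ?D ?q (0, 1)) = (h, 0)"
        using gY(2)[OF that] by (subst f'_eq) (auto simp: U1_def)
      moreover have "inj (blinfun_apply (f' ?q))" and "g' (p, 0) = inv (blinfun_apply (f' ?q))"
        using g'(2,3)[OF V] by (simp_all only: gY(1)[OF that] bij_def)
      ultimately show ?thesis by (metis inv_f_eq)
    qed
    ultimately show ?thesis by simp
  qed
  have "Cn_on n V' Y" for n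
  proof (induction n)
    case 0
    show ?case using has_derivative_continuous[OF DY] by simp
  next
    case (Suc n)
    have *: "Cn_on n V' (\<lambda>p. ?D (p, Y p) u)" for u
    proof (rule Cn_on_compose[OF \<open>open V'\<close>, where f = "\<lambda>q. ?D q u" and g = "\<lambda>p. (p, Y p)" and V = U1])
      show "Cn_on n V' (\<lambda>p. (p, Y p))"
        by (rule Cn_on_Pair[OF \<open>open V'\<close> Cn_on_id[OF \<open>open V'\<close>] Suc])
      show "Cn_on n U1 (\<lambda>q. ?D q u)"
        by (rule smooth_on_Cn_on[OF smooth_on_frechet_derivative[OF F1]])
    qed (use gY in auto)
    show ?case
    proof (rule Cn_on_SucI[OF \<open>open V'\<close>])
      fix h
      have "Cn_on n V' (\<lambda>p. inverse (?D (p, Y p) (0, 1)))"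
        by (rule Cn_on_compose[OF \<open>open V'\<close> * Cn_on_inverse]) (use gY(2) in \<open>auto simp: U1_def\<close>)
      then have "Cn_on n V' (\<lambda>p. ?D (p, Y p) (- h, 0) * inverse (?D (p, Y p) (0, 1)))"
        by (intro Cn_on_bounded_bilinear[OF bounded_bilinear_mult] \<open>open V'\<close> *)
      then show "Cn_on n V' (\<lambda>p. ?D (p, Y p) (- h, 0) / ?D (p, Y p) (0, 1))"
        by (simp add: divide_inverse)
    next
      fix p assume p: "p \<in> V'"
      have "?D (p, Y p) (- h, 0) = - ?D (p, Y p) (h, 0)" for h
        using linear_neg[OF has_derivative_linear[OF smooth_on_has_derivative[OF F1 gY(2)[OF p]]], of "(h, 0)"]
        by simp
      then show "(Y has_derivative (\<lambda>h. ?D (p, Y p) (- h, 0) / ?D (p, Y p) (0, 1))) (at p)"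
        using DY[OF p] by simp
    qed
  qed
  then have "smooth_on V' Y" using \<open>open V'\<close> by (simp add: smooth_on_def)
  moreover have "p0 \<in> V'" using UV(5) \<open>F (p0, y0) = 0\<close> by (simp add: V'_def)
  moreover have "Y p0 = y0"
  proof -
    have "g (?\<Phi> (p0, y0)) = (p0, y0)" by (rule homeomorphism_apply1[OF hom UV(3)])
    then show ?thesis using \<open>F (p0, y0) = 0\<close> by (simp add: Y_def)
  qed
  moreover have "(p, Y p) \<in> U \<and> F (p, Y p) = 0" if "p \<in> V'" for p
    using gY(2,3)[OF that] by (simp add: U1_def)
  ultimately show ?thesis by (intro that[OF \<open>open V'\<close>])
qed

section \<open>Smooth families of curves as smooth maps into \<open>H\<^sup>2_loc\<close>\<close>

lemma set_integrable_lebesgue_continuous: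
  fixes f :: "real \<Rightarrow> 'b::euclidean_space"
  assumes "continuous_on UNIV f"
  shows "set_integrable lebesgue {c<..<d} f"
proof -
  have "set_integrable lborel {c..d} f"
    by (rule borel_integrable_atLeastAtMost') (rule continuous_on_subset[OF assms subset_UNIV])
  then have "set_integrable lborel {c<..<d} f"
    by (rule set_integrable_subset) auto
  moreover have "(\<lambda>s. indicator {c<..<d} s *\<^sub>R f s) \<in> borel_measurable lborel"
    using borel_measurable_continuous_onI[OF assms] by measurable
  ultimately show ?thesis
    unfolding set_integrable_def by (simp add: integrable_completion)
qed

lemma L2_on_continuous:
  assumes "continuous_on UNIV u"
  shows "L2_on {c<..<d} u"
  unfolding L2_on_def
proof
  show "u \<in> borel_measurable (lebesgue_on {c<..<d})"
    by (rule continuous_imp_measurable_on_sets_lebesgue[OF continuous_on_subset[OF assms subset_UNIV]]) auto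
  show "set_integrable lebesgue {c<..<d} (\<lambda>s. (norm (u s))\<^sup>2)"
    by (intro set_integrable_lebesgue_continuous continuous_intros assms)
qed

text \<open>Integration by parts; the boundary terms vanish because the test function is zero off a
  compact subset of the open interval.\<close>

lemma weak_deriv_on_classical:
  assumes u: "\<And>s. (u has_vector_derivative v s) (at s)" and v: "continuous_on UNIV v" and "c < d"
  shows "weak_deriv_on {c<..<d} u v"
  unfolding weak_deriv_on_def
proof (intro allI impI)
  fix \<psi> :: "real \<Rightarrow> real"
  assume "test_function {c<..<d} \<psi>"
  then obtain K where sm: "smooth_real_on UNIV \<psi>" and K: "K \<subseteq> {c<..<d}" "\<And>s. s \<notin> K \<Longrightarrow> \<psi> s = 0"
    unfolding test_function_def by blast
  have d\<psi>: "(\<psi> has_real_derivative deriv \<psi> s) (at s)" for s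
    using sm[unfolded smooth_real_on_def, rule_format, of s 0] DERIV_deriv_iff_real_differentiable by simp
  have cont\<psi>: "continuous_on UNIV \<psi>"
    using d\<psi> DERIV_continuous_on by blast
  have cont\<psi>': "continuous_on UNIV (deriv \<psi>)"
    using sm[unfolded smooth_real_on_def, rule_format, of _ 1]
    by (auto simp: continuous_on_eq_continuous_at intro: differentiable_imp_continuous_within)
  have contu: "continuous_on UNIV u"
    by (rule continuous_on_vector_derivative, rule u)
  have int: "set_integrable lebesgue {c<..<d} (\<lambda>s. deriv \<psi> s *\<^sub>R u s)"
     "set_integrable lebesgue {c<..<d} (\<lambda>s. \<psi> s *\<^sub>R v s)"
    by (intro set_integrable_lebesgue_continuous continuous_intros cont\<psi> cont\<psi>' contu v)+
  have "((\<lambda>s. \<psi> s *\<^sub>R v s + deriv \<psi> s *\<^sub>R u s) has_integral \<psi> d *\<^sub>R u d - \<psi> c *\<^sub>R u c) {c..d}"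
  proof (rule fundamental_theorem_of_calculus)
    fix s
    have "((\<lambda>s. \<psi> s *\<^sub>R u s) has_vector_derivative \<psi> s *\<^sub>R v s + deriv \<psi> s *\<^sub>R u s) (at s)"
      by (rule has_vector_derivative_scaleR[OF d\<psi> u])
    then show "((\<lambda>s. \<psi> s *\<^sub>R u s) has_vector_derivative \<psi> s *\<^sub>R v s + deriv \<psi> s *\<^sub>R u s) (at s within {c..d})"
      by (rule has_vector_derivative_at_within)
  qed (use \<open>c < d\<close> in simp)
  moreover have "d \<notin> K" "c \<notin> K" using K(1) by auto
  note this[THEN K(2)]
  ultimately have "integral {c..d} (\<lambda>s. \<psi> s *\<^sub>R v s + deriv \<psi> s *\<^sub>R u s) = 0"
    by (simp add: integral_unique)
  then have "integral {c<..<d} (\<lambda>s. \<psi> s *\<^sub>R v s + deriv \<psi> s *\<^sub>R u s) = 0"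
    by (simp only: integral_open_interval_real)
  moreover have "integral {c<..<d} (\<lambda>s. \<psi> s *\<^sub>R v s + deriv \<psi> s *\<^sub>R u s) =
      (LINT s:{c<..<d}|lebesgue. \<psi> s *\<^sub>R v s) + (LINT s:{c<..<d}|lebesgue. deriv \<psi> s *\<^sub>R u s)"
    using set_lebesgue_integral_eq_integral[OF int(1)] set_lebesgue_integral_eq_integral[OF int(2)]
    by (simp add: integral_add)
  ultimately show "(LINT s:{c<..<d}|lebesgue. deriv \<psi> s *\<^sub>R u s) = - (LINT s:{c<..<d}|lebesgue. \<psi> s *\<^sub>R v s)"
    by (simp add: eq_neg_iff_add_eq_0 add.commute)
qed

lemma H2_derivs_on_classical:
  assumes u: "\<And>s. (u has_vector_derivative v s) (at s)"
    and v: "\<And>s. (v has_vector_derivative w s) (at s)"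
    and w: "continuous_on UNIV w" and "c < d"
  shows "H2_derivs_on {c<..<d} u v w"
proof -
  have "continuous_on UNIV u" "continuous_on UNIV v"
    by (rule continuous_on_vector_derivative, rule u) (rule continuous_on_vector_derivative, rule v)
  then show ?thesis
    unfolding H2_derivs_on_def
    by (intro conjI L2_on_continuous w weak_deriv_on_classical[OF u] weak_deriv_on_classical[OF v] \<open>c < d\<close>)
qed

text \<open>\<open>H2_norm\<close> is an infimum of nonnegative numbers over the admissible pairs of
  weak derivatives. The classical pair is admissible, so its value bounds the infimum from above;
  the factor 3 counts the three squared norms.\<close>

lemma H2_norm_bounds_classical:
  assumes u: "\<And>s. (u has_vector_derivative v s) (at s)"
    and v: "\<And>s. (v has_vector_derivative w s) (at s)"
    and w: "continuous_on UNIV w" and "c < d"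
  shows "0 \<le> H2_norm {c<..<d} u"
    and "\<lbrakk>\<And>s. s \<in> {c..d} \<Longrightarrow> norm (u s) \<le> M \<and> norm (v s) \<le> M \<and> norm (w s) \<le> M\<rbrakk>
      \<Longrightarrow> H2_norm {c<..<d} u \<le> sqrt (3 * (d - c)) * M"
proof -
  let ?N = "\<lambda>v w. sqrt (LINT s:{c<..<d}|lebesgue. (norm (u s))\<^sup>2 + (norm (v s))\<^sup>2 + (norm (w s))\<^sup>2)"
  let ?S = "{?N v w | v w. H2_derivs_on {c<..<d} u v w}"
  have in_S: "?N v w \<in> ?S" using H2_derivs_on_classical[OF assms] by blast
  have nonneg: "0 \<le> ?N v w" for v w
    unfolding set_lebesgue_integral_def by (auto intro!: integral_nonneg)
  then show "0 \<le> H2_norm {c<..<d} u"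
    unfolding H2_norm_def using in_S by (intro cInf_greatest) auto
  assume M: "\<And>s. s \<in> {c..d} \<Longrightarrow> norm (u s) \<le> M \<and> norm (v s) \<le> M \<and> norm (w s) \<le> M"
  have "M \<ge> 0" using M[of c] \<open>c < d\<close> order_trans[OF norm_ge_zero] by auto
  have cont: "continuous_on UNIV u" "continuous_on UNIV v"
    by (rule continuous_on_vector_derivative, rule u) (rule continuous_on_vector_derivative, rule v)
  let ?f = "\<lambda>s. (norm (u s))\<^sup>2 + (norm (v s))\<^sup>2 + (norm (w s))\<^sup>2"
  have "set_integrable lebesgue {c<..<d} ?f"
    by (intro set_integrable_lebesgue_continuous continuous_intros cont w)
  then have "(LINT s:{c<..<d}|lebesgue. ?f s) = integral {c<..<d} ?f"
    by (rule set_lebesgue_integral_eq_integral)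
  also have "\<dots> = integral {c..d} ?f"
    using integral_open_interval_real[of c d ?f] by simp
  also have "\<dots> \<le> integral {c..d} (\<lambda>s. 3 * M\<^sup>2)"
  proof (rule integral_le)
    show "?f integrable_on {c..d}"
      by (intro integrable_continuous_interval continuous_intros continuous_on_subset[OF cont(1)]
         continuous_on_subset[OF cont(2)] continuous_on_subset[OF w] subset_UNIV)
    show "?f s \<le> 3 * M\<^sup>2" if "s \<in> {c..d}" for s
      using M[OF that] power_mono[of "norm (u s)" M 2] power_mono[of "norm (v s)" M 2]
        power_mono[of "norm (w s)" M 2] by simp
  qed auto
  also have "\<dots> = 3 * (d - c) * M\<^sup>2" using \<open>c < d\<close> by simp
  finally have "?N v w \<le> sqrt (3 * (d - c) * M\<^sup>2)" by (rule real_sqrt_le_mono)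
  also have "\<dots> = sqrt (3 * (d - c)) * M" using \<open>M \<ge> 0\<close> by (simp add: real_sqrt_mult)
  finally have "?N v w \<le> sqrt (3 * (d - c)) * M" .
  moreover have "H2_norm {c<..<d} u \<le> ?N v w"
    unfolding H2_norm_def using nonneg by (intro cInf_lower[OF in_S] bdd_belowI[where m = 0]) auto
  ultimately show "H2_norm {c<..<d} u \<le> sqrt (3 * (d - c)) * M" by simp
qed

section \<open>Estimates in the parameter, uniform over compact sets of the other variables\<close>

lemma smooth_on_uniform_continuity:
  fixes g :: "'p::euclidean_space \<times> 'k::euclidean_space \<Rightarrow> 'b::real_normed_vector"
  assumes g: "smooth_on (U \<times> UNIV) g" and "compact K" "open U" "p \<in> U" "\<epsilon> > 0"
  shows "\<exists>r>0. ball p r \<subseteq> U \<and> (\<forall>q\<in>ball p r. \<forall>\<kappa>\<in>K. norm (g (q, \<kappa>) - g (p, \<kappa>)) \<le> \<epsilon>)"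
proof -
  have "continuous_on (U \<times> K) g"
    by (rule continuous_on_subset[OF smooth_on_continuous_on[OF g]]) auto
  from continuous_on_prod_compactE[OF this assms(2,4,5)]
  obtain X where X: "p \<in> X" "open X" "\<forall>q\<in>X \<inter> U. \<forall>\<kappa>\<in>K. dist (g (q, \<kappa>)) (g (p, \<kappa>)) \<le> \<epsilon>" .
  obtain r where "r > 0" "ball p r \<subseteq> X \<inter> U"
    using openE[OF open_Int[OF X(2) \<open>open U\<close>]] X(1) \<open>p \<in> U\<close> by (metis IntI)
  then show ?thesis using X(3) by (intro exI[of _ r]) (auto simp: dist_norm)
qed

text \<open>By compactness of K the derivative at (q, \<kappa>) is within \<epsilon> of that at (p,
  \<kappa>) for all \<kappa> in K once q is near p; the mean value inequality on the segment from p
  to q turns this into a bound on the linearisation error.\<close>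

lemma smooth_on_uniform_differentiability:
  fixes g :: "'p::euclidean_space \<times> 'k::euclidean_space \<Rightarrow> 'b::real_normed_vector"
  assumes g: "smooth_on (U \<times> UNIV) g" and "compact K" "open U" "p \<in> U" "\<epsilon> > 0"
  shows "\<exists>r>0. ball p r \<subseteq> U \<and> (\<forall>q\<in>ball p r. \<forall>\<kappa>\<in>K.
    norm (g (q, \<kappa>) - g (p, \<kappa>) - frechet_derivative g (at (p, \<kappa>)) (q - p, 0)) \<le> \<epsilon> * norm (q - p))"
proof -
  obtain g' where g': "\<And>q. q \<in> U \<times> UNIV \<Longrightarrow> (g has_derivative blinfun_apply (g' q)) (at q)"
      "continuous_on (U \<times> UNIV) g'"
      "\<And>q. q \<in> U \<times> UNIV \<Longrightarrow> blinfun_apply (g' q) = frechet_derivative g (at q)"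
    using smooth_on_has_blinfun_derivative[OF g] by metis
  have "continuous_on (U \<times> K) g'"
    by (rule continuous_on_subset[OF g'(2)]) auto
  from continuous_on_prod_compactE[OF this assms(2,4,5)]
  obtain X where X: "p \<in> X" "open X" "\<forall>q\<in>X \<inter> U. \<forall>\<kappa>\<in>K. dist (g' (q, \<kappa>)) (g' (p, \<kappa>)) \<le> \<epsilon>" .
  obtain r where r: "r > 0" "ball p r \<subseteq> X \<inter> U"
    using openE[OF open_Int[OF X(2) \<open>open U\<close>]] X(1) \<open>p \<in> U\<close> by (metis IntI)
  have "norm (g (q, \<kappa>) - g (p, \<kappa>) - frechet_derivative g (at (p, \<kappa>)) (q - p, 0)) \<le> \<epsilon> * norm (q - p)"
    if q: "q \<in> ball p r" and \<kappa>: "\<kappa> \<in> K" for q \<kappa>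
  proof -
    have "norm (g (q, \<kappa>) - g (p, \<kappa>) - g' (p, \<kappa>) (q - p, 0)) \<le> norm (q - p) * \<epsilon>"
    proof (rule differentiable_bound_linearization[where f = "\<lambda>q. g (q, \<kappa>)" and S = "ball p r"
          and f' = "\<lambda>q h. g' (q, \<kappa>) (h, 0)"])
      show "p + s *\<^sub>R (q - p) \<in> ball p r" if "s \<in> {0..1}" for s
      proof -
        have "\<bar>s\<bar> * norm (q - p) \<le> 1 * norm (q - p)" using that by (intro mult_right_mono) auto
        then show ?thesis using q by (simp add: dist_norm norm_minus_commute)
      qed
    next
      fix x assume x: "x \<in> ball p r"
      then have xU: "x \<in> X \<inter> U" using r by blast
      have "((\<lambda>q. (q, \<kappa>)) has_derivative (\<lambda>h. (h, 0))) (at x within ball p r)"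
        by (auto intro!: derivative_eq_intros)
      from has_derivative_compose[OF this g'(1)]
      show "((\<lambda>q. g (q, \<kappa>)) has_derivative (\<lambda>h. g' (x, \<kappa>) (h, 0))) (at x within ball p r)"
        using xU by simp
      have "norm (g' (x, \<kappa>) - g' (p, \<kappa>)) \<le> \<epsilon>" using X(3) xU \<kappa> by (auto simp: dist_norm)
      then have le: "norm ((g' (x, \<kappa>) - g' (p, \<kappa>)) (h, 0)) \<le> \<epsilon> * norm h" for h
        using norm_blinfun[of "g' (x, \<kappa>) - g' (p, \<kappa>)" "(h, 0)"]
          mult_right_mono[of "norm (g' (x, \<kappa>) - g' (p, \<kappa>))" \<epsilon> "norm h"]
        by (simp add: norm_Pair)
      show "onorm ((\<lambda>h. g' (x, \<kappa>) (h, 0)) - (\<lambda>h. g' (p, \<kappa>) (h, 0))) \<le> \<epsilon>"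
        by (rule onorm_bound) (use le \<open>\<epsilon> > 0\<close> in \<open>auto simp: blinfun.diff_left\<close>)
    qed (use r in auto)
    then show ?thesis using g'(3)[of "(p, \<kappa>)"] \<open>p \<in> U\<close> by (simp add: mult.commute)
  qed
  then show ?thesis using r by blast
qed

lemma small_multiple:
  fixes C \<epsilon> :: real
  assumes "C \<ge> 0" "\<epsilon> > 0"
  obtains \<epsilon>' where "\<epsilon>' > 0" "C * \<epsilon>' < \<epsilon>"
proof
  have "C + 1 > 0" using assms by simp
  then show "\<epsilon> / (C + 1) > 0" "C * (\<epsilon> / (C + 1)) < \<epsilon>"
    using assms by (simp_all add: field_simps)
qed

lemma smooth_on_has_vector_derivative_snd:
  fixes H :: "'p::euclidean_space \<times> real \<Rightarrow> 'b::real_normed_vector"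
  assumes "smooth_on (U \<times> UNIV) H" "p \<in> U"
  shows "((\<lambda>\<xi>. H (p, \<xi>)) has_vector_derivative frechet_derivative H (at (p, \<xi>)) (0, 1)) (at \<xi>)"
proof -
  have "(H has_derivative frechet_derivative H (at (p, \<xi>))) (at ((p, 0) + \<xi> *\<^sub>R (0, 1)))"
    using smooth_on_has_derivative[OF assms(1), of "(p, \<xi>)"] assms(2) by simp
  from has_derivative_along_line[OF this] show ?thesis by simp
qed

text \<open>By symmetry of second derivatives, a \<xi>-derivative of a parameter derivative is a
  parameter derivative of a \<xi>-derivative; the estimates for a family thus pass to its
  \<xi>-derivatives.\<close>

lemma frechet_derivative_has_vector_derivative_snd:
  fixes H :: "'p::euclidean_space \<times> real \<Rightarrow> 'b::euclidean_space"
  assumes "smooth_on (U \<times> UNIV) H" "p \<in> U"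
  shows "((\<lambda>\<xi>. frechet_derivative H (at (p, \<xi>)) h) has_vector_derivative
    frechet_derivative (\<lambda>x. frechet_derivative H (at x) (0, 1)) (at (p, \<xi>)) h) (at \<xi>)"
  using smooth_on_has_vector_derivative_snd[OF smooth_on_frechet_derivative[OF assms(1), of h] assms(2), of \<xi>]
    symmetric_frechet_derivative[OF assms(1), of "(p, \<xi>)" "(0, 1)" h] assms(2) by simp

text \<open>In the parameter \<open>q\<close>, a smooth family and its first two \<open>\<xi>\<close>-derivatives are uniformly
  differentiable over compact \<open>\<xi>\<close>-intervals; this is differentiability in \<open>H\<^sup>2_loc\<close>.\<close>

lemma has_H2_loc_derivs_smooth_family:
  fixes G :: "(real \<times> real) \<times> real \<Rightarrow> real^3"
  assumes G: "smooth_on (U \<times> UNIV) G" and "open U" and p: "p \<in> U"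
  shows "has_H2_loc_derivs (\<lambda>p \<xi>. G (p, \<xi>)) (\<lambda>\<xi>. frechet_derivative G (at (p, \<xi>)) ((1, 0), 0))
    (\<lambda>\<xi>. frechet_derivative G (at (p, \<xi>)) ((0, 1), 0)) p"
proof -
  define d where "d H x = frechet_derivative H (at x) (0, 1)"
    for H :: "(real \<times> real) \<times> real \<Rightarrow> real^3" and x
  have d: "smooth_on (U \<times> UNIV) (d H)" if "smooth_on (U \<times> UNIV) H" for H
    unfolding d_def by (rule smooth_on_frechet_derivative[OF that])
  define Ds where "Ds H h \<xi> = frechet_derivative H (at (p, \<xi>)) h"
    for H :: "(real \<times> real) \<times> real \<Rightarrow> real^3" and h \<xi>
  have dDs: "(Ds H h has_vector_derivative Ds (d H) h \<xi>) (at \<xi>)" if "smooth_on (U \<times> UNIV) H" for H h \<xi>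
    using frechet_derivative_has_vector_derivative_snd[OF that p] unfolding Ds_def d_def .
  have cDs: "continuous_on UNIV (Ds H h)" if "smooth_on (U \<times> UNIV) H" for H h
    by (rule continuous_on_vector_derivative) (rule dDs[OF that])
  have dd: "((\<lambda>\<xi>. H (q, \<xi>)) has_vector_derivative d H (q, \<xi>)) (at \<xi>)"
    if "smooth_on (U \<times> UNIV) H" "q \<in> U" for H :: "(real \<times> real) \<times> real \<Rightarrow> real^3" and q \<xi>
    using smooth_on_has_vector_derivative_snd[OF that] unfolding d_def .
  note G1 = d[OF G] and G2 = d[OF d[OF G]]
  \<comment> \<open>The linearisation error is linear in H and commutes with \<xi>-differentiation.
    One estimate, applied to G and its first two \<xi>-derivatives, therefore controls the error and
    both of its derivatives.\<close>
  define E where "E H q \<xi> = H (q, \<xi>) - H (p, \<xi>) - (fst q - fst p) *\<^sub>R Ds H ((1, 0), 0) \<xi>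
      - (snd q - snd p) *\<^sub>R Ds H ((0, 1), 0) \<xi>"
    for H :: "(real \<times> real) \<times> real \<Rightarrow> real^3" and q \<xi>
  have E_eq: "E H q \<xi> = H (q, \<xi>) - H (p, \<xi>) - Ds H (q - p, 0) \<xi>" if "smooth_on (U \<times> UNIV) H" for H q \<xi>
  proof -
    interpret linear "frechet_derivative H (at (p, \<xi>))"
      using smooth_on_has_derivative[OF that, of "(p, \<xi>)"] p has_derivative_linear by auto
    have "(q - p, 0) = (fst q - fst p) *\<^sub>R ((1, 0), 0) + (snd q - snd p) *\<^sub>R ((0, 1), 0 :: real)"
      by (simp add: prod_eq_iff)
    then have "Ds H (q - p, 0) \<xi> = (fst q - fst p) *\<^sub>R Ds H ((1, 0), 0) \<xi> + (snd q - snd p) *\<^sub>R Ds H ((0, 1), 0) \<xi>"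
      unfolding Ds_def by (simp only: add scale)
    then show ?thesis unfolding E_def by simp
  qed
  have dE: "(E H q has_vector_derivative E (d H) q \<xi>) (at \<xi>)" if "smooth_on (U \<times> UNIV) H" "q \<in> U" for H :: "(real \<times> real) \<times> real \<Rightarrow> real^3" and q \<xi>
    unfolding E_def
    by (auto intro!: derivative_eq_intros dd[OF that] dd[OF that(1) p] dDs[OF that(1)])
  have cE: "continuous_on UNIV (E H q)" if "smooth_on (U \<times> UNIV) H" "q \<in> U" for H :: "(real \<times> real) \<times> real \<Rightarrow> real^3" and q
    by (rule continuous_on_vector_derivative) (rule dE[OF that])
  have small: "\<exists>r>0. ball p r \<subseteq> U \<and> (\<forall>q\<in>ball p r. \<forall>\<xi>\<in>{a..b}. norm (E H q \<xi>) \<le> \<epsilon> * norm (q - p))"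
    if "smooth_on (U \<times> UNIV) H" "\<epsilon> > 0" for H \<epsilon> a b
    using smooth_on_uniform_differentiability[OF that(1) compact_Icc \<open>open U\<close> p that(2), of a b]
    by (simp add: E_eq[OF that(1)] Ds_def)
  have loc: "H2_loc (Ds G h)" for h
    unfolding H2_loc_def H2_on_def
    using H2_derivs_on_classical[OF dDs[OF G] dDs[OF G1] cDs[OF G2]] by blast
  have "((\<lambda>q. H2_norm {a<..<b} (E G q) / norm (q - p)) \<longlongrightarrow> 0) (at p)" if "a < b" for a b
  proof (rule tendstoI)
    fix \<epsilon> :: real assume "\<epsilon> > 0"
    let ?C = "sqrt (3 * (b - a))"
    have "?C \<ge> 0" using \<open>a < b\<close> by simp
    from small_multiple[OF this \<open>\<epsilon> > 0\<close>] obtain \<epsilon>' where "\<epsilon>' > 0" "?C * \<epsilon>' < \<epsilon>" .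
    obtain r0 where r0: "r0 > 0" "ball p r0 \<subseteq> U" "\<And>q \<xi>. q \<in> ball p r0 \<Longrightarrow> \<xi> \<in> {a..b} \<Longrightarrow> norm (E G q \<xi>) \<le> \<epsilon>' * norm (q - p)"
      using small[OF G \<open>\<epsilon>' > 0\<close>] by metis
    obtain r1 where r1: "r1 > 0" "\<And>q \<xi>. q \<in> ball p r1 \<Longrightarrow> \<xi> \<in> {a..b} \<Longrightarrow> norm (E (d G) q \<xi>) \<le> \<epsilon>' * norm (q - p)"
      using small[OF G1 \<open>\<epsilon>' > 0\<close>] by metis
    obtain r2 where r2: "r2 > 0" "\<And>q \<xi>. q \<in> ball p r2 \<Longrightarrow> \<xi> \<in> {a..b} \<Longrightarrow> norm (E (d (d G)) q \<xi>) \<le> \<epsilon>' * norm (q - p)"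
      using small[OF G2 \<open>\<epsilon>' > 0\<close>] by metis
    have "eventually (\<lambda>q. q \<in> ball p (min r0 (min r1 r2)) \<and> q \<noteq> p) (at p)"
      using r0 r1 r2 by (intro eventually_conj eventually_neq_at_within eventually_at_in_open') auto
    then show "eventually (\<lambda>q. dist (H2_norm {a<..<b} (E G q) / norm (q - p)) 0 < \<epsilon>) (at p)"
    proof eventually_elim
      case (elim q)
      then have q: "q \<in> U" "norm (q - p) > 0" using r0 by auto
      note cl = dE[OF G q(1)] dE[OF G1 q(1)] cE[OF G2 q(1)] \<open>a < b\<close>
      have "H2_norm {a<..<b} (E G q) \<le> ?C * (\<epsilon>' * norm (q - p))"
        by (rule H2_norm_bounds_classical(2)[OF cl]) (use elim r0 r1 r2 in auto)
      also have "\<dots> < \<epsilon> * norm (q - p)" using \<open>?C * \<epsilon>' < \<epsilon>\<close> q by simp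
      finally show ?case using H2_norm_bounds_classical(1)[OF cl] q by (simp add: field_simps)
    qed
  qed
  then show ?thesis
    unfolding has_H2_loc_derivs_def using loc by (simp add: Ds_def[abs_def] E_def[abs_def])
qed

text \<open>The first two \<xi>-derivatives of G are smooth families as well, so the uniform
  continuity estimate applies to all three and \<open>H2_norm_bounds_classical\<close> combines
  them.\<close>

lemma H2_loc_continuous_on_smooth_family:
  fixes G :: "(real \<times> real) \<times> real \<Rightarrow> real^3"
  assumes G: "smooth_on (U \<times> UNIV) G" and "open U"
  shows "H2_loc_continuous_on U (\<lambda>p \<xi>. G (p, \<xi>))"
proof -
  define d where "d H x = frechet_derivative H (at x) (0, 1)"
    for H :: "(real \<times> real) \<times> real \<Rightarrow> real^3" and x
  have d: "smooth_on (U \<times> UNIV) (d H)" if "smooth_on (U \<times> UNIV) H" for H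
    unfolding d_def by (rule smooth_on_frechet_derivative[OF that])
  have dd: "((\<lambda>\<xi>. H (q, \<xi>)) has_vector_derivative d H (q, \<xi>)) (at \<xi>)"
    if "smooth_on (U \<times> UNIV) H" "q \<in> U" for H :: "(real \<times> real) \<times> real \<Rightarrow> real^3" and q \<xi>
    using smooth_on_has_vector_derivative_snd[OF that] unfolding d_def .
  have cd: "continuous_on UNIV (\<lambda>\<xi>. H (q, \<xi>))" if "smooth_on (U \<times> UNIV) H" "q \<in> U" for H :: "(real \<times> real) \<times> real \<Rightarrow> real^3" and q
    by (rule continuous_on_vector_derivative) (rule dd[OF that])
  note G1 = d[OF G] and G2 = d[OF d[OF G]]
  have "((\<lambda>q. H2_norm {a<..<b} (\<lambda>\<xi>. G (q, \<xi>) - G (p, \<xi>))) \<longlongrightarrow> 0) (at p within U)"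
    if p: "p \<in> U" and "a < b" for p a b
  proof (rule tendstoI)
    fix \<epsilon> :: real assume "\<epsilon> > 0"
    let ?C = "sqrt (3 * (b - a))"
    have "?C \<ge> 0" using \<open>a < b\<close> by simp
    from small_multiple[OF this \<open>\<epsilon> > 0\<close>] obtain \<epsilon>' where "\<epsilon>' > 0" "?C * \<epsilon>' < \<epsilon>" .
    note small = smooth_on_uniform_continuity[OF _ compact_Icc[of a b] \<open>open U\<close> p \<open>\<epsilon>' > 0\<close>]
    obtain r0 where r0: "r0 > 0" "\<And>q \<xi>. q \<in> ball p r0 \<Longrightarrow> \<xi> \<in> {a..b} \<Longrightarrow> norm (G (q, \<xi>) - G (p, \<xi>)) \<le> \<epsilon>'"
      using small[OF G] by metis
    obtain r1 where r1: "r1 > 0" "\<And>q \<xi>. q \<in> ball p r1 \<Longrightarrow> \<xi> \<in> {a..b} \<Longrightarrow> norm (d G (q, \<xi>) - d G (p, \<xi>)) \<le> \<epsilon>'"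
      using small[OF G1] by metis
    obtain r2 where r2: "r2 > 0" "\<And>q \<xi>. q \<in> ball p r2 \<Longrightarrow> \<xi> \<in> {a..b} \<Longrightarrow> norm (d (d G) (q, \<xi>) - d (d G) (p, \<xi>)) \<le> \<epsilon>'"
      using small[OF G2] by metis
    have "eventually (\<lambda>q. q \<in> ball p (min r0 (min r1 r2))) (at p within U)"
      using eventually_at_ball[of "min r0 (min r1 r2)" p U] r0 r1 r2 by (auto elim: eventually_mono)
    moreover have "eventually (\<lambda>q. q \<in> U) (at p within U)"
      by (auto simp: eventually_at_filter)
    ultimately show "eventually (\<lambda>q. dist (H2_norm {a<..<b} (\<lambda>\<xi>. G (q, \<xi>) - G (p, \<xi>))) 0 < \<epsilon>) (at p within U)"
    proof eventually_elim
      case (elim q)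
      then have q: "q \<in> U" by auto
      note cl = has_vector_derivative_diff[OF dd[OF G q] dd[OF G p]]
        has_vector_derivative_diff[OF dd[OF G1 q] dd[OF G1 p]]
        continuous_on_diff[OF cd[OF G2 q] cd[OF G2 p]] \<open>a < b\<close>
      have "H2_norm {a<..<b} (\<lambda>\<xi>. G (q, \<xi>) - G (p, \<xi>)) \<le> ?C * \<epsilon>'"
        by (rule H2_norm_bounds_classical(2)[OF cl]) (use elim r0 r1 r2 in auto)
      then show ?case using H2_norm_bounds_classical(1)[OF cl] \<open>?C * \<epsilon>' < \<epsilon>\<close> by simp
    qed
  qed
  moreover have "H2_loc (\<lambda>\<xi>. G (p, \<xi>))" if "p \<in> U" for p
    unfolding H2_loc_def H2_on_def
    using H2_derivs_on_classical[OF dd[OF G that] dd[OF G1 that] cd[OF G2 that]] by blast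
  ultimately show ?thesis unfolding H2_loc_continuous_on_def by blast
qed

text \<open>The parameter derivatives are smooth families of the same kind, so the recursion of
  \<open>H2_loc_Cn_on\<close> unwinds by induction over all G at once.\<close>

lemma H2_loc_smooth_on_smooth_family:
  fixes G :: "(real \<times> real) \<times> real \<Rightarrow> real^3"
  assumes "smooth_on (U \<times> UNIV) G" and "open U"
  shows "H2_loc_smooth_on U (\<lambda>p \<xi>. G (p, \<xi>))"
  unfolding H2_loc_smooth_on_def
proof
  show "H2_loc_Cn_on n U (\<lambda>p \<xi>. G (p, \<xi>))" for n
    using assms(1)
  proof (induction n arbitrary: G)
    case 0
    then show ?case using H2_loc_continuous_on_smooth_family assms(2) by simp
  next
    case (Suc n)
    let ?D = "\<lambda>h p \<xi>. frechet_derivative G (at (p, \<xi>)) h"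
    have *: "H2_loc_Cn_on n U (?D h)" for h
      by (rule Suc.IH[OF smooth_on_frechet_derivative[OF Suc.prems]])
    have "\<exists>F\<^sub>1 F\<^sub>2. (\<forall>p\<in>U. has_H2_loc_derivs (\<lambda>p \<xi>. G (p, \<xi>)) (F\<^sub>1 p) (F\<^sub>2 p) p) \<and>
        H2_loc_Cn_on n U F\<^sub>1 \<and> H2_loc_Cn_on n U F\<^sub>2"
      by (rule exI[where x = "?D ((1, 0), 0)"], rule exI[where x = "?D ((0, 1), 0)"])
        (use has_H2_loc_derivs_smooth_family[OF Suc.prems assms(2)] * in blast)
    then show ?case
      using H2_loc_continuous_on_smooth_family[OF Suc.prems assms(2)] by simp
  qed
qed

lemma periodic_int_multiple:
  fixes f :: "real \<Rightarrow> 'b"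
  assumes "\<And>x. f (x + P) = f x"
  shows "f (x + of_int n * P) = f x"
proof -
  have nat: "f (x + of_nat m * P) = f x" for m x
  proof (induction m)
    case (Suc m)
    have "f (x + of_nat (Suc m) * P) = f ((x + of_nat m * P) + P)" by (simp add: algebra_simps)
    then show ?case using assms Suc by simp
  qed simp
  show ?thesis
  proof (cases "n \<ge> 0")
    case True
    then show ?thesis using nat[of x "nat n"] by simp
  next
    case False
    then show ?thesis using nat[of "x + of_int n * P" "nat (- n)"] by (simp add: algebra_simps)
  qed
qed

section \<open>Remainders of higher than first order, uniformly in a periodic parameter\<close>

text \<open>A function with vanishing value and t-derivative at t = 0 is o(t), uniformly over
  compact sets of (\<phi>, \<xi>); the variables are grouped as (t, (\<phi>, \<xi>)) for this
  reason. Periodicity reduces all \<phi> to one compact period.\<close>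

lemma H2_norm_second_order_family:
  fixes E :: "real \<times> (real \<times> real) \<Rightarrow> real^3"
  assumes E: "smooth_on (U \<times> UNIV) E" and "open U" "0 \<in> U"
    and E0: "\<And>\<kappa>. E (0, \<kappa>) = 0" and E1: "\<And>\<kappa>. frechet_derivative E (at (0, \<kappa>)) (1, 0) = 0"
    and per: "\<And>t \<phi> \<xi>. t \<in> U \<Longrightarrow> E (t, \<phi> + P, \<xi>) = E (t, \<phi>, \<xi>)" and "P > 0"
    and "c < d" "\<epsilon> > 0"
  shows "\<forall>\<^sub>F t in at 0. \<forall>\<phi>. H2_norm {c<..<d} (\<lambda>\<xi>. E (t, \<phi>, \<xi>)) \<le> \<epsilon> * \<bar>t\<bar>"
proof -
  define d\<xi> where "d\<xi> H x = frechet_derivative H (at x) (0, 0, 1)"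
    for H :: "real \<times> (real \<times> real) \<Rightarrow> real^3" and x
  have sm: "smooth_on (U \<times> UNIV) (d\<xi> H)" if "smooth_on (U \<times> UNIV) H" for H
    unfolding d\<xi>_def by (rule smooth_on_frechet_derivative[OF that])
  have dd: "((\<lambda>\<xi>. H (t, \<phi>, \<xi>)) has_vector_derivative frechet_derivative H (at (t, \<phi>, \<xi>)) (0, 0, 1)) (at \<xi>)"
    if "smooth_on (U \<times> UNIV) H" "t \<in> U" for H :: "real \<times> (real \<times> real) \<Rightarrow> real^3" and t \<phi> \<xi>
  proof -
    have "(H has_derivative frechet_derivative H (at (t, \<phi>, \<xi>))) (at ((t, \<phi>, 0) + \<xi> *\<^sub>R (0, 0, 1)))"
      using smooth_on_has_derivative[OF that(1), of "(t, \<phi>, \<xi>)"] that(2) by simp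
    from has_derivative_along_line[OF this] show ?thesis by simp
  qed
  have zero: "d\<xi> H (0, \<kappa>) = 0" if "smooth_on (U \<times> UNIV) H" "\<And>\<kappa>. H (0, \<kappa>) = 0" for H \<kappa>
    using dd[OF that(1) \<open>0 \<in> U\<close>, of "fst \<kappa>" "snd \<kappa>"] that(2) vector_derivative_unique_at[OF _ has_vector_derivative_const]
    by (simp add: d\<xi>_def)
  \<comment> \<open>Vanishing of the t-derivative at t = 0 passes to the \<xi>-derivatives because
    the two differentiations commute.\<close>
  have zero': "frechet_derivative (d\<xi> H) (at (0, \<kappa>)) (1, 0) = 0"
    if "smooth_on (U \<times> UNIV) H" "\<And>\<kappa>. frechet_derivative H (at (0, \<kappa>)) (1, 0) = 0" for H \<kappa>
  proof -
    have "frechet_derivative (d\<xi> H) (at (0, \<kappa>)) (1, 0) =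
        d\<xi> (\<lambda>x. frechet_derivative H (at x) (1, 0)) (0, \<kappa>)"
      unfolding d\<xi>_def by (rule symmetric_frechet_derivative[OF that(1)]) (use \<open>0 \<in> U\<close> in simp)
    also have "\<dots> = 0"
      by (rule zero[OF smooth_on_frechet_derivative[OF that(1)] that(2)])
    finally show ?thesis .
  qed
  let ?K = "{0..P} \<times> {c..d}"
  have small: "\<exists>r>0. ball 0 r \<subseteq> U \<and> (\<forall>t\<in>ball 0 r. \<forall>\<kappa>\<in>?K. norm (H (t, \<kappa>)) \<le> \<epsilon>' * \<bar>t\<bar>)"
    if H: "smooth_on (U \<times> UNIV) H" and "\<And>\<kappa>. H (0, \<kappa>) = 0"
      and "\<And>\<kappa>. frechet_derivative H (at (0, \<kappa>)) (1, 0) = 0" and "\<epsilon>' > 0"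
    for H :: "real \<times> (real \<times> real) \<Rightarrow> real^3" and \<epsilon>'
  proof -
    have "frechet_derivative H (at (0, \<kappa>)) (t, 0) = 0" for t \<kappa>
    proof -
      have "linear (frechet_derivative H (at (0, \<kappa>)))"
        using smooth_on_has_derivative[OF H, of "(0, \<kappa>)"] \<open>0 \<in> U\<close> has_derivative_linear by auto
      from linear_scale[OF this, of t "(1, 0)"] show ?thesis using that(3) by simp
    qed
    then show ?thesis
      using smooth_on_uniform_differentiability[OF H _ \<open>open U\<close> \<open>0 \<in> U\<close> \<open>\<epsilon>' > 0\<close>, of ?K] that(2)
      by (simp add: compact_Times)
  qed
  note E' = sm[OF E] and E'' = sm[OF sm[OF E]]
  let ?C = "sqrt (3 * (d - c))"
  have "?C \<ge> 0" using \<open>c < d\<close> by simp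
  from small_multiple[OF this \<open>\<epsilon> > 0\<close>] obtain \<epsilon>' where \<epsilon>': "\<epsilon>' > 0" "?C * \<epsilon>' < \<epsilon>" .
  obtain r0 where r0: "r0 > 0" "ball 0 r0 \<subseteq> U" "\<And>t \<kappa>. t \<in> ball 0 r0 \<Longrightarrow> \<kappa> \<in> ?K \<Longrightarrow> norm (E (t, \<kappa>)) \<le> \<epsilon>' * \<bar>t\<bar>"
    using small[OF E E0 E1 \<epsilon>'(1)] by metis
  obtain r1 where r1: "r1 > 0" "\<And>t \<kappa>. t \<in> ball 0 r1 \<Longrightarrow> \<kappa> \<in> ?K \<Longrightarrow> norm (d\<xi> E (t, \<kappa>)) \<le> \<epsilon>' * \<bar>t\<bar>"
    using small[OF E' zero[OF E E0] zero'[OF E E1] \<epsilon>'(1)] by metis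
  obtain r2 where r2: "r2 > 0" "\<And>t \<kappa>. t \<in> ball 0 r2 \<Longrightarrow> \<kappa> \<in> ?K \<Longrightarrow> norm (d\<xi> (d\<xi> E) (t, \<kappa>)) \<le> \<epsilon>' * \<bar>t\<bar>"
    using small[OF E'' zero[OF E' zero[OF E E0]] zero'[OF E' zero'[OF E E1]] \<epsilon>'(1)] by metis
  have "\<forall>\<^sub>F t in at 0. t \<in> ball (0::real) (min r0 (min r1 r2))"
    using eventually_at_ball[of "min r0 (min r1 r2)" "0::real" UNIV] r0 r1 r2 by (auto elim: eventually_mono)
  then show ?thesis
  proof eventually_elim
    case (elim t)
    show ?case
    proof
      fix \<phi>
      have t: "t \<in> U" using elim r0 by auto
      \<comment> \<open>The representative of \<phi> in one period, obtained by removing the integer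
        part of \<phi> / P.\<close>
      define \<psi> where "\<psi> = \<phi> + of_int (- \<lfloor>\<phi> / P\<rfloor>) * P"
      have "\<psi> = P * frac (\<phi> / P)" using \<open>P > 0\<close> by (simp add: \<psi>_def frac_def field_simps)
      then have \<psi>: "\<psi> \<in> {0..P}"
        using \<open>P > 0\<close> frac_ge_0[of "\<phi> / P"] frac_lt_1[of "\<phi> / P"] by (simp add: mult_left_le)
      have "(\<lambda>\<xi>. E (t, \<phi>, \<xi>)) = (\<lambda>\<xi>. E (t, \<psi>, \<xi>))"
      proof
        show "E (t, \<phi>, \<xi>) = E (t, \<psi>, \<xi>)" for \<xi>
          unfolding \<psi>_def by (rule periodic_int_multiple[symmetric, where f = "\<lambda>\<phi>. E (t, \<phi>, \<xi>)"]) (rule per[OF t])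
      qed
      moreover have "H2_norm {c<..<d} (\<lambda>\<xi>. E (t, \<psi>, \<xi>)) \<le> ?C * (\<epsilon>' * \<bar>t\<bar>)"
      proof (rule H2_norm_bounds_classical(2)[OF _ _ _ \<open>c < d\<close>])
        show "((\<lambda>\<xi>. E (t, \<psi>, \<xi>)) has_vector_derivative d\<xi> E (t, \<psi>, \<xi>)) (at \<xi>)" for \<xi>
          using dd[OF E t] unfolding d\<xi>_def .
        show "((\<lambda>\<xi>. d\<xi> E (t, \<psi>, \<xi>)) has_vector_derivative d\<xi> (d\<xi> E) (t, \<psi>, \<xi>)) (at \<xi>)" for \<xi>
          using dd[OF E' t] unfolding d\<xi>_def[of "d\<xi> E"] .
        show "continuous_on UNIV (\<lambda>\<xi>. d\<xi> (d\<xi> E) (t, \<psi>, \<xi>))"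
          by (rule continuous_on_vector_derivative) (rule dd[OF E'' t])
      qed (use elim \<psi> r0 r1 r2 in auto)
      moreover have "?C * (\<epsilon>' * \<bar>t\<bar>) \<le> \<epsilon> * \<bar>t\<bar>"
        using \<epsilon>'(2) mult_right_mono[of "?C * \<epsilon>'" \<epsilon> "\<bar>t\<bar>"] by (simp add: mult.assoc)
      ultimately show "H2_norm {c<..<d} (\<lambda>\<xi>. E (t, \<phi>, \<xi>)) \<le> \<epsilon> * \<bar>t\<bar>" by simp
    qed
  qed
qed

section \<open>The phase of the oscillation\<close>

lemma frechet_derivative_along_line:
  assumes "f differentiable (at p)" and "((\<lambda>r. f (p + r *\<^sub>R h)) has_vector_derivative D) (at 0)"
  shows "frechet_derivative f (at p) h = D"
proof -
  have "(f has_derivative frechet_derivative f (at p)) (at (p + 0 *\<^sub>R h))"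
    using assms(1) by (simp add: frechet_derivative_works)
  from vector_derivative_unique_at[OF has_derivative_along_line[OF this] assms(2)] show ?thesis .
qed

lemma equal_derivatives_imp_eq:
  fixes f g :: "real \<Rightarrow> real"
  assumes "\<And>s. (f has_real_derivative f' s) (at s)" "\<And>s. (g has_real_derivative f' s) (at s)" "f a = g a"
  shows "f s = g s"
proof -
  have "\<forall>x. ((\<lambda>s. f s - g s) has_real_derivative 0) (at x)"
    using DERIV_diff[OF assms(1,2)] by simp
  from DERIV_isconst_all[OF this, of s a] show ?thesis using assms(3) by simp
qed

text \<open>By symmetry of second derivatives, the parameter derivative of an antiderivative is the
  antiderivative of the parameter derivative. First-order terms of the integrals below are found in
  this way, by integrating the linearised integrand.\<close>

lemma antiderivative_parameter_derivative:
  fixes F f :: "'a::euclidean_space \<times> real \<Rightarrow> real"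
  assumes F: "smooth_on (U \<times> UNIV) F" and F0: "\<And>p. p \<in> U \<Longrightarrow> F (p, 0) = 0"
    and DF: "\<And>p s. p \<in> U \<Longrightarrow> ((\<lambda>s. F (p, s)) has_real_derivative f (p, s)) (at s)"
    and f: "smooth_on (U \<times> UNIV) f" and U: "open U" "p \<in> U"
  shows "((\<lambda>s. frechet_derivative F (at (p, s)) (h, 0)) has_real_derivative
      frechet_derivative f (at (p, s)) (h, 0)) (at s)"
    and "frechet_derivative F (at (p, 0)) (h, 0) = 0"
proof -
  have eq: "frechet_derivative F (at x) (0, 1) = f x" if xU: "x \<in> U \<times> UNIV" for x
  proof -
    obtain q s where x: "x = (q, s)" "q \<in> U" using xU by blast
    have "((\<lambda>s. F (q, s)) has_vector_derivative f (q, s)) (at s)"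
      using DF[OF x(2)] by (simp add: has_real_derivative_iff_has_vector_derivative)
    from vector_derivative_unique_at[OF smooth_on_has_vector_derivative_snd[OF F x(2)] this]
    show ?thesis unfolding x .
  qed
  have opn: "open (U \<times> (UNIV :: real set))" using U by (intro open_Times) auto
  have "frechet_derivative (\<lambda>x. frechet_derivative F (at x) (0, 1)) (at (p, s)) = frechet_derivative f (at (p, s))"
    by (rule frechet_derivative_cong_open(2)[OF opn, where f = f and g = "\<lambda>x. frechet_derivative F (at x) (0, 1)"])
      (use U eq smooth_on_differentiable[OF f] in auto)
  with frechet_derivative_has_vector_derivative_snd[OF F U(2), of "(h, 0)" s]
  show "((\<lambda>s. frechet_derivative F (at (p, s)) (h, 0)) has_real_derivative
      frechet_derivative f (at (p, s)) (h, 0)) (at s)"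
    by (simp add: has_real_derivative_iff_has_vector_derivative)
  have "((\<lambda>r. F ((p, 0) + r *\<^sub>R (h, 0))) has_vector_derivative 0) (at 0)"
  proof (rule has_vector_derivative_transform_within_open[OF has_vector_derivative_const])
    show "open ((\<lambda>r. p + r *\<^sub>R h) -` U)"
      by (intro open_vimage U continuous_intros)
  qed (use U F0 in auto)
  then show "frechet_derivative F (at (p, 0)) (h, 0) = 0"
    using smooth_on_differentiable[OF F, of "(p, 0)"] U by (intro frechet_derivative_along_line) auto
qed

lemma one_minus_mult_cos_pos:
  fixes e \<psi> :: real
  assumes "e \<in> {-1<..<1}"
  shows "1 - e * cos \<psi> > 0"
proof -
  have "\<bar>e * cos \<psi>\<bar> \<le> \<bar>e\<bar> * 1" unfolding abs_mult by (intro mult_left_mono) auto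
  then show ?thesis using assms by auto
qed

text \<open>S is an incomplete elliptic integral: time as a function of the phase, up to division by
  \<kappa> J(e). J(e) is the mean of the integrand over a period, and dividing by it makes the
  period independent of e.\<close>

lemma phase_time:
  obtains S :: "real \<times> real \<Rightarrow> real" and J :: "real \<Rightarrow> real"
  where "smooth_on ({-1<..<1} \<times> UNIV) S" "\<And>e. S (e, 0) = 0"
    "\<And>e \<psi>. e \<in> {-1<..<1} \<Longrightarrow> ((\<lambda>\<psi>. S (e, \<psi>)) has_real_derivative 1 / sqrt (1 - e * cos \<psi>)) (at \<psi>)"
    "\<And>e \<psi>. e \<in> {-1<..<1} \<Longrightarrow> S (e, \<psi> + 2 * pi) = S (e, \<psi>) + 2 * pi * J e"
    "\<And>\<psi>. S (0, \<psi>) = \<psi>"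
    "smooth_on {-1<..<1} J" "\<And>e. e \<in> {-1<..<1} \<Longrightarrow> J e > 0" "J 0 = 1" "(J has_real_derivative 0) (at 0)"
proof -
  let ?I = "{-1<..<1::real}"
  let ?f = "\<lambda>x::real \<times> real. 1 / sqrt (1 - fst x * cos (snd x))"
  have opn: "open (?I \<times> (UNIV :: real set))" by (intro open_Times) auto
  have pos: "1 - e * cos \<psi> > 0" if "e \<in> ?I" for e \<psi> by (rule one_minus_mult_cos_pos[OF that])
  have smf: "smooth_on (?I \<times> UNIV) ?f"
    by (intro smooth_intros opn) (use pos in \<open>fastforce simp: less_imp_neq[symmetric]\<close>)+
  obtain S where S: "smooth_on (?I \<times> UNIV) S" "\<And>e. S (e, 0) = 0"
    "\<And>e \<psi>. e \<in> ?I \<Longrightarrow> ((\<lambda>\<psi>. S (e, \<psi>)) has_real_derivative ?f (e, \<psi>)) (at \<psi>)"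
    using smooth_on_antiderivative[OF smf open_greaterThanLessThan] by blast
  define J where "J e = S (e, 2 * pi) / (2 * pi)" for e
  have per: "S (e, \<psi> + 2 * pi) = S (e, \<psi>) + 2 * pi * J e" if e: "e \<in> ?I" for e \<psi>
  proof -
    have "S (e, \<psi> + 2 * pi) - 2 * pi * J e = S (e, \<psi>)"
    proof (rule equal_derivatives_imp_eq[where a = 0 and f' = "\<lambda>\<psi>. ?f (e, \<psi>)"
          and f = "\<lambda>\<psi>. S (e, \<psi> + 2 * pi) - 2 * pi * J e" and g = "\<lambda>\<psi>. S (e, \<psi>)"])
      show "((\<lambda>\<psi>. S (e, \<psi>)) has_real_derivative ?f (e, \<psi>)) (at \<psi>)" for \<psi> by (rule S(3)[OF e])
      show "((\<lambda>\<psi>. S (e, \<psi> + 2 * pi) - 2 * pi * J e) has_real_derivative ?f (e, \<psi>)) (at \<psi>)" for \<psi>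
        using DERIV_diff[OF S(3)[OF e, of "\<psi> + 2 * pi", unfolded DERIV_shift] DERIV_const] by simp
    qed (simp add: S(2) J_def)
    then show ?thesis by simp
  qed
  have S0: "S (0, \<psi>) = \<psi>" for \<psi>
    by (rule equal_derivatives_imp_eq[where f' = "\<lambda>_. 1" and a = 0]) (use S(2) S(3)[of 0] in auto)
  have smJ: "smooth_on ?I J"
    unfolding J_def
    by (intro smooth_intros smooth_on_compose[OF S(1), where g = "\<lambda>e. (e, 2 * pi)"]) auto
  have "J e > 0" if e: "e \<in> ?I" for e
  proof -
    have "S (e, 0) < S (e, 2 * pi)"
    proof (rule DERIV_pos_imp_increasing[where f = "\<lambda>\<psi>. S (e, \<psi>)"])
      fix x
      show "\<exists>y. ((\<lambda>\<psi>. S (e, \<psi>)) has_real_derivative y) (at x) \<and> 0 < y"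
        using S(3)[OF e, of x] pos[OF e, of x] by (intro exI[of _ "?f (e, x)"]) simp
    qed simp
    then show ?thesis by (simp add: S(2) J_def)
  qed
  \<comment> \<open>To first order in e the integrand changes by cos \<psi> / 2 times e, which has
    mean zero over a period.\<close>
  moreover have "(J has_real_derivative 0) (at 0)"
  proof -
    note par = antiderivative_parameter_derivative[OF S(1,2,3) smf open_greaterThanLessThan, where p = 0 and h = 1]
    have Df: "frechet_derivative ?f (at (0, \<psi>)) (1, 0) = cos \<psi> / 2" for \<psi>
    proof (rule frechet_derivative_along_line)
      show "?f differentiable at (0, \<psi>)" by (rule smooth_on_differentiable[OF smf]) simp
      have "((\<lambda>r. 1 / sqrt (1 - r * cos \<psi>)) has_real_derivative cos \<psi> / 2) (at 0)"
        by (auto intro!: derivative_eq_intros)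
      then show "((\<lambda>r. ?f ((0, \<psi>) + r *\<^sub>R (1, 0))) has_vector_derivative cos \<psi> / 2) (at 0)"
        by (simp add: has_real_derivative_iff_has_vector_derivative)
    qed
    have "frechet_derivative S (at (0, s)) (1, 0) = sin s / 2" for s
    proof (rule equal_derivatives_imp_eq[where f = "\<lambda>s. frechet_derivative S (at (0, s)) (1, 0)"
          and g = "\<lambda>s. sin s / 2" and f' = "\<lambda>\<psi>. cos \<psi> / 2" and a = 0])
      show "((\<lambda>s. frechet_derivative S (at (0, s)) (1, 0)) has_real_derivative cos s / 2) (at s)" for s
        using par(1)[of s] unfolding Df by simp
      show "((\<lambda>s. sin s / 2) has_real_derivative cos s / 2) (at s)" for s :: real
        by (auto intro!: derivative_eq_intros)
      show "frechet_derivative S (at (0, 0)) (1, 0) = sin 0 / 2"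
        using par(2) by simp
    qed
    from this[of "2 * pi"] have "frechet_derivative S (at (0, 2 * pi)) (1, 0) = 0" by simp
    moreover have "((\<lambda>r. S ((0, 2 * pi) + r *\<^sub>R (1, 0))) has_vector_derivative frechet_derivative S (at (0, 2 * pi)) (1, 0)) (at 0)"
      by (rule has_derivative_along_line) (use smooth_on_has_derivative[OF S(1)] in simp)
    ultimately have "((\<lambda>r. S (r, 2 * pi)) has_real_derivative 0) (at 0)"
      by (simp add: has_real_derivative_iff_has_vector_derivative)
    then show ?thesis unfolding J_def by (auto intro!: derivative_eq_intros)
  qed
  ultimately show ?thesis using that[of S J] S per S0 smJ by (simp add: J_def)
qed

text \<open>The phase inverts the time integral: \<psi>(e, s) solves S(e, \<psi>) = \<kappa> J(e) s.
  S increases strictly in \<psi> and gains 2 pi J(e) per turn, so the solution exists and is unique;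
  smoothness comes from the implicit function theorem.\<close>

lemma phase_function:
  fixes S :: "real \<times> real \<Rightarrow> real" and J :: "real \<Rightarrow> real" and \<kappa> :: real
  assumes S: "smooth_on ({-1<..<1} \<times> UNIV) S" "\<And>e. S (e, 0) = 0"
    "\<And>e \<psi>. e \<in> {-1<..<1} \<Longrightarrow> ((\<lambda>\<psi>. S (e, \<psi>)) has_real_derivative 1 / sqrt (1 - e * cos \<psi>)) (at \<psi>)"
    "\<And>e \<psi>. e \<in> {-1<..<1} \<Longrightarrow> S (e, \<psi> + 2 * pi) = S (e, \<psi>) + 2 * pi * J e"
    "\<And>\<psi>. S (0, \<psi>) = \<psi>"
    and J: "smooth_on {-1<..<1} J" "\<And>e. e \<in> {-1<..<1} \<Longrightarrow> J e > 0" "J 0 = 1"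
    and "\<kappa> > 0"
  obtains \<psi> where "smooth_on ({-1<..<1} \<times> UNIV) \<psi>" "\<And>e. e \<in> {-1<..<1} \<Longrightarrow> \<psi> (e, 0) = 0" "\<And>s. \<psi> (0, s) = \<kappa> * s"
    "\<And>e s. e \<in> {-1<..<1} \<Longrightarrow>
      ((\<lambda>s. \<psi> (e, s)) has_real_derivative \<kappa> * J e * sqrt (1 - e * cos (\<psi> (e, s)))) (at s)"
    "\<And>e s. e \<in> {-1<..<1} \<Longrightarrow> \<psi> (e, s + 2 * pi / \<kappa>) = \<psi> (e, s) + 2 * pi"
proof -
  let ?I = "{-1<..<1::real}"
  have mono: "S (e, x) < S (e, y)" if "e \<in> ?I" "x < y" for e x y
  proof (rule DERIV_pos_imp_increasing[OF that(2), where f = "\<lambda>\<psi>. S (e, \<psi>)"])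
    fix z
    show "\<exists>y. ((\<lambda>\<psi>. S (e, \<psi>)) has_real_derivative y) (at z) \<and> 0 < y"
      using S(3)[OF that(1), of z] one_minus_mult_cos_pos[OF that(1), of z]
      by (intro exI[of _ "1 / sqrt (1 - e * cos z)"]) simp
  qed
  have inj: "x = y" if "e \<in> ?I" "S (e, x) = S (e, y)" for e x y
    using mono[OF that(1), of x y] mono[OF that(1), of y x] that(2) by (cases x y rule: linorder_cases) auto
  have mult: "S (e, of_int n * (2 * pi)) = of_int n * (2 * pi * J e)" if e: "e \<in> ?I" for e n
  proof -
    \<comment> \<open>S minus its mean growth J(e) \<psi> is periodic in \<psi>.\<close>
    have "S (e, 0 + of_int n * (2 * pi)) - J e * (0 + of_int n * (2 * pi)) = S (e, 0) - J e * 0"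
      by (rule periodic_int_multiple[where f = "\<lambda>\<psi>. S (e, \<psi>) - J e * \<psi>"])
        (unfold S(4)[OF e], simp add: algebra_simps)
    then show ?thesis by (simp add: S(2))
  qed
  have ex: "\<exists>y. S (e, y) = \<tau>" if e: "e \<in> ?I" for e \<tau>
  proof -
    have pos: "2 * pi * J e > 0" using J(2)[OF e] by simp
    then obtain n :: nat where "\<bar>\<tau>\<bar> \<le> of_nat n * (2 * pi * J e)"
      using reals_Archimedean3[OF pos] by (meson less_imp_le)
    then have n: "- (of_int (int n) * (2 * pi * J e)) \<le> \<tau>" "\<tau> \<le> of_int (int n) * (2 * pi * J e)" by auto
    have "\<exists>y\<ge>of_int (- int n) * (2 * pi). y \<le> of_int (int n) * (2 * pi) \<and> S (e, y) = \<tau>"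
    proof (rule IVT')
      show "S (e, of_int (- int n) * (2 * pi)) \<le> \<tau>" "\<tau> \<le> S (e, of_int (int n) * (2 * pi))"
        unfolding mult[OF e] using n by simp_all
      show "continuous_on {of_int (- int n) * (2 * pi)..of_int (int n) * (2 * pi)} (\<lambda>y. S (e, y))"
        by (rule DERIV_continuous_on[OF DERIV_subset[OF S(3)[OF e] subset_UNIV]])
    qed simp
    then show ?thesis by blast
  qed
  define \<psi> where "\<psi> x = (THE y. S (fst x, y) = \<kappa> * J (fst x) * snd x)" for x
  have \<psi>_unique: "\<psi> (e, s) = y" if "e \<in> ?I" "S (e, y) = \<kappa> * J e * s" for e s y
    unfolding \<psi>_def using that inj by (intro the_equality) auto
  have S\<psi>: "S (e, \<psi> (e, s)) = \<kappa> * J e * s" if "e \<in> ?I" for e s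
    using ex[OF that, of "\<kappa> * J e * s"] \<psi>_unique[OF that] by metis
  have opn: "open (?I \<times> (UNIV :: real set))" by (intro open_Times) auto
  have opn2: "open ((?I \<times> (UNIV :: real set)) \<times> (UNIV :: real set))" by (intro open_Times) auto
  let ?F = "\<lambda>x::(real \<times> real) \<times> real. S (fst (fst x), snd x) - \<kappa> * J (fst (fst x)) * snd (fst x)"
  have smF: "smooth_on ((?I \<times> UNIV) \<times> UNIV) ?F"
    by (intro smooth_intros smooth_on_compose[OF S(1), where g = "\<lambda>x. (fst (fst x), snd x)"]
        smooth_on_compose[OF J(1), where g = "\<lambda>x. fst (fst x)"] opn2) auto
  have sm\<psi>: "smooth_on (?I \<times> UNIV) \<psi>"
  proof (rule smooth_on_local[OF _ opn])
    fix p :: "real \<times> real" assume p: "p \<in> ?I \<times> UNIV"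
    then obtain e s where es: "p = (e, s)" "e \<in> ?I" by auto
    have "((\<lambda>y. ?F (p, y)) has_real_derivative 1 / sqrt (1 - e * cos (\<psi> p))) (at (\<psi> p))"
      using DERIV_diff[OF S(3)[OF es(2)] DERIV_const] by (simp add: es)
    then have "((\<lambda>y. ?F (p, y)) has_vector_derivative 1 / sqrt (1 - e * cos (\<psi> p))) (at (\<psi> p))"
      by (simp add: has_real_derivative_iff_has_vector_derivative)
    from vector_derivative_unique_at[OF smooth_on_has_vector_derivative_snd[OF smF p] this]
    have "frechet_derivative ?F (at (p, \<psi> p)) (0, 1) \<noteq> 0"
      using one_minus_mult_cos_pos[OF es(2), of "\<psi> p"] by simp
    moreover have "?F (p, \<psi> p) = 0" using S\<psi>[OF es(2)] by (simp add: es)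
    ultimately obtain V Y where V: "open V" "p \<in> V" "smooth_on V Y"
      and Y: "\<And>q. q \<in> V \<Longrightarrow> (q, Y q) \<in> (?I \<times> UNIV) \<times> UNIV \<and> ?F (q, Y q) = 0"
      using implicit_function_smooth[OF smF, of p "\<psi> p"] p by (metis (no_types, lifting) SigmaI UNIV_I)
    \<comment> \<open>Injectivity of S in the phase identifies the local branch Y with the globally
      defined \<psi>.\<close>
    have "smooth_on V \<psi>"
    proof (rule smooth_on_cong[OF V(3)])
      show "Y q = \<psi> q" if "q \<in> V" for q
        using \<psi>_unique[of "fst q" "Y q" "snd q"] Y[OF that] by (auto simp: mem_Times_iff)
    qed
    then show "\<exists>V. p \<in> V \<and> smooth_on V \<psi>" using V by blast
  qed
  have d\<psi>: "((\<lambda>s. \<psi> (e, s)) has_real_derivative \<kappa> * J e * sqrt (1 - e * cos (\<psi> (e, s)))) (at s)"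
    if e: "e \<in> ?I" for e s
  proof -
    let ?q = "sqrt (1 - e * cos (\<psi> (e, s)))"
    have q: "?q > 0" using one_minus_mult_cos_pos[OF e] by simp
    obtain D where D: "((\<lambda>s. \<psi> (e, s)) has_real_derivative D) (at s)"
      using smooth_on_has_vector_derivative_snd[OF sm\<psi> e]
      by (auto simp: has_real_derivative_iff_has_vector_derivative)
    have "((\<lambda>s. S (e, \<psi> (e, s))) has_real_derivative 1 / ?q * D) (at s)"
      by (rule DERIV_chain2[OF S(3)[OF e] D])
    moreover have "((\<lambda>s. \<kappa> * J e * s) has_real_derivative \<kappa> * J e) (at s)"
      by (auto intro!: derivative_eq_intros)
    ultimately have "1 / ?q * D = \<kappa> * J e"
      unfolding S\<psi>[OF e] by (rule DERIV_unique)
    then have "D = \<kappa> * J e * ?q" using q by (simp add: field_simps)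
    then show ?thesis using D by simp
  qed
  show ?thesis
  proof (rule that[OF sm\<psi> _ _ d\<psi>])
    show "\<psi> (e, 0) = 0" if "e \<in> ?I" for e by (rule \<psi>_unique[OF that]) (simp add: S(2))
    show "\<psi> (0, s) = \<kappa> * s" for s by (rule \<psi>_unique) (simp_all add: S(5) J(3))
    show "\<psi> (e, s + 2 * pi / \<kappa>) = \<psi> (e, s) + 2 * pi" if e: "e \<in> ?I" for e s
    proof (rule \<psi>_unique[OF e])
      show "S (e, \<psi> (e, s) + 2 * pi) = \<kappa> * J e * (s + 2 * pi / \<kappa>)"
        unfolding S(4)[OF e] S\<psi>[OF e] using \<open>\<kappa> > 0\<close> by (simp add: field_simps)
    qed
  qed
qed

section \<open>The swept angle and the closing condition\<close>

lemma has_vector_derivative_compose_frechet: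
  assumes "f differentiable (at (g t))" "(g has_vector_derivative v) (at t)"
  shows "((\<lambda>r. f (g r)) has_vector_derivative frechet_derivative f (at (g t)) v) (at t)"
proof -
  have f: "(f has_derivative frechet_derivative f (at (g t))) (at (g t))"
    using assms(1) by (simp add: frechet_derivative_works)
  from has_derivative_compose[OF assms(2)[unfolded has_vector_derivative_def] f]
  show ?thesis
    unfolding has_vector_derivative_def using linear_scale[OF has_derivative_linear[OF f]] by simp
qed

text \<open>These formulas come from comparing coefficients in
  \<open>(1 - z\<^sup>2) (E - 2 \<mu> z) - (c - \<mu> z)\<^sup>2 = 2 \<mu> ((z - m)\<^sup>2 - b\<^sup>2) (z - m - h)\<close>, where \<open>h = (\<kappa> J e)\<^sup>2 / (2 \<mu>)\<close> and
  \<open>b = e h\<close>: the angular momentum \<open>c\<close> is \<open>ang_mom\<close>, and the condition left after eliminating \<open>E\<close> is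
  \<open>constraint = 0\<close>.\<close>

definition amplitude :: "real \<Rightarrow> (real \<Rightarrow> real) \<Rightarrow> real \<Rightarrow> real \<Rightarrow> real" where
  "amplitude \<kappa> J e \<mu> = e * ((\<kappa> * J e)\<^sup>2 / (2 * \<mu>))"

definition ang_mom :: "real \<Rightarrow> (real \<Rightarrow> real) \<Rightarrow> real \<Rightarrow> real \<Rightarrow> real \<Rightarrow> real" where
  "ang_mom \<kappa> J e m \<mu> = 1 + 3 * m\<^sup>2 + m * ((\<kappa> * J e)\<^sup>2 / \<mu>) - (amplitude \<kappa> J e \<mu>)\<^sup>2"

definition height :: "real \<Rightarrow> (real \<Rightarrow> real) \<Rightarrow> real \<Rightarrow> real \<Rightarrow> real \<Rightarrow> real \<Rightarrow> real" where
  "height \<kappa> J e m \<mu> \<psi> = m + amplitude \<kappa> J e \<mu> * cos \<psi>"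

text \<open>The longitude's rate \<theta>', solved from the conserved vertical component c = (1 -
  z^2) \<theta>' + \<mu> z.\<close>

definition ang_vel :: "real \<Rightarrow> (real \<Rightarrow> real) \<Rightarrow> real \<Rightarrow> real \<Rightarrow> real \<Rightarrow> real \<Rightarrow> real" where
  "ang_vel \<kappa> J e m \<mu> \<psi> =
     (ang_mom \<kappa> J e m \<mu> - \<mu> * height \<kappa> J e m \<mu> \<psi>) / (1 - (height \<kappa> J e m \<mu> \<psi>)\<^sup>2)"

definition constraint :: "real \<Rightarrow> (real \<Rightarrow> real) \<Rightarrow> real \<Rightarrow> real \<Rightarrow> real \<Rightarrow> real" where
  "constraint \<kappa> J e m \<mu> = (ang_mom \<kappa> J e m \<mu>)\<^sup>2 + \<mu>\<^sup>2 - (\<kappa> * J e)\<^sup>2 - 6 * \<mu> * m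
     - (2 * \<mu> * m + (\<kappa> * J e)\<^sup>2) * (m\<^sup>2 - (amplitude \<kappa> J e \<mu>)\<^sup>2)"

text \<open>The last inequality keeps |z| < 1 for every phase, so orbits avoid the poles, where the
  longitude breaks down. The nesting ((e, m), \<mu>) puts the unknown that is eliminated first into
  last place, as \<open>implicit_function_smooth\<close> expects.\<close>

definition param_dom :: "real \<Rightarrow> (real \<Rightarrow> real) \<Rightarrow> ((real \<times> real) \<times> real) set" where
  "param_dom \<kappa> J = {x. fst (fst x) \<in> {-1<..<1} \<and> snd x > 0 \<and>
     \<bar>snd (fst x)\<bar> + \<bar>amplitude \<kappa> J (fst (fst x)) (snd x)\<bar> < 1}"

lemma abs_height_less_1:
  assumes "((e, m), \<mu>) \<in> param_dom \<kappa> J"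
  shows "\<bar>height \<kappa> J e m \<mu> \<psi>\<bar> < 1"
proof -
  have "\<bar>height \<kappa> J e m \<mu> \<psi>\<bar> \<le> \<bar>m\<bar> + \<bar>amplitude \<kappa> J e \<mu> * cos \<psi>\<bar>"
    unfolding height_def by (rule abs_triangle_ineq)
  also have "\<bar>amplitude \<kappa> J e \<mu> * cos \<psi>\<bar> \<le> \<bar>amplitude \<kappa> J e \<mu>\<bar> * 1"
    unfolding abs_mult by (intro mult_left_mono) auto
  finally show ?thesis using assms by (simp add: param_dom_def)
qed

lemma height_square_less_1:
  "((e, m), \<mu>) \<in> param_dom \<kappa> J \<Longrightarrow> (height \<kappa> J e m \<mu> \<psi>)\<^sup>2 < 1"
  using abs_height_less_1 by (simp add: abs_square_less_1)

lemma open_param_dom: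
  assumes "smooth_on {-1<..<1} J"
  shows "open (param_dom \<kappa> J)"
proof -
  define A where "A = ({-1<..<1::real} \<times> (UNIV :: real set)) \<times> {0::real<..}"
  have opn: "open A" unfolding A_def by (intro open_Times) auto
  have smJ: "smooth_on A (\<lambda>x. J (fst (fst x)))"
    by (intro smooth_on_compose[OF assms, where g = "\<lambda>x. fst (fst x)"] smooth_intros opn) (auto simp: A_def)
  have "smooth_on A (\<lambda>x. amplitude \<kappa> J (fst (fst x)) (snd x))"
    unfolding amplitude_def by (intro smooth_intros opn smJ) (auto simp: A_def)
  then have "continuous_on A (\<lambda>x. \<bar>snd (fst x)\<bar> + \<bar>amplitude \<kappa> J (fst (fst x)) (snd x)\<bar>)"
    by (intro continuous_intros smooth_on_continuous_on)
  from continuous_open_preimage[OF this opn open_lessThan[of 1]]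
  have "open (A \<inter> (\<lambda>x. \<bar>snd (fst x)\<bar> + \<bar>amplitude \<kappa> J (fst (fst x)) (snd x)\<bar>) -` {..<1})" .
  also have "A \<inter> (\<lambda>x. \<bar>snd (fst x)\<bar> + \<bar>amplitude \<kappa> J (fst (fst x)) (snd x)\<bar>) -` {..<1} = param_dom \<kappa> J"
    by (auto simp: A_def param_dom_def mem_Times_iff)
  finally show ?thesis .
qed

lemma smooth_on_profile_coefficients:
  assumes J: "smooth_on {-1<..<1} J"
  shows "smooth_on (param_dom \<kappa> J) (\<lambda>x. constraint \<kappa> J (fst (fst x)) (snd (fst x)) (snd x))"
    and "smooth_on (param_dom \<kappa> J \<times> UNIV)
      (\<lambda>x. ang_vel \<kappa> J (fst (fst (fst x))) (snd (fst (fst x))) (snd (fst x)) (snd x))"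
    and "smooth_on (param_dom \<kappa> J) (\<lambda>x. amplitude \<kappa> J (fst (fst x)) (snd x))"
proof -
  let ?W = "param_dom \<kappa> J"
  note opn = open_param_dom[OF J, of \<kappa>]
  have pos: "snd x \<noteq> 0" "2 * snd x \<noteq> 0" if "x \<in> ?W" for x using that by (auto simp: param_dom_def)
  have smJ: "smooth_on ?W (\<lambda>x. J (fst (fst x)))"
    by (intro smooth_on_compose[OF J, where g = "\<lambda>x. fst (fst x)"] smooth_intros opn) (auto simp: param_dom_def)
  show amp: "smooth_on ?W (\<lambda>x. amplitude \<kappa> J (fst (fst x)) (snd x))"
    unfolding amplitude_def by (intro smooth_intros opn smJ) (use pos in auto)
  have mom: "smooth_on ?W (\<lambda>x. ang_mom \<kappa> J (fst (fst x)) (snd (fst x)) (snd x))"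
    unfolding ang_mom_def by (intro smooth_intros opn smJ amp) (use pos in auto)
  show "smooth_on ?W (\<lambda>x. constraint \<kappa> J (fst (fst x)) (snd (fst x)) (snd x))"
    unfolding constraint_def by (intro smooth_intros opn smJ amp mom)
  have opn2: "open (?W \<times> (UNIV :: real set))" using opn by (intro open_Times) auto
  have fst: "smooth_on (?W \<times> (UNIV :: real set)) (\<lambda>x. F (fst x))" if "smooth_on ?W F"
    for F :: "(real \<times> real) \<times> real \<Rightarrow> real"
    by (rule smooth_on_compose[OF that]) (auto intro!: smooth_intros opn2)
  have hgt: "smooth_on (?W \<times> UNIV) (\<lambda>x. height \<kappa> J (fst (fst (fst x))) (snd (fst (fst x))) (snd (fst x)) (snd x))"
    unfolding height_def by (intro smooth_intros opn2 fst[OF amp])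
  show "smooth_on (?W \<times> UNIV) (\<lambda>x. ang_vel \<kappa> J (fst (fst (fst x))) (snd (fst (fst x))) (snd (fst x)) (snd x))"
    unfolding ang_vel_def
  proof (intro smooth_intros opn2 hgt fst[OF mom])
    fix x assume "x \<in> ?W \<times> (UNIV :: real set)"
    then show "1 - (height \<kappa> J (fst (fst (fst x))) (snd (fst (fst x))) (snd (fst x)) (snd x))\<^sup>2 \<noteq> 0"
      using height_square_less_1[of "fst (fst (fst x))" "snd (fst (fst x))" "snd (fst x)" \<kappa> J "snd x"]
      by (auto simp: mem_Times_iff)
  qed
qed

text \<open>The angle of a solution as a function of the phase, up to the factor \<open>\<kappa> J e\<close>.\<close>

lemma swept_angle:
  assumes J: "smooth_on {-1<..<1} J" "J 0 = 1" "(J has_real_derivative 0) (at 0)" and "\<kappa> > 1"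
  obtains \<Theta> where "smooth_on (param_dom \<kappa> J \<times> UNIV) \<Theta>"
    "\<And>x. \<Theta> (x, 0) = 0"
    "\<And>e m \<mu> \<psi>. ((e, m), \<mu>) \<in> param_dom \<kappa> J \<Longrightarrow>
      ((\<lambda>\<psi>. \<Theta> (((e, m), \<mu>), \<psi>)) has_real_derivative ang_vel \<kappa> J e m \<mu> \<psi> / sqrt (1 - e * cos \<psi>)) (at \<psi>)"
    "\<And>x \<psi>. x \<in> param_dom \<kappa> J \<Longrightarrow> \<Theta> (x, \<psi> + 2 * pi) = \<Theta> (x, \<psi>) + \<Theta> (x, 2 * pi)"
    "\<And>m \<mu> \<psi>. ((0, m), \<mu>) \<in> param_dom \<kappa> J \<Longrightarrow>
      \<Theta> (((0, m), \<mu>), \<psi>) = \<psi> * ((1 + 3 * m\<^sup>2 + m * (\<kappa>\<^sup>2 / \<mu>) - \<mu> * m) / (1 - m\<^sup>2))"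
    "((\<lambda>e. \<Theta> (((e, 0), sqrt (\<kappa>\<^sup>2 - 1)), 2 * pi)) has_real_derivative 0) (at 0)"
proof -
  let ?W = "param_dom \<kappa> J"
  let ?f = "\<lambda>x. ang_vel \<kappa> J (fst (fst (fst x))) (snd (fst (fst x))) (snd (fst x)) (snd x) /
      sqrt (1 - fst (fst (fst x)) * cos (snd x))"
  note opn = open_param_dom[OF J(1), of \<kappa>]
  have opn2: "open (?W \<times> (UNIV :: real set))" using opn by (intro open_Times) auto
  have eI: "fst (fst x) \<in> {-1<..<1}" if "x \<in> ?W" for x using that by (auto simp: param_dom_def)
  have pos: "1 - fst (fst (fst x)) * cos (snd x) > 0" if "x \<in> ?W \<times> UNIV" for x
    using that by (intro one_minus_mult_cos_pos eI) (auto simp: mem_Times_iff)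
  have smf: "smooth_on (?W \<times> UNIV) ?f"
    by (intro smooth_intros opn2 smooth_on_profile_coefficients(2)[OF J(1)] pos)
      (use pos in \<open>fastforce simp: less_imp_neq[symmetric]\<close>)+
  obtain \<Theta> where \<Theta>: "smooth_on (?W \<times> UNIV) \<Theta>" "\<And>x. \<Theta> (x, 0) = 0"
    and d: "\<And>x \<psi>. x \<in> ?W \<Longrightarrow> ((\<lambda>\<psi>. \<Theta> (x, \<psi>)) has_real_derivative ?f (x, \<psi>)) (at \<psi>)"
    using smooth_on_antiderivative[OF smf opn] by blast
  have per: "\<Theta> (x, \<psi> + 2 * pi) = \<Theta> (x, \<psi>) + \<Theta> (x, 2 * pi)" if x: "x \<in> ?W" for x \<psi>
  proof -
    have "\<Theta> (x, \<psi> + 2 * pi) - \<Theta> (x, 2 * pi) = \<Theta> (x, \<psi>)"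
    proof (rule equal_derivatives_imp_eq[where a = 0 and f' = "\<lambda>\<psi>. ?f (x, \<psi>)"
          and f = "\<lambda>\<psi>. \<Theta> (x, \<psi> + 2 * pi) - \<Theta> (x, 2 * pi)" and g = "\<lambda>\<psi>. \<Theta> (x, \<psi>)"])
      have "?f (x, \<psi> + 2 * pi) = ?f (x, \<psi>)" for \<psi> by (simp add: ang_vel_def height_def)
      then show "((\<lambda>\<psi>. \<Theta> (x, \<psi> + 2 * pi) - \<Theta> (x, 2 * pi)) has_real_derivative ?f (x, \<psi>)) (at \<psi>)" for \<psi>
        using DERIV_diff[OF d[OF x, of "\<psi> + 2 * pi", unfolded DERIV_shift] DERIV_const] by (simp only: diff_zero)
    qed (use \<Theta>(2) d[OF x] in auto)
    then show ?thesis by simp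
  qed
  \<comment> \<open>For e = 0 the amplitude is 0, so the height is m and the integrand does not
    depend on the phase.\<close>
  have at0: "\<Theta> (((0, m), \<mu>), \<psi>) = \<psi> * ((1 + 3 * m\<^sup>2 + m * (\<kappa>\<^sup>2 / \<mu>) - \<mu> * m) / (1 - m\<^sup>2))"
    if x: "((0, m), \<mu>) \<in> ?W" for m \<mu> \<psi>
  proof (rule equal_derivatives_imp_eq[where a = 0 and f = "\<lambda>\<psi>. \<Theta> (((0, m), \<mu>), \<psi>)"])
    let ?c = "(1 + 3 * m\<^sup>2 + m * (\<kappa>\<^sup>2 / \<mu>) - \<mu> * m) / (1 - m\<^sup>2)"
    have "?f (((0, m), \<mu>), \<psi>) = ?c" for \<psi>
      by (simp add: ang_vel_def height_def ang_mom_def amplitude_def J(2))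
    then show "((\<lambda>\<psi>. \<Theta> (((0, m), \<mu>), \<psi>)) has_real_derivative ?c) (at \<psi>)" for \<psi>
      using d[OF x, of \<psi>] by (simp only:)
    show "((\<lambda>\<psi>. \<psi> * ?c) has_real_derivative ?c) (at \<psi>)" for \<psi>
      using DERIV_cmult_right[OF DERIV_ident[of "at \<psi>"], of ?c] by (simp only: mult_1)
  qed (simp add: \<Theta>(2))
  define \<mu>0 where "\<mu>0 = sqrt (\<kappa>\<^sup>2 - 1)"
  have "\<kappa>\<^sup>2 > 1" using \<open>\<kappa> > 1\<close> by (simp add: one_less_power)
  then have \<mu>0: "\<mu>0 > 0" by (simp add: \<mu>0_def)
  let ?p = "((0, 0), \<mu>0)"
  have p: "?p \<in> ?W" using \<mu>0 by (simp add: param_dom_def amplitude_def)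
  note par = antiderivative_parameter_derivative[OF \<Theta>(1,2) d smf opn p, where h = "((1, 0), 0)"]
  let ?h = "\<kappa>\<^sup>2 / (2 * \<mu>0)"
  \<comment> \<open>The term 1/2 comes from expanding 1 / sqrt (1 - e cos \<psi>), the term - \<mu>0
    ?h from the height in c - \<mu> z. Both multiply cos \<psi>, so the angle swept over a full
    period is stationary in e.\<close>
  have Df: "frechet_derivative ?f (at (?p, \<psi>)) (((1, 0), 0), 0) = (1 / 2 - \<mu>0 * ?h) * cos \<psi>" for \<psi>
  proof (rule frechet_derivative_along_line)
    show "?f differentiable at (?p, \<psi>)" by (rule smooth_on_differentiable[OF smf]) (use p in simp)
    have amp: "((\<lambda>r. amplitude \<kappa> J r \<mu>0) has_real_derivative ?h) (at 0)"
      unfolding amplitude_def using \<mu>0 J(2,3) by (auto intro!: derivative_eq_intros J(3))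
    have amp0: "amplitude \<kappa> J 0 \<mu>0 = 0" by (simp add: amplitude_def)
    have "((\<lambda>r. (1 - (amplitude \<kappa> J r \<mu>0)\<^sup>2 - \<mu>0 * (amplitude \<kappa> J r \<mu>0 * cos \<psi>)) /
       (1 - (amplitude \<kappa> J r \<mu>0 * cos \<psi>)\<^sup>2) / sqrt (1 - r * cos \<psi>)) has_real_derivative (1 / 2 - \<mu>0 * ?h) * cos \<psi>) (at 0)"
      using \<mu>0 by (auto intro!: derivative_eq_intros amp simp: amp0 algebra_simps)
    then show "((\<lambda>r. ?f ((?p, \<psi>) + r *\<^sub>R (((1, 0), 0), 0))) has_vector_derivative (1 / 2 - \<mu>0 * ?h) * cos \<psi>) (at 0)"
      by (simp add: has_real_derivative_iff_has_vector_derivative ang_vel_def height_def ang_mom_def)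
  qed
  have "frechet_derivative \<Theta> (at (?p, s)) (((1, 0), 0), 0) = (1 / 2 - \<mu>0 * ?h) * sin s" for s
  proof (rule equal_derivatives_imp_eq[where f = "\<lambda>s. frechet_derivative \<Theta> (at (?p, s)) (((1, 0), 0), 0)"
        and g = "\<lambda>s. (1 / 2 - \<mu>0 * ?h) * sin s" and f' = "\<lambda>s. (1 / 2 - \<mu>0 * ?h) * cos s" and a = 0])
    show "((\<lambda>s. frechet_derivative \<Theta> (at (?p, s)) (((1, 0), 0), 0)) has_real_derivative (1 / 2 - \<mu>0 * ?h) * cos s) (at s)" for s
      using par(1)[of s] unfolding Df .
    show "((\<lambda>s. (1 / 2 - \<mu>0 * ?h) * sin s) has_real_derivative (1 / 2 - \<mu>0 * ?h) * cos s) (at s)" for s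
      by (rule DERIV_cmult) (rule DERIV_sin)
    show "frechet_derivative \<Theta> (at (?p, 0)) (((1, 0), 0), 0) = (1 / 2 - \<mu>0 * ?h) * sin 0"
      using par(2) by simp
  qed
  from this[of "2 * pi"] have "frechet_derivative \<Theta> (at (?p, 2 * pi)) (((1, 0), 0), 0) = 0" by simp
  moreover have "((\<lambda>r. \<Theta> ((?p, 2 * pi) + r *\<^sub>R (((1, 0), 0), 0))) has_vector_derivative
      frechet_derivative \<Theta> (at (?p, 2 * pi)) (((1, 0), 0), 0)) (at 0)"
    by (rule has_derivative_along_line) (use smooth_on_has_derivative[OF \<Theta>(1)] p in simp)
  ultimately have "((\<lambda>e. \<Theta> (((e, 0), \<mu>0), 2 * pi)) has_real_derivative 0) (at 0)"
    by (simp add: has_real_derivative_iff_has_vector_derivative)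
  moreover have "((\<lambda>\<psi>. \<Theta> (((e, m), \<mu>), \<psi>)) has_real_derivative ang_vel \<kappa> J e m \<mu> \<psi> / sqrt (1 - e * cos \<psi>)) (at \<psi>)"
    if "((e, m), \<mu>) \<in> ?W" for e m \<mu> \<psi>
    using d[OF that, of \<psi>] by simp
  ultimately show ?thesis using that[of \<Theta>] \<Theta> per at0 unfolding \<mu>0_def by blast
qed

section \<open>The compatibility and closing conditions solved by nested implicit functions\<close>

text \<open>Both conditions hold at e = m = 0 with \<mu>0 = sqrt (\<kappa>^2 - 1) > 0. There
  compatibility has \<mu>-derivative 2 \<mu>0 and yields \<mu> = M(e, m); after inserting M, the
  closing condition has m-derivative 2 pi / \<mu>0 and yields m.\<close>

lemma parameter_curve:
  assumes J: "smooth_on {-1<..<1} J" "J 0 = 1" "(J has_real_derivative 0) (at 0)" and \<kappa>: "\<kappa> > 1"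
    and \<Theta>: "smooth_on (param_dom \<kappa> J \<times> UNIV) \<Theta>"
    "\<And>m \<mu> \<psi>. ((0, m), \<mu>) \<in> param_dom \<kappa> J \<Longrightarrow>
      \<Theta> (((0, m), \<mu>), \<psi>) = \<psi> * ((1 + 3 * m\<^sup>2 + m * (\<kappa>\<^sup>2 / \<mu>) - \<mu> * m) / (1 - m\<^sup>2))"
    "((\<lambda>e. \<Theta> (((e, 0), sqrt (\<kappa>\<^sup>2 - 1)), 2 * pi)) has_real_derivative 0) (at 0)"
  obtains V m \<mu> where "open V" "0 \<in> V" "smooth_on V m" "smooth_on V \<mu>" "m 0 = 0" "\<mu> 0 = sqrt (\<kappa>\<^sup>2 - 1)"
    "(m has_real_derivative 0) (at 0)"
    "\<And>e. e \<in> V \<Longrightarrow> ((e, m e), \<mu> e) \<in> param_dom \<kappa> J"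
    "\<And>e. e \<in> V \<Longrightarrow> constraint \<kappa> J e (m e) (\<mu> e) = 0"
    "\<And>e. e \<in> V \<Longrightarrow> \<Theta> (((e, m e), \<mu> e), 2 * pi) = 2 * pi * J e"
proof -
  let ?W = "param_dom \<kappa> J"
  note opn = open_param_dom[OF J(1), of \<kappa>]
  define \<mu>0 where "\<mu>0 = sqrt (\<kappa>\<^sup>2 - 1)"
  have "\<kappa>\<^sup>2 > 1" using \<open>\<kappa> > 1\<close> by (simp add: one_less_power)
  then have \<mu>0: "\<mu>0 > 0" "\<mu>0\<^sup>2 = \<kappa>\<^sup>2 - 1" by (simp_all add: \<mu>0_def)
  have p: "((0, 0), \<mu>) \<in> ?W" if "\<mu> > 0" for \<mu> using that by (simp add: param_dom_def amplitude_def)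
  let ?C = "\<lambda>x. constraint \<kappa> J (fst (fst x)) (snd (fst x)) (snd x)"
  note smC = smooth_on_profile_coefficients(1)[OF J(1), of \<kappa>]
  have C0: "?C ((0, 0), \<mu>) = 1 + \<mu>\<^sup>2 - \<kappa>\<^sup>2" for \<mu>
    by (simp add: constraint_def ang_mom_def amplitude_def J(2))
  have "frechet_derivative ?C (at ((0, 0), \<mu>0)) (0, 1) = 2 * \<mu>0"
  proof (rule frechet_derivative_along_line)
    show "?C differentiable at ((0, 0), \<mu>0)" by (rule smooth_on_differentiable[OF smC p[OF \<mu>0(1)]])
    have eq: "((0, 0), \<mu>0) + r *\<^sub>R (0, 1) = ((0, 0), \<mu>0 + r)" for r :: real
      by (simp add: zero_prod_def)
    have "((\<lambda>r. 1 + (\<mu>0 + r)\<^sup>2 - \<kappa>\<^sup>2) has_real_derivative 2 * \<mu>0) (at 0)"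
      by (auto intro!: derivative_eq_intros)
    then show "((\<lambda>r. ?C (((0, 0), \<mu>0) + r *\<^sub>R (0, 1))) has_vector_derivative 2 * \<mu>0) (at 0)"
      unfolding eq C0 by (simp add: has_real_derivative_iff_has_vector_derivative)
  qed
  then obtain V1 M where V1: "open V1" "(0, 0) \<in> V1" and M: "smooth_on V1 M" "M (0, 0) = \<mu>0"
    and V1M: "\<And>q. q \<in> V1 \<Longrightarrow> (q, M q) \<in> ?W \<and> ?C (q, M q) = 0"
    using implicit_function_smooth[OF smC p[OF \<mu>0(1)]] \<mu>0 C0[of \<mu>0] by auto
  define A where "A x = \<Theta> (x, 2 * pi) - 2 * pi * J (fst (fst x))" for x
  have smA: "smooth_on ?W A"
    unfolding A_def
    by (intro smooth_intros smooth_on_compose[OF \<Theta>(1), where g = "\<lambda>x. (x, 2 * pi)"]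
        smooth_on_compose[OF J(1), where g = "\<lambda>x. fst (fst x)"] opn) (auto simp: param_dom_def)
  define B where "B q = A (q, M q)" for q
  have smB: "smooth_on V1 B"
    unfolding B_def by (intro smooth_on_compose[OF smA, where g = "\<lambda>q. (q, M q)"] smooth_intros M V1)
      (use V1M in auto)
  let ?DB = "frechet_derivative B (at (0, 0))"
  have dB: "B differentiable at (0, 0)" by (rule smooth_on_differentiable[OF smB V1(2)])
  have linB: "linear ?DB" using smooth_on_has_derivative[OF smB V1(2)] has_derivative_linear by blast
  have B0: "B (0, 0) = 0" using \<Theta>(2)[OF p[OF \<mu>0(1)]] by (simp add: B_def A_def M J)
  have dM: "M differentiable at (0, 0)" by (rule smooth_on_differentiable[OF M(1) V1(2)])
  \<comment> \<open>On the line e = 0 the swept angle is explicit. M occurs there only in terms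
    carrying a factor m, so its unknown derivative M1 drops out at m = 0.\<close>
  have B01: "?DB (0, 1) = 2 * pi / \<mu>0"
  proof (rule frechet_derivative_along_line[OF dB])
    obtain M1 where M1: "((\<lambda>r. M (0, r)) has_real_derivative M1) (at 0)"
      using has_vector_derivative_compose_frechet[of M "\<lambda>r. (0, r)" 0 "(0, 1)"] dM
        has_vector_derivative_Pair[OF has_vector_derivative_const has_vector_derivative_id]
      by (auto simp: has_real_derivative_iff_has_vector_derivative)
    have "((\<lambda>r. 2 * pi * ((1 + 3 * r\<^sup>2 + r * (\<kappa>\<^sup>2 / M (0, r)) - M (0, r) * r) / (1 - r\<^sup>2)) - 2 * pi * J 0)
        has_real_derivative 2 * pi * (\<kappa>\<^sup>2 / \<mu>0 - \<mu>0)) (at 0)"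
      using \<mu>0 by (auto intro!: derivative_eq_intros M1 simp: M)
    moreover have "2 * pi * (\<kappa>\<^sup>2 / \<mu>0 - \<mu>0) = 2 * pi / \<mu>0"
    proof -
      have "\<kappa>\<^sup>2 / \<mu>0 - \<mu>0 = (\<kappa>\<^sup>2 - \<mu>0\<^sup>2) / \<mu>0"
        using \<mu>0(1) by (simp add: diff_divide_distrib power2_eq_square)
      also have "\<dots> = 1 / \<mu>0" by (simp add: \<mu>0(2))
      finally show ?thesis by simp
    qed
    ultimately have "((\<lambda>r. 2 * pi * ((1 + 3 * r\<^sup>2 + r * (\<kappa>\<^sup>2 / M (0, r)) - M (0, r) * r) / (1 - r\<^sup>2)) - 2 * pi * J 0)
        has_vector_derivative 2 * pi / \<mu>0) (at 0)"
      by (simp add: has_real_derivative_iff_has_vector_derivative)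
    then show "((\<lambda>r. B ((0, 0) + r *\<^sub>R (0, 1))) has_vector_derivative 2 * pi / \<mu>0) (at 0)"
    proof (rule has_vector_derivative_transform_within_open)
      show "open ((\<lambda>r. (0, r)) -` V1)" by (intro open_vimage V1 continuous_intros)
      show "2 * pi * ((1 + 3 * r\<^sup>2 + r * (\<kappa>\<^sup>2 / M (0, r)) - M (0, r) * r) / (1 - r\<^sup>2)) - 2 * pi * J 0 =
          B ((0, 0) + r *\<^sub>R (0, 1))" if "r \<in> (\<lambda>r. (0, r)) -` V1" for r
        using \<Theta>(2)[of r "M (0, r)" "2 * pi"] V1M[of "(0, r)"] that by (simp add: B_def A_def)
    qed (use V1 in simp)
  qed
  \<comment> \<open>This is what gives m'(0) = 0. The e-derivative vanishes because the swept angle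
    and J are both stationary at e = 0; the contribution through \<mu> vanishes because at e = m = 0
    the value of \<open>\<Theta>\<close> over a period is 2 pi for every \<mu>.\<close>
  have B10: "?DB (1, 0) = 0"
  proof (rule frechet_derivative_along_line[OF dB])
    let ?DA = "frechet_derivative A (at ((0, 0), \<mu>0))"
    have dA: "A differentiable at ((0, 0), \<mu>0)" by (rule smooth_on_differentiable[OF smA p[OF \<mu>0(1)]])
    have linA: "linear ?DA"
      using smooth_on_has_derivative[OF smA p[OF \<mu>0(1)]] has_derivative_linear by blast
    obtain M1 where M1: "((\<lambda>r. M (r, 0)) has_vector_derivative M1) (at 0)"
      using has_vector_derivative_compose_frechet[of M "\<lambda>r. (r, 0)" 0 "(1, 0)"] dM
        has_vector_derivative_Pair[OF has_vector_derivative_id has_vector_derivative_const] by auto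
    have A1: "?DA ((0, 0), 1) = 0"
    proof (rule frechet_derivative_along_line[OF dA])
      show "((\<lambda>r. A (((0, 0), \<mu>0) + r *\<^sub>R ((0, 0), 1))) has_vector_derivative 0) (at 0)"
      proof (rule has_vector_derivative_transform_within_open[OF has_vector_derivative_const[of 0]])
        show "open {-\<mu>0<..}" by simp
        show "0 = A (((0, 0), \<mu>0) + r *\<^sub>R ((0, 0), 1))" if "r \<in> {-\<mu>0<..}" for r
          using \<Theta>(2)[of 0 "\<mu>0 + r" "2 * pi"] p[of "\<mu>0 + r"] that by (simp add: A_def J)
      qed (use \<mu>0 in simp)
    qed
    have A2: "?DA ((1, 0), 0) = 0"
    proof (rule frechet_derivative_along_line[OF dA])
      have "((\<lambda>e. \<Theta> (((e, 0), \<mu>0), 2 * pi) - 2 * pi * J e) has_real_derivative 0) (at 0)"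
        using \<Theta>(3) by (auto simp: \<mu>0_def intro!: derivative_eq_intros J(3))
      then show "((\<lambda>r. A (((0, 0), \<mu>0) + r *\<^sub>R ((1, 0), 0))) has_vector_derivative 0) (at 0)"
        by (simp add: A_def has_real_derivative_iff_has_vector_derivative)
    qed
    have "?DA ((1, 0), M1) = ?DA (((1, 0), 0) + M1 *\<^sub>R ((0, 0), 1))" by simp
    also have "\<dots> = 0" unfolding linear_add[OF linA] linear_scale[OF linA] A1 A2 by simp
    finally have A3: "?DA ((1, 0), M1) = 0" .
    have "((\<lambda>r. ((r, 0), M (r, 0))) has_vector_derivative ((1, 0), M1)) (at 0)"
      by (intro has_vector_derivative_Pair has_vector_derivative_id has_vector_derivative_const M1)
    from has_vector_derivative_compose_frechet[of A, OF _ this] dA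
    show "((\<lambda>r. B ((0, 0) + r *\<^sub>R (1, 0))) has_vector_derivative 0) (at 0)"
      by (simp add: B_def M A3)
  qed
  have "?DB (0, 1) \<noteq> 0" using B01 \<mu>0 by simp
  then obtain V m where V: "open V" "0 \<in> V" and m: "smooth_on V m" "m 0 = 0"
    and Vm: "\<And>e. e \<in> V \<Longrightarrow> (e, m e) \<in> V1 \<and> B (e, m e) = 0"
    using implicit_function_smooth[OF smB V1(2) B0] by auto
  have "(m has_real_derivative 0) (at 0)"
  proof -
    obtain m1 where m1: "(m has_vector_derivative m1) (at 0)"
      using has_vector_derivative_compose_frechet[of m "\<lambda>r. r" 0 1] smooth_on_differentiable[OF m(1) V(2)]
      by auto
    have "((\<lambda>r. (r, m r)) has_vector_derivative (1, m1)) (at 0)"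
      by (intro has_vector_derivative_Pair has_vector_derivative_id m1)
    from has_vector_derivative_compose_frechet[of B, OF _ this] dB
    have 1: "((\<lambda>r. B (r, m r)) has_vector_derivative ?DB (1, m1)) (at 0)" by (simp add: m)
    have 2: "((\<lambda>r. B (r, m r)) has_vector_derivative 0) (at 0)"
      by (rule has_vector_derivative_transform_within_open[OF has_vector_derivative_const[of 0] V]) (use Vm in simp)
    have "?DB (1, m1) = ?DB ((1, 0) + m1 *\<^sub>R (0, 1))" by simp
    also have "\<dots> = m1 * (2 * pi / \<mu>0)" unfolding linear_add[OF linB] linear_scale[OF linB] B01 B10 by simp
    finally have "m1 * (2 * pi / \<mu>0) = 0" using vector_derivative_unique_at[OF 1 2] by simp
    then have "m1 = 0" using \<mu>0 by simp
    then show ?thesis using m1 by (simp add: has_real_derivative_iff_has_vector_derivative)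
  qed
  moreover have "smooth_on V (\<lambda>e. M (e, m e))"
    by (intro smooth_on_compose[OF M(1), where g = "\<lambda>e. (e, m e)"] smooth_intros m V) (use Vm in auto)
  moreover have "((e, m e), M (e, m e)) \<in> ?W" "constraint \<kappa> J e (m e) (M (e, m e)) = 0"
     "\<Theta> (((e, m e), M (e, m e)), 2 * pi) = 2 * pi * J e" if "e \<in> V" for e
    using Vm[OF that] V1M[of "(e, m e)"] by (auto simp: B_def A_def)
  ultimately show ?thesis
    using that[of V m "\<lambda>e. M (e, m e)"] V m M by (simp add: \<mu>0_def)
qed

section \<open>The family of orbits\<close>

text \<open>For z = m + b x, comparing coefficients factors the cubic as b^2 (1 - x^2) K (1 - e x),
  which is z'^2 in the phase variable; 6 \<mu> m + K - \<mu>^2 is E, read off from the z^2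
  coefficient. The second identity is z'' = P'(z) / 2. It is proved separately, since dividing the
  derivative of z'^2 = P(z) by z' fails at turning points; the constant coefficient, which carries
  the constraint, drops out of P'. The hypotheses on b and c are multiplied out so that the
  arithmetic stays polynomial.\<close>

lemma cubic_identities:
  fixes z c K e b m \<mu> x :: real
  assumes z: "z = m + b * x" and b: "2 * \<mu> * b = e * K" and c: "\<mu> * c = \<mu> + 3 * \<mu> * m\<^sup>2 + m * K - \<mu> * b\<^sup>2"
  shows "c\<^sup>2 + \<mu>\<^sup>2 - K - 6 * \<mu> * m - (2 * \<mu> * m + K) * (m\<^sup>2 - b\<^sup>2) = 0 \<Longrightarrow>
      b\<^sup>2 * (1 - x\<^sup>2) * (K * (1 - e * x)) =
      (1 - z\<^sup>2) * (6 * \<mu> * m + K - \<mu>\<^sup>2 - 2 * \<mu> * z) - (c - \<mu> * z)\<^sup>2"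
    and "- (b * K * (x * (1 - e * x) + (1 - x\<^sup>2) * e / 2)) =
      - z * (6 * \<mu> * m + K - \<mu>\<^sup>2 - 2 * \<mu> * z) - \<mu> * (1 - z\<^sup>2) + \<mu> * (c - \<mu> * z)"
proof -
  assume "c\<^sup>2 + \<mu>\<^sup>2 - K - 6 * \<mu> * m - (2 * \<mu> * m + K) * (m\<^sup>2 - b\<^sup>2) = 0"
  then have c2: "c\<^sup>2 = 6 * \<mu> * m + K - \<mu>\<^sup>2 + (2 * \<mu> * m + K) * (m\<^sup>2 - b\<^sup>2)" by simp
  have "(c - \<mu> * z)\<^sup>2 = c\<^sup>2 - 2 * (\<mu> * c) * z + \<mu>\<^sup>2 * z\<^sup>2"
    by (simp add: power2_eq_square algebra_simps)
  then have 1: "(c - \<mu> * z)\<^sup>2 = 6 * \<mu> * m + K - \<mu>\<^sup>2 + (2 * \<mu> * m + K) * (m\<^sup>2 - b\<^sup>2)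
      - 2 * (\<mu> + 3 * \<mu> * m\<^sup>2 + m * K - \<mu> * b\<^sup>2) * z + \<mu>\<^sup>2 * z\<^sup>2"
    unfolding c2 c .
  have "b\<^sup>2 * (1 - x\<^sup>2) * (K * (1 - e * x)) = b\<^sup>2 * (1 - x\<^sup>2) * (K - (e * K) * x)"
    by (simp add: algebra_simps)
  also have "\<dots> = b\<^sup>2 * (1 - x\<^sup>2) * (K - 2 * \<mu> * b * x)" unfolding b ..
  also have "\<dots> = (1 - z\<^sup>2) * (6 * \<mu> * m + K - \<mu>\<^sup>2 - 2 * \<mu> * z) - (c - \<mu> * z)\<^sup>2"
    unfolding 1 unfolding z by (simp add: power2_eq_square algebra_simps)
  finally show "b\<^sup>2 * (1 - x\<^sup>2) * (K * (1 - e * x)) =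
      (1 - z\<^sup>2) * (6 * \<mu> * m + K - \<mu>\<^sup>2 - 2 * \<mu> * z) - (c - \<mu> * z)\<^sup>2" .
next
  have "- (b * K * (x * (1 - e * x) + (1 - x\<^sup>2) * e / 2)) =
      - b * K * x + b * (e * K) * x\<^sup>2 - b * (e * K) * (1 - x\<^sup>2) / 2"
    by (simp add: power2_eq_square algebra_simps)
  also have "\<dots> = - b * K * x + b * (2 * \<mu> * b) * x\<^sup>2 - b * (2 * \<mu> * b) * (1 - x\<^sup>2) / 2"
    unfolding b ..
  also have "\<dots> = - z * (6 * \<mu> * m + K - \<mu>\<^sup>2 - 2 * \<mu> * z) - \<mu> * (1 - z\<^sup>2)
      + ((\<mu> + 3 * \<mu> * m\<^sup>2 + m * K - \<mu> * b\<^sup>2) - \<mu>\<^sup>2 * z)"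
    unfolding z by (simp add: power2_eq_square algebra_simps diff_divide_distrib)
  also have "\<dots> = - z * (6 * \<mu> * m + K - \<mu>\<^sup>2 - 2 * \<mu> * z) - \<mu> * (1 - z\<^sup>2) + \<mu> * (c - \<mu> * z)"
    unfolding c[symmetric] by (simp add: power2_eq_square algebra_simps)
  finally show "- (b * K * (x * (1 - e * x) + (1 - x\<^sup>2) * e / 2)) =
      - z * (6 * \<mu> * m + K - \<mu>\<^sup>2 - 2 * \<mu> * z) - \<mu> * (1 - z\<^sup>2) + \<mu> * (c - \<mu> * z)" .
qed

lemma has_vector_derivative_vector3:
  fixes f g h :: "real \<Rightarrow> real"
  assumes "(f has_real_derivative f') F" "(g has_real_derivative g') F" "(h has_real_derivative h') F"
  shows "((\<lambda>s. vector [f s, g s, h s] :: real^3) has_vector_derivative vector [f', g', h']) F"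
proof -
  have v: "vector [x, y, z] = x *\<^sub>R axis 1 1 + y *\<^sub>R axis 2 1 + z *\<^sub>R (axis 3 1 :: real^3)" for x y z :: real
    by (auto simp: vec_eq_iff forall_3 axis_def)
  show ?thesis
    unfolding v using assms
    unfolding has_real_derivative_iff_has_vector_derivative
    by (intro has_vector_derivative_add bounded_linear.has_vector_derivative[OF bounded_linear_scaleR_left])
qed

text \<open>In cylindrical coordinates \<open>(\<surd>(1 - z\<^sup>2), \<theta>, z)\<close> the vertical component of \<open>u \<times> u' + \<mu> u\<close> and the
  energy are conserved; \<open>c\<close> and \<open>E / 2\<close> are their values.\<close>

lemma cylindrical_solution:
  fixes z z' \<theta> :: "real \<Rightarrow> real" and \<mu> c E :: real and u :: "real \<Rightarrow> real^3"
  assumes z: "\<And>s. (z has_real_derivative z' s) (at s)"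
    and z': "\<And>s. (z' has_real_derivative
       - z s * (E - 2 * \<mu> * z s) - \<mu> * (1 - (z s)\<^sup>2) + \<mu> * (c - \<mu> * z s)) (at s)"
    and energy: "\<And>s. (z' s)\<^sup>2 = (1 - (z s)\<^sup>2) * (E - 2 * \<mu> * z s) - (c - \<mu> * z s)\<^sup>2"
    and \<theta>: "\<And>s. (\<theta> has_real_derivative (c - \<mu> * z s) / (1 - (z s)\<^sup>2)) (at s)"
    and lt: "\<And>s. (z s)\<^sup>2 < 1"
    and u: "u = (\<lambda>s. vector [sqrt (1 - (z s)\<^sup>2) * cos (\<theta> s), sqrt (1 - (z s)\<^sup>2) * sin (\<theta> s), z s])"
  obtains u' u'' where "\<And>s. (u has_vector_derivative u' s) (at s)" "\<And>s. (u' has_vector_derivative u'' s) (at s)"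
    "\<And>s. cross3 (u s) (u'' s) - \<mu> *\<^sub>R cross3 (axis 3 1) (u s) + \<mu> *\<^sub>R u' s = 0"
proof -
  define r where "r s = sqrt (1 - (z s)\<^sup>2)" for s
  have r: "r s > 0" "r s * r s = 1 - (z s)\<^sup>2" for s
    using lt[of s] by (simp_all add: r_def)
  define z2 where "z2 s = - z s * (E - 2 * \<mu> * z s) - \<mu> * (1 - (z s)\<^sup>2) + \<mu> * (c - \<mu> * z s)" for s
  define L where "L s = c - \<mu> * z s" for s
  define r' where "r' s = - (z s * z' s) / r s" for s
  \<comment> \<open>A and -B are the radial and azimuthal components of u''. A comes from
    differentiating |u| = 1 twice, u \<bullet> u'' = - |u'|^2 = - (E - 2 \<mu> z); B comes from L' =
    - \<mu> z', where L = r^2 \<theta>'.\<close>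
  define A where "A s = (- (z s * z2 s) - (E - 2 * \<mu> * z s)) / r s" for s
  define B where "B s = \<mu> * z' s / r s" for s
  have \<theta>': "(\<theta> has_real_derivative L s / (r s)\<^sup>2) (at s)" for s
    using \<theta>[of s] r(2)[of s] by (simp add: L_def power2_eq_square)
  have z2: "(z' has_real_derivative z2 s) (at s)" for s using z' by (simp add: z2_def)
  have dr: "(r has_real_derivative r' s) (at s)" for s
    unfolding r_def r'_def using lt[of s]
    by (auto intro!: derivative_eq_intros z simp: field_simps)
  have dL: "(L has_real_derivative - \<mu> * z' s) (at s)" for s
    unfolding L_def by (auto intro!: derivative_eq_intros z)
  \<comment> \<open>r'' is the radial acceleration A plus r \<theta>'^2 = L^2 / r^3; the energy
    identity is what brings the differentiated quotient into this form.\<close>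
  have dr': "(r' has_real_derivative A s + (L s)\<^sup>2 / (r s) ^ 3) (at s)" for s
  proof -
    have "(r' has_real_derivative (- ((z' s * z' s + z s * z2 s) * r s) + z s * z' s * r' s) / (r s * r s)) (at s)"
      unfolding r'_def[abs_def] using r(1)[of s]
      by (auto intro!: derivative_eq_intros z z2 dr[unfolded r'_def] simp: field_simps)
    moreover have "(- ((z' s * z' s + z s * z2 s) * r s) + z s * z' s * r' s) / (r s * r s) =
        A s + (L s)\<^sup>2 / (r s) ^ 3"
    proof -
      have "(z' s)\<^sup>2 = (r s)\<^sup>2 * (E - 2 * \<mu> * z s) - (L s)\<^sup>2"
        using energy[of s] r(2)[of s] by (simp add: L_def power2_eq_square)
      moreover have "(z' s)\<^sup>2 = (r s)\<^sup>2 * (z' s)\<^sup>2 + (z s)\<^sup>2 * (z' s)\<^sup>2"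
      proof -
        have "(r s)\<^sup>2 + (z s)\<^sup>2 = 1" using r(2)[of s] by (simp add: power2_eq_square)
        then show ?thesis by (simp add: distrib_right[symmetric])
      qed
      ultimately have "- ((z' s)\<^sup>2 * (r s)\<^sup>2) - (z s)\<^sup>2 * (z' s)\<^sup>2 = (L s)\<^sup>2 - (r s)\<^sup>2 * (E - 2 * \<mu> * z s)"
        by (simp add: algebra_simps)
      then have "(- ((z' s)\<^sup>2 * (r s)\<^sup>2) - (z s)\<^sup>2 * (z' s)\<^sup>2) / (r s) ^ 3 =
          ((L s)\<^sup>2 - (r s)\<^sup>2 * (E - 2 * \<mu> * z s)) / (r s) ^ 3" by simp
      then show ?thesis
        using r(1)[of s] by (simp add: A_def r'_def field_simps power2_eq_square power3_eq_cube)
    qed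
    ultimately show ?thesis by simp
  qed
  \<comment> \<open>The azimuthal velocity r \<theta>'.\<close>
  define P where "P s = L s / r s" for s
  have u_def: "u s = vector [r s * cos (\<theta> s), r s * sin (\<theta> s), z s]" for s
    by (simp add: u r_def)
  define u' where "u' s = (vector [r' s * cos (\<theta> s) - P s * sin (\<theta> s),
      r' s * sin (\<theta> s) + P s * cos (\<theta> s), z' s] :: real^3)" for s
  define u'' where "u'' s = (vector [A s * cos (\<theta> s) + B s * sin (\<theta> s),
      A s * sin (\<theta> s) - B s * cos (\<theta> s), z2 s] :: real^3)" for s
  have du: "(u has_vector_derivative u' s) (at s)" for s
    unfolding u_def[abs_def] u'_def
  proof (rule has_vector_derivative_vector3)
    have eq: "r s * (L s / (r s)\<^sup>2) = P s" using r(1)[of s] by (simp add: P_def power2_eq_square)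
    have "((\<lambda>s. r s * cos (\<theta> s)) has_real_derivative r' s * cos (\<theta> s) - r s * (L s / (r s)\<^sup>2) * sin (\<theta> s)) (at s)"
      by (auto intro!: derivative_eq_intros dr \<theta>')
    then show "((\<lambda>s. r s * cos (\<theta> s)) has_real_derivative r' s * cos (\<theta> s) - P s * sin (\<theta> s)) (at s)"
      unfolding eq .
    have "((\<lambda>s. r s * sin (\<theta> s)) has_real_derivative r' s * sin (\<theta> s) + r s * (L s / (r s)\<^sup>2) * cos (\<theta> s)) (at s)"
      by (auto intro!: derivative_eq_intros dr \<theta>')
    then show "((\<lambda>s. r s * sin (\<theta> s)) has_real_derivative r' s * sin (\<theta> s) + P s * cos (\<theta> s)) (at s)"
      unfolding eq .
  qed (rule z)
  have du': "(u' has_vector_derivative u'' s) (at s)" for s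
    unfolding u'_def[abs_def] u''_def
  proof (rule has_vector_derivative_vector3)
    have dP: "(P has_real_derivative - B s - L s * r' s / (r s)\<^sup>2) (at s)"
      unfolding P_def[abs_def] using r(1)[of s]
      by (auto intro!: derivative_eq_intros dL dr simp: B_def power2_eq_square field_simps)
    have P3: "P s * (L s / (r s)\<^sup>2) = (L s)\<^sup>2 / (r s) ^ 3"
      by (simp add: P_def power2_eq_square power3_eq_cube)
    have "((\<lambda>s. r' s * cos (\<theta> s) - P s * sin (\<theta> s)) has_real_derivative
        (A s + (L s)\<^sup>2 / (r s) ^ 3) * cos (\<theta> s) - r' s * (sin (\<theta> s) * (L s / (r s)\<^sup>2))
         - ((- B s - L s * r' s / (r s)\<^sup>2) * sin (\<theta> s) + P s * (L s / (r s)\<^sup>2) * cos (\<theta> s))) (at s)"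
      by (auto intro!: derivative_eq_intros dr' dP \<theta>' simp: mult_ac)
    then show "((\<lambda>s. r' s * cos (\<theta> s) - P s * sin (\<theta> s)) has_real_derivative
        A s * cos (\<theta> s) + B s * sin (\<theta> s)) (at s)"
      unfolding P3 by (simp add: algebra_simps)
    have "((\<lambda>s. r' s * sin (\<theta> s) + P s * cos (\<theta> s)) has_real_derivative
        (A s + (L s)\<^sup>2 / (r s) ^ 3) * sin (\<theta> s) + r' s * (cos (\<theta> s) * (L s / (r s)\<^sup>2))
         + ((- B s - L s * r' s / (r s)\<^sup>2) * cos (\<theta> s) - P s * (L s / (r s)\<^sup>2) * sin (\<theta> s))) (at s)"
      by (auto intro!: derivative_eq_intros dr' dP \<theta>' simp: mult_ac)
    then show "((\<lambda>s. r' s * sin (\<theta> s) + P s * cos (\<theta> s)) has_real_derivative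
        A s * sin (\<theta> s) - B s * cos (\<theta> s)) (at s)"
      unfolding P3 by (simp add: algebra_simps)
  qed (rule z2)
  have eqn: "cross3 (u s) (u'' s) - \<mu> *\<^sub>R cross3 (axis 3 1) (u s) + \<mu> *\<^sub>R u' s = 0" for s
  proof -
    \<comment> \<open>The equation in the moving frame: 1 is its radial, 2 its azimuthal and 3 its
      vertical component, up to sign. \<open>c1\<close> to \<open>c3\<close> rotate them back to
      Cartesian coordinates.\<close>
    have 1: "z s * B s + \<mu> * r' s = 0" by (simp add: B_def r'_def)
    have 3: "r s * B s = \<mu> * z' s" using r(1)[of s] by (simp add: B_def)
    have rA: "r s * A s = - (z s * z2 s) - (E - 2 * \<mu> * z s)" using r(1)[of s] by (simp add: A_def)
    have "r s * (r s * z2 s - z s * A s + \<mu> * r s - \<mu> * (P s)) =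
        (r s * r s) * z2 s - z s * (r s * A s) + \<mu> * (r s * r s) - \<mu> * L s"
      using r(1)[of s] by (simp add: P_def field_simps)
    also have "\<dots> = 0" unfolding rA r(2) by (simp add: z2_def L_def power2_eq_square algebra_simps)
    finally have 2: "r s * z2 s - z s * A s + \<mu> * r s - \<mu> * (P s) = 0" using r(1)[of s] by simp
    have c1: "r s * sin (\<theta> s) * z2 s - z s * (A s * sin (\<theta> s) - B s * cos (\<theta> s)) + \<mu> * (r s * sin (\<theta> s))
        + \<mu> * (r' s * cos (\<theta> s) - P s * sin (\<theta> s)) =
        (r s * z2 s - z s * A s + \<mu> * r s - \<mu> * (P s)) * sin (\<theta> s) + (z s * B s + \<mu> * r' s) * cos (\<theta> s)"
      by (simp add: algebra_simps)
    have c2: "z s * (A s * cos (\<theta> s) + B s * sin (\<theta> s)) - r s * cos (\<theta> s) * z2 s - \<mu> * (r s * cos (\<theta> s))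
        + \<mu> * (r' s * sin (\<theta> s) + P s * cos (\<theta> s)) =
        - (r s * z2 s - z s * A s + \<mu> * r s - \<mu> * (P s)) * cos (\<theta> s) + (z s * B s + \<mu> * r' s) * sin (\<theta> s)"
      by (simp add: algebra_simps)
    have "r s * cos (\<theta> s) * (A s * sin (\<theta> s) - B s * cos (\<theta> s)) - r s * sin (\<theta> s) * (A s * cos (\<theta> s) + B s * sin (\<theta> s))
        = - (r s * B s) * (cos (\<theta> s) * cos (\<theta> s) + sin (\<theta> s) * sin (\<theta> s))"
      by (simp only: left_diff_distrib right_diff_distrib distrib_left distrib_right mult_minus_left mult_minus_right) simp
    then have c3: "r s * cos (\<theta> s) * (A s * sin (\<theta> s) - B s * cos (\<theta> s)) - r s * sin (\<theta> s) * (A s * cos (\<theta> s) + B s * sin (\<theta> s))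
        = - (\<mu> * z' s)" by (simp only: 3 sin_cos_squared_add3 mult_1_right)
    show ?thesis
      using c1 c2 c3 unfolding 1 2
      by (simp add: u_def u'_def u''_def cross3_def vec_eq_iff forall_3 axis_def)
  qed
  show ?thesis
    by (rule that[OF du du' eqn])
qed

text \<open>With a = R \<omega> \<mu> all three terms of the profile equation carry the common
  factor R^2 \<omega>^2. For \<omega> = a / \<Lambda> this relation says \<mu> = \<Lambda> /
  R.\<close>

lemma solves_profile_eq_rescale:
  fixes u u' u'' :: "real \<Rightarrow> real^3"
  assumes u: "\<And>s. (u has_vector_derivative u' s) (at s)" "\<And>s. (u' has_vector_derivative u'' s) (at s)"
    and eqn: "\<And>s. cross3 (u s) (u'' s) - \<mu> *\<^sub>R cross3 (axis 3 1) (u s) + \<mu> *\<^sub>R u' s = 0"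
    and a: "a = R * \<omega> * \<mu>"
  shows "solves_profile_eq a (a * \<omega>) (\<lambda>\<xi>. R *\<^sub>R u (\<omega> * \<xi> - \<phi>))"
  unfolding solves_profile_eq_def
proof (intro exI conjI allI)
  have lin: "((\<lambda>\<xi>. \<omega> * \<xi> - \<phi>) has_vector_derivative \<omega>) (at \<xi>)" for \<xi>
    by (auto intro!: derivative_eq_intros)
  have comp: "((\<lambda>\<xi>. C *\<^sub>R v (\<omega> * \<xi> - \<phi>)) has_vector_derivative (C * \<omega>) *\<^sub>R v' (\<omega> * \<xi> - \<phi>)) (at \<xi>)"
    if "\<And>s. (v has_vector_derivative v' s) (at s)" for C \<xi> and v v' :: "real \<Rightarrow> real^3"
    using bounded_linear.has_vector_derivative[OF bounded_linear_scaleR_right[of C]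
        vector_diff_chain_at[OF lin that]] by (simp add: o_def)
  show "((\<lambda>\<xi>. R *\<^sub>R u (\<omega> * \<xi> - \<phi>)) has_vector_derivative (R * \<omega>) *\<^sub>R u' (\<omega> * \<xi> - \<phi>)) (at \<xi>)" for \<xi>
    by (rule comp[OF u(1)])
  show "((\<lambda>\<xi>. (R * \<omega>) *\<^sub>R u' (\<omega> * \<xi> - \<phi>)) has_vector_derivative (R * \<omega> * \<omega>) *\<^sub>R u'' (\<omega> * \<xi> - \<phi>)) (at \<xi>)" for \<xi>
    by (rule comp[OF u(2)])
  fix \<xi>
  let ?s = "\<omega> * \<xi> - \<phi>"
  have "cross3 (R *\<^sub>R u ?s) ((R * \<omega> * \<omega>) *\<^sub>R u'' ?s) - (a * \<omega>) *\<^sub>R cross3 (axis 3 1) (R *\<^sub>R u ?s)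
      + a *\<^sub>R ((R * \<omega>) *\<^sub>R u' ?s)
    = (R * R * \<omega> * \<omega>) *\<^sub>R (cross3 (u ?s) (u'' ?s) - \<mu> *\<^sub>R cross3 (axis 3 1) (u ?s) + \<mu> *\<^sub>R u' ?s)"
    by (simp add: a cross_mult_left cross_mult_right algebra_simps)
  then show "cross3 (R *\<^sub>R u ?s) ((R * \<omega> * \<omega>) *\<^sub>R u'' ?s) - (a * \<omega>) *\<^sub>R cross3 (axis 3 1) (R *\<^sub>R u ?s)
      + a *\<^sub>R ((R * \<omega>) *\<^sub>R u' ?s) = 0"
    by (simp add: eqn)
qed

section \<open>One-parameter family of closed orbits with its first-order behaviour\<close>

text \<open>Besides the orbit itself, the conclusion records what the later arguments consume: the
  first-order terms of z and \<theta> at e = 0 for the expansion, and, for the immersion, that s = 0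
  is a turning point whose height still moves with e.\<close>

lemma orbit_family:
  fixes \<kappa> :: real
  assumes \<kappa>: "\<kappa> > 1"
  obtains \<delta> :: real and \<mu> c E :: "real \<Rightarrow> real" and z z' \<theta> :: "real \<times> real \<Rightarrow> real" where
    "\<delta> > 0" "smooth_on {-\<delta><..<\<delta>} \<mu>" "\<mu> 0 = sqrt (\<kappa>\<^sup>2 - 1)"
    "\<And>e. e \<in> {-\<delta><..<\<delta>} \<Longrightarrow> \<mu> e > 0"
    "smooth_on ({-\<delta><..<\<delta>} \<times> UNIV) z" "smooth_on ({-\<delta><..<\<delta>} \<times> UNIV) \<theta>"
    "\<And>e s. e \<in> {-\<delta><..<\<delta>} \<Longrightarrow> (z (e, s))\<^sup>2 < 1"
    "\<And>e s. e \<in> {-\<delta><..<\<delta>} \<Longrightarrow> ((\<lambda>s. z (e, s)) has_real_derivative z' (e, s)) (at s)"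
    "\<And>e s. e \<in> {-\<delta><..<\<delta>} \<Longrightarrow> ((\<lambda>s. z' (e, s)) has_real_derivative
       - z (e, s) * (E e - 2 * \<mu> e * z (e, s)) - \<mu> e * (1 - (z (e, s))\<^sup>2) + \<mu> e * (c e - \<mu> e * z (e, s))) (at s)"
    "\<And>e s. e \<in> {-\<delta><..<\<delta>} \<Longrightarrow>
       (z' (e, s))\<^sup>2 = (1 - (z (e, s))\<^sup>2) * (E e - 2 * \<mu> e * z (e, s)) - (c e - \<mu> e * z (e, s))\<^sup>2"
    "\<And>e s. e \<in> {-\<delta><..<\<delta>} \<Longrightarrow>
       ((\<lambda>s. \<theta> (e, s)) has_real_derivative (c e - \<mu> e * z (e, s)) / (1 - (z (e, s))\<^sup>2)) (at s)"
    "\<And>e s. e \<in> {-\<delta><..<\<delta>} \<Longrightarrow> z (e, s + 2 * pi / \<kappa>) = z (e, s)"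
    "\<And>e s. e \<in> {-\<delta><..<\<delta>} \<Longrightarrow> \<theta> (e, s + 2 * pi / \<kappa>) = \<theta> (e, s) + 2 * pi / \<kappa>"
    "\<And>s. z (0, s) = 0" "\<And>s. \<theta> (0, s) = s"
    "\<And>s. frechet_derivative z (at (0, s)) (1, 0) = \<kappa>\<^sup>2 / (2 * sqrt (\<kappa>\<^sup>2 - 1)) * cos (\<kappa> * s)"
    "\<And>s. frechet_derivative \<theta> (at (0, s)) (1, 0) = - (\<kappa> / 2) * sin (\<kappa> * s)"
    "\<And>e. e \<in> {-\<delta><..<\<delta>} \<Longrightarrow> z' (e, 0) = 0"
    "\<And>e. e \<in> {-\<delta><..<\<delta>} \<Longrightarrow> frechet_derivative z (at (e, 0)) (1, 0) \<noteq> 0"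
    "\<And>e. e \<in> {-\<delta><..<\<delta>} \<Longrightarrow> e \<noteq> 0 \<Longrightarrow> \<exists>s. z' (e, s) \<noteq> 0"
proof -
  let ?I = "{-1<..<1::real}"
  obtain S J where S: "smooth_on (?I \<times> UNIV) S" "\<And>e. S (e, 0) = 0"
    "\<And>e \<psi>. e \<in> ?I \<Longrightarrow> ((\<lambda>\<psi>. S (e, \<psi>)) has_real_derivative 1 / sqrt (1 - e * cos \<psi>)) (at \<psi>)"
    "\<And>e \<psi>. e \<in> ?I \<Longrightarrow> S (e, \<psi> + 2 * pi) = S (e, \<psi>) + 2 * pi * J e"
    "\<And>\<psi>. S (0, \<psi>) = \<psi>"
    and J: "smooth_on ?I J" "\<And>e. e \<in> ?I \<Longrightarrow> J e > 0" "J 0 = 1" "(J has_real_derivative 0) (at 0)"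
    using phase_time by blast
  have "\<kappa> > 0" using \<kappa> by simp
  obtain \<psi> where \<psi>: "smooth_on (?I \<times> UNIV) \<psi>" "\<And>e. e \<in> ?I \<Longrightarrow> \<psi> (e, 0) = 0" "\<And>s. \<psi> (0, s) = \<kappa> * s"
    "\<And>e s. e \<in> ?I \<Longrightarrow>
      ((\<lambda>s. \<psi> (e, s)) has_real_derivative \<kappa> * J e * sqrt (1 - e * cos (\<psi> (e, s)))) (at s)"
    "\<And>e s. e \<in> ?I \<Longrightarrow> \<psi> (e, s + 2 * pi / \<kappa>) = \<psi> (e, s) + 2 * pi"
    using phase_function[OF S J(1-3) \<open>\<kappa> > 0\<close>] by blast
  let ?W = "param_dom \<kappa> J"
  obtain \<Theta> where \<Theta>: "smooth_on (?W \<times> UNIV) \<Theta>" "\<And>x. \<Theta> (x, 0) = 0"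
    "\<And>e m \<mu> \<psi>. ((e, m), \<mu>) \<in> ?W \<Longrightarrow>
      ((\<lambda>\<psi>. \<Theta> (((e, m), \<mu>), \<psi>)) has_real_derivative ang_vel \<kappa> J e m \<mu> \<psi> / sqrt (1 - e * cos \<psi>)) (at \<psi>)"
    "\<And>x \<psi>. x \<in> ?W \<Longrightarrow> \<Theta> (x, \<psi> + 2 * pi) = \<Theta> (x, \<psi>) + \<Theta> (x, 2 * pi)"
    "\<And>m \<mu> \<psi>. ((0, m), \<mu>) \<in> ?W \<Longrightarrow>
      \<Theta> (((0, m), \<mu>), \<psi>) = \<psi> * ((1 + 3 * m\<^sup>2 + m * (\<kappa>\<^sup>2 / \<mu>) - \<mu> * m) / (1 - m\<^sup>2))"
    "((\<lambda>e. \<Theta> (((e, 0), sqrt (\<kappa>\<^sup>2 - 1)), 2 * pi)) has_real_derivative 0) (at 0)"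
    using swept_angle[OF J(1,3,4) \<kappa>] by blast
  obtain V m \<mu> where V: "open V" "0 \<in> V" and m: "smooth_on V m" and \<mu>: "smooth_on V \<mu>"
    and m0: "m 0 = 0" and \<mu>0: "\<mu> 0 = sqrt (\<kappa>\<^sup>2 - 1)" and m1: "(m has_real_derivative 0) (at 0)"
    and dom: "\<And>e. e \<in> V \<Longrightarrow> ((e, m e), \<mu> e) \<in> ?W"
    and constr: "\<And>e. e \<in> V \<Longrightarrow> constraint \<kappa> J e (m e) (\<mu> e) = 0"
    and closed: "\<And>e. e \<in> V \<Longrightarrow> \<Theta> (((e, m e), \<mu> e), 2 * pi) = 2 * pi * J e"
    using parameter_curve[OF J(1,3,4) \<kappa> \<Theta>(1,5,6)] by blast
  have VI: "e \<in> ?I" and \<mu>_pos: "\<mu> e > 0" if "e \<in> V" for e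
    using dom[OF that] by (auto simp: param_dom_def)
  have opn: "open (V \<times> (UNIV :: real set))" using V by (intro open_Times) auto
  define b where "b e = amplitude \<kappa> J e (\<mu> e)" for e
  define c where "c e = ang_mom \<kappa> J e (m e) (\<mu> e)" for e
  define K where "K e = (\<kappa> * J e)\<^sup>2" for e
  define z where "z x = m (fst x) + b (fst x) * cos (\<psi> x)" for x
  define q where "q x = sqrt (1 - fst x * cos (\<psi> x))" for x
  define z' where "z' x = - (b (fst x) * sin (\<psi> x) * (\<kappa> * J (fst x) * q x))" for x
  define \<theta> where "\<theta> x = \<Theta> (((fst x, m (fst x)), \<mu> (fst x)), \<psi> x) / (\<kappa> * J (fst x))" for x
  have smV: "smooth_on (V \<times> (UNIV :: real set)) (\<lambda>x. f (fst x))" if "smooth_on V f" for f :: "real \<Rightarrow> real"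
    by (rule smooth_on_compose[OF that]) (auto intro!: smooth_intros opn)
  have sm\<psi>: "smooth_on (V \<times> UNIV) \<psi>" by (rule smooth_on_subset[OF \<psi>(1) _ opn]) (use VI in auto)
  have smJ: "smooth_on V J" by (rule smooth_on_subset[OF J(1) _ V(1)]) (use VI in auto)
  have smb: "smooth_on V b"
    unfolding b_def
    by (rule smooth_on_compose[OF smooth_on_profile_coefficients(3)[OF J(1), of \<kappa>],
          where g = "\<lambda>e. ((e, m e), \<mu> e)", simplified])
      (use dom in \<open>auto intro!: smooth_intros m \<mu> V\<close>)
  have smz: "smooth_on (V \<times> UNIV) z"
    unfolding z_def by (intro smooth_intros smV m smb sm\<psi>)
  have smX: "smooth_on (V \<times> (UNIV :: real set)) (\<lambda>x. ((fst x, m (fst x)), \<mu> (fst x)))"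
    by (intro smooth_intros smV m \<mu> opn)
  have sm\<theta>: "smooth_on (V \<times> UNIV) \<theta>"
    unfolding \<theta>_def
  proof (intro smooth_intros smV smJ opn)
    show "smooth_on (V \<times> UNIV) (\<lambda>x. \<Theta> (((fst x, m (fst x)), \<mu> (fst x)), \<psi> x))"
      by (rule smooth_on_compose[OF \<Theta>(1), where g = "\<lambda>x. (((fst x, m (fst x)), \<mu> (fst x)), \<psi> x)"])
        (use dom in \<open>auto intro!: smooth_intros smX sm\<psi> simp: mem_Times_iff\<close>)
    show "\<kappa> * J (fst x) \<noteq> 0" if "x \<in> V \<times> (UNIV :: real set)" for x
      using that J(2)[OF VI, of "fst x"] \<kappa> by auto
  qed
  have z_height: "z (e, s) = height \<kappa> J e (m e) (\<mu> e) (\<psi> (e, s))" for e s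
    by (simp add: z_def height_def b_def)
  have z_lt: "(z (e, s))\<^sup>2 < 1" if "e \<in> V" for e s
    unfolding z_height by (rule height_square_less_1[OF dom[OF that]])
  have q: "q (e, s) > 0" "q (e, s) * q (e, s) = 1 - e * cos (\<psi> (e, s))" if "e \<in> V" for e s
    using one_minus_mult_cos_pos[OF VI[OF that], of "\<psi> (e, s)"] by (simp_all add: q_def)
  have d\<psi>: "((\<lambda>s. \<psi> (e, s)) has_real_derivative \<kappa> * J e * q (e, s)) (at s)" if "e \<in> V" for e s
    using \<psi>(4)[OF VI[OF that]] by (simp add: q_def)
  have dz: "((\<lambda>s. z (e, s)) has_real_derivative z' (e, s)) (at s)" if "e \<in> V" for e s
    unfolding z_def z'_def by (auto intro!: derivative_eq_intros d\<psi>[OF that])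
  define E where "E e = 6 * \<mu> e * m e + K e - (\<mu> e)\<^sup>2" for e
  have b_eq: "2 * \<mu> e * b e = e * K e" if "e \<in> V" for e
    using \<mu>_pos[OF that] by (simp add: b_def amplitude_def K_def)
  have c_eq: "\<mu> e * c e = \<mu> e + 3 * \<mu> e * (m e)\<^sup>2 + m e * K e - \<mu> e * (b e)\<^sup>2" if "e \<in> V" for e
    using \<mu>_pos[OF that] by (simp add: c_def ang_mom_def K_def b_def algebra_simps)
  have z_eq: "z (e, s) = m e + b e * cos (\<psi> (e, s))" for e s by (simp add: z_def)
  have energy: "(z' (e, s))\<^sup>2 = (1 - (z (e, s))\<^sup>2) * (E e - 2 * \<mu> e * z (e, s)) - (c e - \<mu> e * z (e, s))\<^sup>2"
    if "e \<in> V" for e s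
  proof -
    have "(z' (e, s))\<^sup>2 = (b e)\<^sup>2 * (1 - (cos (\<psi> (e, s)))\<^sup>2) * (K e * (q (e, s) * q (e, s)))"
      by (simp add: z'_def K_def power_mult_distrib sin_squared_eq power2_eq_square[of "q _"])
    also have "\<dots> = (b e)\<^sup>2 * (1 - (cos (\<psi> (e, s)))\<^sup>2) * (K e * (1 - e * cos (\<psi> (e, s))))"
      unfolding q(2)[OF that] ..
    also have "\<dots> = (1 - (z (e, s))\<^sup>2) * (E e - 2 * \<mu> e * z (e, s)) - (c e - \<mu> e * z (e, s))\<^sup>2"
      unfolding E_def
      by (rule cubic_identities(1)[OF z_eq b_eq[OF that] c_eq[OF that]])
        (use constr[OF that] in \<open>simp add: constraint_def c_def b_def K_def\<close>)
    finally show ?thesis .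
  qed
  have dz': "((\<lambda>s. z' (e, s)) has_real_derivative
     - z (e, s) * (E e - 2 * \<mu> e * z (e, s)) - \<mu> e * (1 - (z (e, s))\<^sup>2) + \<mu> e * (c e - \<mu> e * z (e, s))) (at s)"
    if e: "e \<in> V" for e s
  proof -
    have dq: "((\<lambda>s. q (e, s)) has_real_derivative e * sin (\<psi> (e, s)) * (\<kappa> * J e) / 2) (at s)"
      unfolding q_def fst_conv using q(1)[OF e, of s] one_minus_mult_cos_pos[OF VI[OF e], of "\<psi> (e, s)"]
      by (auto intro!: derivative_eq_intros d\<psi>[OF e] simp: q_def field_simps)
    have "((\<lambda>s. z' (e, s)) has_real_derivative
        - (b e * (cos (\<psi> (e, s)) * (\<kappa> * J e * q (e, s)) * (\<kappa> * J e * q (e, s)) +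
          sin (\<psi> (e, s)) * (\<kappa> * J e * (e * sin (\<psi> (e, s)) * (\<kappa> * J e) / 2))))) (at s)"
      unfolding z'_def fst_conv
      by (auto intro!: derivative_eq_intros d\<psi>[OF e] dq simp: algebra_simps)
    also have "b e * (cos (\<psi> (e, s)) * (\<kappa> * J e * q (e, s)) * (\<kappa> * J e * q (e, s)) +
          sin (\<psi> (e, s)) * (\<kappa> * J e * (e * sin (\<psi> (e, s)) * (\<kappa> * J e) / 2))) =
        b e * K e * (cos (\<psi> (e, s)) * (q (e, s) * q (e, s)) + (sin (\<psi> (e, s)))\<^sup>2 * e / 2)"
      by (simp add: K_def power2_eq_square algebra_simps)
    also have "\<dots> = b e * K e * (cos (\<psi> (e, s)) * (1 - e * cos (\<psi> (e, s))) + (1 - (cos (\<psi> (e, s)))\<^sup>2) * e / 2)"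
      unfolding q(2)[OF e] sin_squared_eq ..
    finally show ?thesis
      unfolding E_def cubic_identities(2)[OF z_eq b_eq[OF e] c_eq[OF e]] .
  qed
  define w where "w x = (c (fst x) - \<mu> (fst x) * z x) / (1 - (z x)\<^sup>2)" for x
  have smc: "smooth_on V c"
    unfolding c_def ang_mom_def b_def[symmetric]
    by (intro smooth_intros V m \<mu> smJ smb) (use \<mu>_pos in force)
  have z_neq: "1 - (z x)\<^sup>2 \<noteq> 0" if "x \<in> V \<times> UNIV" for x
    using z_lt[of "fst x" "snd x"] that by (simp add: mem_Times_iff)
  have smw: "smooth_on (V \<times> UNIV) w"
    unfolding w_def by (intro smooth_intros smV smc \<mu> smz opn z_neq)
  have d\<theta>: "((\<lambda>s. \<theta> (e, s)) has_real_derivative w (e, s)) (at s)" if e: "e \<in> V" for e s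
  proof -
    have "((\<lambda>s. \<Theta> (((e, m e), \<mu> e), \<psi> (e, s))) has_real_derivative
        ang_vel \<kappa> J e (m e) (\<mu> e) (\<psi> (e, s)) / q (e, s) * (\<kappa> * J e * q (e, s))) (at s)"
      using DERIV_chain2[OF \<Theta>(3)[OF dom[OF e]] d\<psi>[OF e]] by (simp add: q_def)
    then have "((\<lambda>s. \<theta> (e, s)) has_real_derivative
        ang_vel \<kappa> J e (m e) (\<mu> e) (\<psi> (e, s)) / q (e, s) * (\<kappa> * J e * q (e, s)) / (\<kappa> * J e)) (at s)"
      unfolding \<theta>_def fst_conv by (rule DERIV_cdivide)
    moreover have "ang_vel \<kappa> J e (m e) (\<mu> e) (\<psi> (e, s)) / q (e, s) * (\<kappa> * J e * q (e, s)) / (\<kappa> * J e) = w (e, s)"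
      using q(1)[OF e, of s] J(2)[OF VI[OF e]] \<kappa> by (simp add: ang_vel_def w_def c_def z_height)
    ultimately show ?thesis by simp
  qed
  have z0: "z (0, s) = 0" for s by (simp add: z_def m0 b_def amplitude_def)
  have \<theta>0: "\<theta> (0, s) = s" for s
    using \<Theta>(5)[of 0 "\<mu> 0" "\<kappa> * s"] dom[OF V(2)] \<kappa> by (simp add: \<theta>_def m0 J \<psi>(3))
  have \<mu>00: "\<mu> 0 > 0" by (rule \<mu>_pos[OF V(2)])
  have b0: "b 0 = 0" by (simp add: b_def amplitude_def)
  obtain \<mu>1 where d\<mu>: "(\<mu> has_real_derivative \<mu>1) (at 0)"
    using smooth_on_differentiable[OF \<mu> V(2)] real_differentiable_def by blast
  have db: "(b has_real_derivative \<kappa>\<^sup>2 / (2 * \<mu> 0)) (at 0)"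
    unfolding b_def amplitude_def using \<mu>00 J(3)
    by (auto intro!: derivative_eq_intros d\<mu> J(4))
  \<comment> \<open>All terms of c besides the constant 1 are of second order in e, since m and its
    derivative vanish at 0 and b is of order e.\<close>
  have dc: "(c has_real_derivative 0) (at 0)"
    unfolding c_def ang_mom_def b_def[symmetric] using \<mu>00 J(3)
    by (auto intro!: derivative_eq_intros d\<mu> J(4) m1 db simp: m0 b0)
  have dze: "((\<lambda>r. z (r, s)) has_real_derivative \<kappa>\<^sup>2 / (2 * \<mu> 0) * cos (\<kappa> * s)) (at 0)" for s
  proof -
    have "(\<psi> has_derivative frechet_derivative \<psi> (at (0, s))) (at ((0, s) + 0 *\<^sub>R (1, 0)))"
      using smooth_on_has_derivative[OF sm\<psi>, of "(0, s)"] V by simp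
    from has_derivative_along_line[OF this]
    obtain D where D: "((\<lambda>r. \<psi> (r, s)) has_real_derivative D) (at 0)"
      by (auto simp: has_real_derivative_iff_has_vector_derivative)
    show ?thesis
      unfolding z_def fst_conv by (auto intro!: derivative_eq_intros m1 db D simp: b0 \<psi>(3))
  qed
  have Dz: "frechet_derivative z (at (0, s)) (1, 0) = \<kappa>\<^sup>2 / (2 * \<mu> 0) * cos (\<kappa> * s)" for s
  proof (rule frechet_derivative_along_line)
    show "z differentiable at (0, s)" by (rule smooth_on_differentiable[OF smz]) (use V in simp)
    show "((\<lambda>r. z ((0, s) + r *\<^sub>R (1, 0))) has_vector_derivative \<kappa>\<^sup>2 / (2 * \<mu> 0) * cos (\<kappa> * s)) (at 0)"
      using dze[of s] by (simp add: has_real_derivative_iff_has_vector_derivative)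
  qed
  have Dw: "frechet_derivative w (at (0, s)) (1, 0) = - (\<kappa>\<^sup>2 / 2) * cos (\<kappa> * s)" for s
  proof (rule frechet_derivative_along_line)
    show "w differentiable at (0, s)" by (rule smooth_on_differentiable[OF smw]) (use V in simp)
    have "((\<lambda>r. (c r - \<mu> r * z (r, s)) / (1 - (z (r, s))\<^sup>2)) has_real_derivative - (\<kappa>\<^sup>2 / 2) * cos (\<kappa> * s)) (at 0)"
      using \<mu>00 by (auto intro!: derivative_eq_intros dc d\<mu> dze simp: z0)
    then show "((\<lambda>r. w ((0, s) + r *\<^sub>R (1, 0))) has_vector_derivative - (\<kappa>\<^sup>2 / 2) * cos (\<kappa> * s)) (at 0)"
      by (simp add: w_def has_real_derivative_iff_has_vector_derivative)
  qed
  have \<theta>_at_0: "\<theta> (e, 0) = 0" if "e \<in> V" for e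
    using \<psi>(2)[OF VI[OF that]] by (simp add: \<theta>_def \<Theta>(2))
  note par = antiderivative_parameter_derivative[OF sm\<theta> \<theta>_at_0 d\<theta> smw V, where h = 1]
  \<comment> \<open>The linearised angular velocity is integrated from s = 0, where \<theta> is 0
    for every e.\<close>
  have D\<theta>: "frechet_derivative \<theta> (at (0, s)) (1, 0) = - (\<kappa> / 2) * sin (\<kappa> * s)" for s
  proof (rule equal_derivatives_imp_eq[where f = "\<lambda>s. frechet_derivative \<theta> (at (0, s)) (1, 0)"
        and g = "\<lambda>s. - (\<kappa> / 2) * sin (\<kappa> * s)" and f' = "\<lambda>s. - (\<kappa>\<^sup>2 / 2) * cos (\<kappa> * s)" and a = 0])
    show "((\<lambda>s. frechet_derivative \<theta> (at (0, s)) (1, 0)) has_real_derivative - (\<kappa>\<^sup>2 / 2) * cos (\<kappa> * s)) (at s)" for s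
      using par(1)[of s] unfolding Dw .
    show "((\<lambda>s. - (\<kappa> / 2) * sin (\<kappa> * s)) has_real_derivative - (\<kappa>\<^sup>2 / 2) * cos (\<kappa> * s)) (at s)" for s
      by (auto intro!: derivative_eq_intros simp: power2_eq_square)
    show "frechet_derivative \<theta> (at (0, 0)) (1, 0) = - (\<kappa> / 2) * sin (\<kappa> * 0)"
      using par(2) by simp
  qed
  \<comment> \<open>Where \<psi> = pi / 2 the factor sin \<psi> of z' is 1; this phase is reached
    because \<psi> runs from 0 to 2 pi within one period.\<close>
  have nonzero: "\<exists>s. z' (e, s) \<noteq> 0" if e: "e \<in> V" "e \<noteq> 0" for e
  proof -
    have "\<exists>s\<ge>0. s \<le> 2 * pi / \<kappa> \<and> \<psi> (e, s) = pi / 2"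
    proof (rule IVT')
      have "\<psi> (e, 0 + 2 * pi / \<kappa>) = 2 * pi" using \<psi>(5)[OF VI[OF e(1)], of 0] \<psi>(2)[OF VI[OF e(1)]] by simp
      then show "pi / 2 \<le> \<psi> (e, 2 * pi / \<kappa>)" by simp
      show "continuous_on {0..2 * pi / \<kappa>} (\<lambda>s. \<psi> (e, s))"
        by (rule DERIV_continuous_on[OF DERIV_subset[OF d\<psi>[OF e(1)] subset_UNIV]])
    qed (use \<psi>(2)[OF VI[OF e(1)]] \<kappa> in auto)
    then obtain s where s: "\<psi> (e, s) = pi / 2" by blast
    have "b e \<noteq> 0" using b_eq[OF e(1)] e(2) J(2)[OF VI[OF e(1)]] \<kappa> by (auto simp: K_def)
    then have "z' (e, s) \<noteq> 0"
      using J(2)[OF VI[OF e(1)]] \<kappa> q(1)[OF e(1), of s] by (simp add: z'_def s)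
    then show ?thesis by blast
  qed
  have per\<theta>: "\<theta> (e, s + 2 * pi / \<kappa>) = \<theta> (e, s) + 2 * pi / \<kappa>" if e: "e \<in> V" for e s
    using J(2)[OF VI[OF e]] \<kappa>
    by (simp add: \<theta>_def \<psi>(5)[OF VI[OF e]] \<Theta>(4)[OF dom[OF e]] closed[OF e] add_divide_distrib)
  have perz: "z (e, s + 2 * pi / \<kappa>) = z (e, s)" if e: "e \<in> V" for e s
    by (simp add: z_def \<psi>(5)[OF VI[OF e]])
  have z'0: "z' (e, 0) = 0" if "e \<in> V" for e
    by (simp add: z'_def \<psi>(2)[OF VI[OF that]])
  \<comment> \<open>Shrinking the parameter interval keeps the e-derivative of the height at s = 0
    nonzero; at e = 0 this is read off from \<open>Dz\<close>.\<close>
  have "open (V \<inter> (\<lambda>e. frechet_derivative z (at (e, 0)) (1, 0)) -` (- {0}))"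
  proof (intro continuous_open_preimage V)
    have "smooth_on V (\<lambda>e. frechet_derivative z (at (e, 0)) (1, 0))"
      by (rule smooth_on_compose[OF smooth_on_frechet_derivative[OF smz, of "(1, 0)"], where g = "\<lambda>e. (e, 0)"])
        (auto intro!: smooth_intros V)
    then show "continuous_on V (\<lambda>e. frechet_derivative z (at (e, 0)) (1, 0))"
      by (rule smooth_on_continuous_on)
  qed auto
  moreover have "0 \<in> V \<inter> (\<lambda>e. frechet_derivative z (at (e, 0)) (1, 0)) -` (- {0})"
    using V \<mu>00 \<kappa> by (simp add: Dz)
  ultimately obtain \<delta> where \<delta>: "\<delta> > 0" "ball 0 \<delta> \<subseteq> V \<inter> (\<lambda>e. frechet_derivative z (at (e, 0)) (1, 0)) -` (- {0})"
    using openE by blast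
  have U: "e \<in> V" "frechet_derivative z (at (e, 0)) (1, 0) \<noteq> 0" if "e \<in> {-\<delta><..<\<delta>}" for e
    using \<delta>(2) that by (auto simp: subset_iff dist_real_def abs_less_iff)
  have sub: "{-\<delta><..<\<delta>} \<subseteq> V" "{-\<delta><..<\<delta>} \<times> (UNIV :: real set) \<subseteq> V \<times> UNIV" using U by auto
  have opn\<delta>: "open ({-\<delta><..<\<delta>} \<times> (UNIV :: real set))" by (intro open_Times) auto
  show ?thesis
    by (rule that[of \<delta> \<mu> z \<theta> z' E c, OF \<delta>(1) smooth_on_subset[OF \<mu> sub(1) open_greaterThanLessThan] \<mu>0 \<mu>_pos[OF U(1)]
      smooth_on_subset[OF smz sub(2) opn\<delta>] smooth_on_subset[OF sm\<theta> sub(2) opn\<delta>] z_lt[OF U(1)] dz[OF U(1)]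
      dz'[OF U(1)] energy[OF U(1)] d\<theta>[OF U(1), unfolded w_def fst_conv] perz[OF U(1)] per\<theta>[OF U(1)] z0 \<theta>0
      Dz[unfolded \<mu>0] D\<theta> z'0[OF U(1)] U(2) nonzero[OF U(1)]])
qed

section \<open>The two-parameter family: periodicity, nondegeneracy and expansion\<close>

text \<open>The set where f is nonzero is open and Lebesgue null, hence empty. This turns an
  identity between elements of H^2_loc into a pointwise one that can be evaluated at chosen
  points.\<close>

lemma continuous_AE_zero_imp_zero:
  fixes f :: "real \<Rightarrow> 'b::real_normed_vector"
  assumes "continuous_on UNIV f" "AE \<xi> in lebesgue. f \<xi> = 0"
  shows "f \<xi> = 0"
proof -
  have "open (- (f -` {0}))"
    using closed_vimage[OF closed_singleton assms(1)] by auto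
  moreover have "negligible (- (f -` {0}))"
  proof -
    obtain N where N: "N \<in> null_sets lebesgue" "{\<xi> \<in> space lebesgue. f \<xi> \<noteq> 0} \<subseteq> N"
      using assms(2) unfolding eventually_ae_filter by blast
    from N(1) have "negligible N" by (simp add: negligible_iff_null_sets)
    then show ?thesis by (rule negligible_subset) (use N(2) in auto)
  qed
  ultimately show ?thesis using open_not_negligible by blast
qed

theorem theorem1p1:
  fixes R a :: real and k :: nat
  assumes R_pos: "R > 0" and a_pos: "a > 0" and k_ge: "k \<ge> 2"
  shows "let l\<^sub>k = crit_lambda R k; \<Omega>\<^sub>k = a\<^sup>2 / l\<^sub>k; \<omega>\<^sub>k = \<Omega>\<^sub>k / a in
    \<exists>(\<delta>::real) (\<Lambda> :: real \<Rightarrow> real) (x :: real \<Rightarrow> real \<Rightarrow> real \<Rightarrow> real^3).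
      \<delta> > 0 \<and>
      smooth_real_on {-\<delta><..<\<delta>} \<Lambda> \<and> (\<forall>t\<in>{-\<delta><..<\<delta>}. \<Lambda> t > 0) \<and> \<Lambda> 0 = l\<^sub>k \<and>
      \<comment> \<open>smooth family on \<open>(-\<delta>,\<delta>) \<times> \<real>/2\<pi>\<int>\<close>, as a \<open>2\<pi>\<close>-periodic one on \<open>(-\<delta>,\<delta>) \<times> \<real>\<close>\<close>
      H2_loc_smooth_on {p. fst p \<in> {-\<delta><..<\<delta>}} (\<lambda>(t, \<phi>). x t \<phi>) \<and>
      (\<forall>t\<in>{-\<delta><..<\<delta>}. \<forall>\<phi>. x t (\<phi> + 2 * pi) = x t \<phi>) \<and>
      (let \<Omega> = (\<lambda>t. a\<^sup>2 / \<Lambda> t); \<omega> = (\<lambda>t. \<Omega> t / a); T = (\<lambda>t. 2 * pi / \<omega> t) in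
        \<comment> \<open>(i)\<close>
        (\<forall>t\<in>{-\<delta><..<\<delta>}. \<forall>\<phi>.
           solves_profile_eq a (\<Omega> t) (x t \<phi>) \<and>
           (\<forall>\<xi>. x t \<phi> (\<xi> + T t) = x t \<phi> \<xi>) \<and>
           (\<forall>\<xi>. norm (x t \<phi> \<xi>) = R)) \<and>
        \<comment> \<open>(ii)\<close>
        (\<forall>\<phi>. x 0 \<phi> = equatorial R \<omega>\<^sub>k 0) \<and>
        \<comment> \<open>(iii)\<close>
        (\<Lambda> \<longlongrightarrow> l\<^sub>k) (at 0) \<and>
        (\<forall>c d. c < d \<longrightarrow> (\<forall>\<epsilon>>0. \<forall>\<^sub>F t in at 0. \<forall>\<phi>.
           H2_norm {c<..<d}
             (\<lambda>\<xi>. x t \<phi> \<xi> - equatorial R (\<omega> t) 0 \<xi> - t *\<^sub>R first_order_mode k (\<omega> t) \<phi> \<xi>)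
           \<le> \<epsilon> * \<bar>t\<bar>)) \<and>
        \<comment> \<open>(iv)\<close>
        smooth_real_on {-\<delta><..<\<delta>} \<Omega> \<and>
        (\<forall>\<phi>. (\<Omega> 0, x 0 \<phi>) = (\<Omega>\<^sub>k, equatorial R \<omega>\<^sub>k 0)) \<and>
        (\<forall>t\<in>{-\<delta><..<\<delta>}. t \<noteq> 0 \<longrightarrow> (\<forall>\<phi>.
           (\<forall>\<phi>\<^sub>0. x t \<phi> \<noteq> equatorial R (\<omega> t) \<phi>\<^sub>0) \<and>
           immersive_at \<Omega> (\<lambda>(t, \<phi>). x t \<phi>) (t, \<phi>))))"
proof -
  define \<kappa> where "\<kappa> = real k"
  have \<kappa>: "\<kappa> > 1" using k_ge by (simp add: \<kappa>_def)
  define \<mu>0 where "\<mu>0 = sqrt (\<kappa>\<^sup>2 - 1)"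
  have \<mu>0: "\<mu>0 > 0" using \<kappa> by (simp add: \<mu>0_def one_less_power)
  show ?thesis
  proof (rule orbit_family[OF \<kappa>])
    fix \<delta>e :: real and \<mu> c E :: "real \<Rightarrow> real" and z z' \<theta> :: "real \<times> real \<Rightarrow> real"
    assume "\<delta>e > 0" and sm\<mu>: "smooth_on {-\<delta>e<..<\<delta>e} \<mu>" and \<mu>_0: "\<mu> 0 = sqrt (\<kappa>\<^sup>2 - 1)"
      and \<mu>_pos: "\<And>e. e \<in> {-\<delta>e<..<\<delta>e} \<Longrightarrow> \<mu> e > 0"
      and smz: "smooth_on ({-\<delta>e<..<\<delta>e} \<times> UNIV) z" and sm\<theta>: "smooth_on ({-\<delta>e<..<\<delta>e} \<times> UNIV) \<theta>"
      and z_lt: "\<And>e s. e \<in> {-\<delta>e<..<\<delta>e} \<Longrightarrow> (z (e, s))\<^sup>2 < 1"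
      and dz: "\<And>e s. e \<in> {-\<delta>e<..<\<delta>e} \<Longrightarrow> ((\<lambda>s. z (e, s)) has_real_derivative z' (e, s)) (at s)"
      and dz': "\<And>e s. e \<in> {-\<delta>e<..<\<delta>e} \<Longrightarrow> ((\<lambda>s. z' (e, s)) has_real_derivative
         - z (e, s) * (E e - 2 * \<mu> e * z (e, s)) - \<mu> e * (1 - (z (e, s))\<^sup>2) + \<mu> e * (c e - \<mu> e * z (e, s))) (at s)"
      and energy: "\<And>e s. e \<in> {-\<delta>e<..<\<delta>e} \<Longrightarrow>
         (z' (e, s))\<^sup>2 = (1 - (z (e, s))\<^sup>2) * (E e - 2 * \<mu> e * z (e, s)) - (c e - \<mu> e * z (e, s))\<^sup>2"
      and d\<theta>: "\<And>e s. e \<in> {-\<delta>e<..<\<delta>e} \<Longrightarrow>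
         ((\<lambda>s. \<theta> (e, s)) has_real_derivative (c e - \<mu> e * z (e, s)) / (1 - (z (e, s))\<^sup>2)) (at s)"
      and z_per: "\<And>e s. e \<in> {-\<delta>e<..<\<delta>e} \<Longrightarrow> z (e, s + 2 * pi / \<kappa>) = z (e, s)"
      and \<theta>_per: "\<And>e s. e \<in> {-\<delta>e<..<\<delta>e} \<Longrightarrow> \<theta> (e, s + 2 * pi / \<kappa>) = \<theta> (e, s) + 2 * pi / \<kappa>"
      and z0: "\<And>s. z (0, s) = 0" and \<theta>0: "\<And>s. \<theta> (0, s) = s"
      and Dz: "\<And>s. frechet_derivative z (at (0, s)) (1, 0) = \<kappa>\<^sup>2 / (2 * sqrt (\<kappa>\<^sup>2 - 1)) * cos (\<kappa> * s)"
      and D\<theta>: "\<And>s. frechet_derivative \<theta> (at (0, s)) (1, 0) = - (\<kappa> / 2) * sin (\<kappa> * s)"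
      and z'0: "\<And>e. e \<in> {-\<delta>e<..<\<delta>e} \<Longrightarrow> z' (e, 0) = 0"
      and Dz_neq: "\<And>e. e \<in> {-\<delta>e<..<\<delta>e} \<Longrightarrow> frechet_derivative z (at (e, 0)) (1, 0) \<noteq> 0"
      and z'_neq: "\<And>e. e \<in> {-\<delta>e<..<\<delta>e} \<Longrightarrow> e \<noteq> 0 \<Longrightarrow> \<exists>s. z' (e, s) \<noteq> 0"
    let ?Ie = "{-\<delta>e<..<\<delta>e}"
    \<comment> \<open>Because \<kappa> = k is an integer, 2 pi is a whole number of oscillations;
      integer multiples of both signs serve the period in \<xi> and the one in \<phi>.\<close>
    have z_per': "z (e, s + of_int n * (2 * pi)) = z (e, s)" if "e \<in> ?Ie" for e s n
    proof -
      have "z (e, s + of_int (n * int k) * (2 * pi / \<kappa>)) = z (e, s)"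
        by (rule periodic_int_multiple[where f = "\<lambda>s. z (e, s)"]) (rule z_per[OF that])
      then show ?thesis using \<kappa> by (simp add: \<kappa>_def)
    qed
    have \<theta>_per': "\<theta> (e, s + of_int n * (2 * pi)) = \<theta> (e, s) + of_int n * (2 * pi)" if "e \<in> ?Ie" for e s n
    proof -
      have "\<theta> (e, s + of_int (n * int k) * (2 * pi / \<kappa>)) - (s + of_int (n * int k) * (2 * pi / \<kappa>)) = \<theta> (e, s) - s"
        by (rule periodic_int_multiple[where f = "\<lambda>s. \<theta> (e, s) - s"]) (simp add: \<theta>_per[OF that])
      then show ?thesis using \<kappa> by (simp add: \<kappa>_def)
    qed
    \<comment> \<open>This scaling makes \<open>t\<close> the amplitude of the tangential first-order oscillation.\<close>
    define \<eta> where "\<eta> = - 2 / (\<kappa> * R)"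
    have \<eta>: "\<eta> < 0" using \<kappa> R_pos by (simp add: \<eta>_def)
    define \<delta> where "\<delta> = \<delta>e / \<bar>\<eta>\<bar>"
    have "\<delta> > 0" unfolding \<delta>_def using \<open>\<delta>e > 0\<close> \<eta> by (intro divide_pos_pos) auto
    let ?I = "{-\<delta><..<\<delta>}"
    have \<eta>I: "\<eta> * t \<in> ?Ie" if "t \<in> ?I" for t
    proof -
      have "\<bar>t\<bar> < \<delta>e / \<bar>\<eta>\<bar>" using that by (auto simp: \<delta>_def)
      then have "\<bar>t\<bar> * \<bar>\<eta>\<bar> < \<delta>e" using \<eta> by (subst (asm) pos_less_divide_eq) auto
      then have "\<bar>\<eta> * t\<bar> < \<delta>e" by (simp add: abs_mult mult.commute)
      then show ?thesis by (auto simp: abs_less_iff)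
    qed
    define \<Lambda> where "\<Lambda> t = R * \<mu> (\<eta> * t)" for t
    define \<Omega> where "\<Omega> t = a\<^sup>2 / \<Lambda> t" for t
    define \<omega> where "\<omega> t = \<Omega> t / a" for t
    define T where "T t = 2 * pi / \<omega> t" for t
    have \<Lambda>_pos: "\<Lambda> t > 0" if "t \<in> ?I" for t
      using \<mu>_pos[OF \<eta>I[OF that]] R_pos by (simp add: \<Lambda>_def)
    have \<omega>_eq: "\<omega> t = a / \<Lambda> t" for t using a_pos by (simp add: \<omega>_def \<Omega>_def power2_eq_square)
    have \<omega>_pos: "\<omega> t > 0" if "t \<in> ?I" for t using \<Lambda>_pos[OF that] a_pos by (simp add: \<omega>_eq)
    have lk: "\<Lambda> 0 = crit_lambda R k" by (simp add: \<Lambda>_def \<mu>_0 crit_lambda_def \<kappa>_def)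
    have sm\<Lambda>: "smooth_on ?I \<Lambda>"
      unfolding \<Lambda>_def by (intro smooth_intros smooth_on_compose[OF sm\<mu>, where g = "\<lambda>t. \<eta> * t"] \<eta>I) auto
    have sm\<Omega>: "smooth_on ?I \<Omega>"
      unfolding \<Omega>_def by (intro smooth_intros sm\<Lambda>) (use \<Lambda>_pos in force)+
    have sm\<omega>: "smooth_on ?I \<omega>"
      unfolding \<omega>_def by (intro smooth_intros sm\<Omega>) (use a_pos in auto)
    define Z where "Z t \<phi> \<xi> = z (\<eta> * t, \<omega> t * \<xi> - \<phi>)" for t \<phi> \<xi>
    \<comment> \<open>The time shift by \<phi> alone would rotate the equatorial curve at t = 0.
      Adding \<phi> to the longitude undoes this, so that x 0 \<phi> does not depend on
      \<phi>.\<close>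
    define H where "H t \<phi> \<xi> = \<theta> (\<eta> * t, \<omega> t * \<xi> - \<phi>) + \<phi>" for t \<phi> \<xi>
    define x where "x t \<phi> \<xi> = (vector [R * (sqrt (1 - (Z t \<phi> \<xi>)\<^sup>2) * cos (H t \<phi> \<xi>)),
        R * (sqrt (1 - (Z t \<phi> \<xi>)\<^sup>2) * sin (H t \<phi> \<xi>)), R * Z t \<phi> \<xi>] :: real^3)" for t \<phi> \<xi>
    have Z_lt: "(Z t \<phi> \<xi>)\<^sup>2 < 1" if "t \<in> ?I" for t \<phi> \<xi>
      unfolding Z_def by (rule z_lt[OF \<eta>I[OF that]])
    have smZH: "smooth_on W (\<lambda>p. Z (f p) (g p) (h p))" "smooth_on W (\<lambda>p. H (f p) (g p) (h p))"
        "smooth_on W (\<lambda>p. x (f p) (g p) (h p))" "smooth_on W (\<lambda>p. \<omega> (f p))"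
      if "smooth_on W f" "smooth_on W g" "smooth_on W h" "\<And>p. p \<in> W \<Longrightarrow> f p \<in> ?I"
      for W and f g h :: "'p::euclidean_space \<Rightarrow> real"
    proof -
      note W = smooth_on_open[OF that(1)]
      show sm\<omega>f: "smooth_on W (\<lambda>p. \<omega> (f p))"
        by (rule smooth_on_compose[OF sm\<omega> that(1)]) (rule that(4))
      have sm: "smooth_on W (\<lambda>p. (\<eta> * f p, \<omega> (f p) * h p - g p))"
        by (intro smooth_intros sm\<omega>f that W)
      have im: "(\<eta> * f p, \<omega> (f p) * h p - g p) \<in> ?Ie \<times> UNIV" if "p \<in> W" for p
        using \<eta>I[OF \<open>\<And>p. p \<in> W \<Longrightarrow> f p \<in> ?I\<close>[OF that]] by simp
      show smZ: "smooth_on W (\<lambda>p. Z (f p) (g p) (h p))"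
        unfolding Z_def by (rule smooth_on_compose[OF smz sm im])
      show smH: "smooth_on W (\<lambda>p. H (f p) (g p) (h p))"
        unfolding H_def by (intro smooth_on_add that(2) smooth_on_compose[OF sm\<theta> sm im])
      have pos: "0 < 1 - (Z (f p) (g p) (h p))\<^sup>2" if "p \<in> W" for p
        using Z_lt[OF \<open>\<And>p. p \<in> W \<Longrightarrow> f p \<in> ?I\<close>[OF that]] by simp
      show "smooth_on W (\<lambda>p. x (f p) (g p) (h p))"
        unfolding x_def by (intro smooth_intros smZ smH W pos)
    qed
    have solves: "solves_profile_eq a (\<Omega> t) (x t \<phi>)" if t: "t \<in> ?I" for t \<phi>
    proof -
      note e = \<eta>I[OF t]
      let ?u = "\<lambda>s. vector [sqrt (1 - (z (\<eta> * t, s))\<^sup>2) * cos (\<theta> (\<eta> * t, s) + \<phi>),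
        sqrt (1 - (z (\<eta> * t, s))\<^sup>2) * sin (\<theta> (\<eta> * t, s) + \<phi>), z (\<eta> * t, s)] :: real^3"
      have d\<theta>': "((\<lambda>s. \<theta> (\<eta> * t, s) + \<phi>) has_real_derivative
          (c (\<eta> * t) - \<mu> (\<eta> * t) * z (\<eta> * t, s)) / (1 - (z (\<eta> * t, s))\<^sup>2)) (at s)" for s
        using DERIV_add[OF d\<theta>[OF e] DERIV_const] by simp
      obtain u' u'' where u: "\<And>s. (?u has_vector_derivative u' s) (at s)" "\<And>s. (u' has_vector_derivative u'' s) (at s)"
        "\<And>s. cross3 (?u s) (u'' s) - \<mu> (\<eta> * t) *\<^sub>R cross3 (axis 3 1) (?u s) + \<mu> (\<eta> * t) *\<^sub>R u' s = 0"
        using cylindrical_solution[OF dz[OF e] dz'[OF e] energy[OF e] d\<theta>' z_lt[OF e] refl] by blast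
      have "a = R * \<omega> t * \<mu> (\<eta> * t)"
        using \<mu>_pos[OF e] R_pos by (simp add: \<omega>_eq \<Lambda>_def)
      from solves_profile_eq_rescale[OF u this, of \<phi>]
      have "solves_profile_eq a (a * \<omega> t) (\<lambda>\<xi>. R *\<^sub>R ?u (\<omega> t * \<xi> - \<phi>))" .
      moreover have "(\<lambda>\<xi>. R *\<^sub>R ?u (\<omega> t * \<xi> - \<phi>)) = x t \<phi>"
        by (auto simp: x_def Z_def H_def vec_eq_iff forall_3)
      moreover have "a * \<omega> t = \<Omega> t" using a_pos by (simp add: \<omega>_def)
      ultimately show ?thesis by simp
    qed
    \<comment> \<open>T t corresponds to rescaled time 2 pi, that is k oscillations, during which
      the longitude advances by exactly one turn.\<close>
    have period: "x t \<phi> (\<xi> + T t) = x t \<phi> \<xi>" if t: "t \<in> ?I" for t \<phi> \<xi>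
    proof -
      have "\<omega> t * (\<xi> + T t) - \<phi> = \<omega> t * \<xi> - \<phi> + of_int 1 * (2 * pi)"
        using \<omega>_pos[OF t] by (simp add: T_def field_simps)
      then have "Z t \<phi> (\<xi> + T t) = Z t \<phi> \<xi>" "H t \<phi> (\<xi> + T t) = H t \<phi> \<xi> + 2 * pi"
        unfolding Z_def H_def by (simp_all only: z_per'[OF \<eta>I[OF t]] \<theta>_per'[OF \<eta>I[OF t]], simp?)
      then show ?thesis by (simp add: x_def)
    qed
    have \<phi>_period: "x t (\<phi> + 2 * pi) \<xi> = x t \<phi> \<xi>" if t: "t \<in> ?I" for t \<phi> \<xi>
    proof -
      have "\<omega> t * \<xi> - (\<phi> + 2 * pi) = \<omega> t * \<xi> - \<phi> + of_int (- 1) * (2 * pi)" by simp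
      then have "Z t (\<phi> + 2 * pi) \<xi> = Z t \<phi> \<xi>" "H t (\<phi> + 2 * pi) \<xi> = H t \<phi> \<xi>"
        unfolding Z_def H_def by (simp_all only: z_per'[OF \<eta>I[OF t]] \<theta>_per'[OF \<eta>I[OF t]], simp?)
      then show ?thesis by (simp add: x_def)
    qed
    have norm_x: "norm (x t \<phi> \<xi>) = R" if t: "t \<in> ?I" for t \<phi> \<xi>
    proof -
      let ?r = "sqrt (1 - (Z t \<phi> \<xi>)\<^sup>2)" and ?h = "H t \<phi> \<xi>"
      have "?r\<^sup>2 = 1 - (Z t \<phi> \<xi>)\<^sup>2" using Z_lt[OF t, of \<phi> \<xi>] by simp
      then have "(R * (?r * cos ?h))\<^sup>2 + (R * (?r * sin ?h))\<^sup>2 + (R * Z t \<phi> \<xi>)\<^sup>2 =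
          R\<^sup>2 * ((1 - (Z t \<phi> \<xi>)\<^sup>2) * ((cos ?h)\<^sup>2 + (sin ?h)\<^sup>2) + (Z t \<phi> \<xi>)\<^sup>2)"
        by (simp only: power_mult_distrib) (simp only: algebra_simps)
      also have "\<dots> = R\<^sup>2" by simp
      finally show ?thesis using R_pos by (simp add: x_def norm_vec_def L2_set_def sum_3)
    qed
    have "0 \<in> ?I" using \<open>\<delta> > 0\<close> by simp
    have x0: "x 0 \<phi> = equatorial R (\<omega> 0) 0" for \<phi>
      by (rule ext) (simp add: x_def Z_def H_def z0 \<theta>0 equatorial_def)
    have opnI: "open (?I \<times> (UNIV :: real set))" by (intro open_Times) auto
    have smooth_x: "smooth_on ((?I \<times> UNIV) \<times> UNIV) (\<lambda>p. x (fst (fst p)) (snd (fst p)) (snd p))"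
      by (intro smZH(3) smooth_intros open_Times) auto
    \<comment> \<open>An equatorial curve has height 0 throughout, whereas for t \<noteq> 0 the
      height of this orbit is not constant.\<close>
    have nonequatorial: "x t \<phi> \<noteq> equatorial R (\<omega> t) \<phi>\<^sub>0" if t: "t \<in> ?I" "t \<noteq> 0" for t \<phi> \<phi>\<^sub>0
    proof
      assume eq: "x t \<phi> = equatorial R (\<omega> t) \<phi>\<^sub>0"
      have "z (\<eta> * t, s) = 0" for s
      proof -
        have "x t \<phi> ((s + \<phi>) / \<omega> t) $ 3 = 0" unfolding eq by (simp add: equatorial_def)
        then show ?thesis using R_pos \<omega>_pos[OF t(1)] by (simp add: x_def Z_def)
      qed
      then have "((\<lambda>s. 0) has_real_derivative z' (\<eta> * t, s)) (at s)" for s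
        using dz[OF \<eta>I[OF t(1)], of s] by simp
      then have "z' (\<eta> * t, s) = 0" for s using DERIV_unique DERIV_const by blast
      then show False using z'_neq[OF \<eta>I[OF t(1)]] t(2) \<eta> by auto
    qed
    let ?G = "\<lambda>p. x (fst (fst p)) (snd (fst p)) (snd p)"
    let ?DG = "\<lambda>t \<phi> \<xi>. frechet_derivative ?G (at ((t, \<phi>), \<xi>))"
    \<comment> \<open>The height component suffices for the immersion. The term with
      \<open>deriv \<omega> t\<close> grows with \<xi> and arises because the rescaled time itself
      depends on t.\<close>
    have DG3: "?DG t \<phi> \<xi> ((\<alpha>, \<beta>), 0) $ 3 = R * (\<eta> * \<alpha> * frechet_derivative z (at (\<eta> * t, \<omega> t * \<xi> - \<phi>)) (1, 0)
        + (\<alpha> * deriv \<omega> t * \<xi> - \<beta>) * z' (\<eta> * t, \<omega> t * \<xi> - \<phi>))"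
      if t: "t \<in> ?I" for t \<phi> \<xi> \<alpha> \<beta>
    proof -
      let ?p = "(\<eta> * t, \<omega> t * \<xi> - \<phi>)" and ?v = "(\<eta> * \<alpha>, \<alpha> * deriv \<omega> t * \<xi> - \<beta>)"
      have p: "?p \<in> ?Ie \<times> UNIV" using \<eta>I[OF t] by simp
      note Dzp = smooth_on_has_derivative[OF smz p]
      have "((\<lambda>r. ?G (((t, \<phi>), \<xi>) + r *\<^sub>R ((\<alpha>, \<beta>), 0))) has_vector_derivative ?DG t \<phi> \<xi> ((\<alpha>, \<beta>), 0)) (at 0)"
        by (rule has_derivative_along_line) (use smooth_on_has_derivative[OF smooth_x] t in simp)
      from bounded_linear.has_vector_derivative[OF bounded_linear_vec_nth[of 3] this]
      have 1: "((\<lambda>r. R * z (\<eta> * (t + r * \<alpha>), \<omega> (t + r * \<alpha>) * \<xi> - (\<phi> + r * \<beta>))) has_vector_derivative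
          ?DG t \<phi> \<xi> ((\<alpha>, \<beta>), 0) $ 3) (at 0)"
        by (simp add: x_def Z_def)
      have d\<omega>: "(\<omega> has_real_derivative deriv \<omega> t) (at (t + 0 * \<alpha>))"
        using smooth_on_differentiable[OF sm\<omega> t] by (simp add: DERIV_deriv_iff_real_differentiable)
      have "((\<lambda>r. \<omega> (t + r * \<alpha>)) has_real_derivative deriv \<omega> t * \<alpha>) (at 0)"
        by (rule DERIV_chain2[where g = "\<lambda>r. t + r * \<alpha>", OF d\<omega>]) (auto intro!: derivative_eq_intros)
      then have "((\<lambda>r. \<omega> (t + r * \<alpha>) * \<xi> - (\<phi> + r * \<beta>)) has_real_derivative \<alpha> * deriv \<omega> t * \<xi> - \<beta>) (at 0)"
        by (auto intro!: derivative_eq_intros)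
      moreover have "((\<lambda>r. \<eta> * (t + r * \<alpha>)) has_real_derivative \<eta> * \<alpha>) (at 0)"
        by (auto intro!: derivative_eq_intros)
      ultimately have "((\<lambda>r. (\<eta> * (t + r * \<alpha>), \<omega> (t + r * \<alpha>) * \<xi> - (\<phi> + r * \<beta>))) has_vector_derivative ?v) (at 0)"
        unfolding has_real_derivative_iff_has_vector_derivative by (intro has_vector_derivative_Pair)
      from has_vector_derivative_compose_frechet[of z, OF _ this]
      have "((\<lambda>r. z (\<eta> * (t + r * \<alpha>), \<omega> (t + r * \<alpha>) * \<xi> - (\<phi> + r * \<beta>))) has_vector_derivative
          frechet_derivative z (at ?p) ?v) (at 0)"
        using smooth_on_differentiable[OF smz p] by simp
      from bounded_linear.has_vector_derivative[OF bounded_linear_mult_right[of R] this]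
      have 2: "((\<lambda>r. R * z (\<eta> * (t + r * \<alpha>), \<omega> (t + r * \<alpha>) * \<xi> - (\<phi> + r * \<beta>))) has_vector_derivative
          R * frechet_derivative z (at ?p) ?v) (at 0)" .
      have z1: "frechet_derivative z (at ?p) (0, 1) = z' ?p"
        using vector_derivative_unique_at[OF smooth_on_has_vector_derivative_snd[OF smz \<eta>I[OF t]]]
          dz[OF \<eta>I[OF t]] by (simp add: has_real_derivative_iff_has_vector_derivative)
      have lin: "linear (frechet_derivative z (at ?p))" using Dzp has_derivative_linear by blast
      have "?v = (\<eta> * \<alpha>) *\<^sub>R (1, 0) + (\<alpha> * deriv \<omega> t * \<xi> - \<beta>) *\<^sub>R (0, 1)" by simp
      then have "frechet_derivative z (at ?p) ?v = (\<eta> * \<alpha>) * frechet_derivative z (at ?p) (1, 0)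
          + (\<alpha> * deriv \<omega> t * \<xi> - \<beta>) * z' ?p"
        by (simp only: linear_add[OF lin] linear_scale[OF lin] z1 real_scaleR_def)
      then show ?thesis using vector_derivative_unique_at[OF 1 2] by simp
    qed
    have immersive: "immersive_at \<Omega> (\<lambda>(t, \<phi>). x t \<phi>) (t, \<phi>)" if t: "t \<in> ?I" "t \<noteq> 0" for t \<phi>
      unfolding immersive_at_def fst_conv
    proof (intro conjI exI allI impI)
      show "\<Omega> differentiable at t" by (rule smooth_on_differentiable[OF sm\<Omega> t(1)])
      have p: "(t, \<phi>) \<in> ?I \<times> UNIV" using t by simp
      show "has_H2_loc_derivs (\<lambda>(t, \<phi>). x t \<phi>) (\<lambda>\<xi>. ?DG t \<phi> \<xi> ((1, 0), 0)) (\<lambda>\<xi>. ?DG t \<phi> \<xi> ((0, 1), 0)) (t, \<phi>)"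
        using has_H2_loc_derivs_smooth_family[OF smooth_x opnI p] by (simp add: case_prod_unfold)
      fix \<alpha> \<beta> :: real
      assume "\<alpha> * deriv \<Omega> t = 0 \<and> (AE \<xi> in lebesgue. \<alpha> *\<^sub>R ?DG t \<phi> \<xi> ((1, 0), 0) + \<beta> *\<^sub>R ?DG t \<phi> \<xi> ((0, 1), 0) = 0)"
      then have AE: "AE \<xi> in lebesgue. \<alpha> *\<^sub>R ?DG t \<phi> \<xi> ((1, 0), 0) + \<beta> *\<^sub>R ?DG t \<phi> \<xi> ((0, 1), 0) = 0" by simp
      have "continuous_on UNIV (\<lambda>\<xi>. ?DG t \<phi> \<xi> h)" for h
        by (rule continuous_on_vector_derivative) (rule frechet_derivative_has_vector_derivative_snd[OF smooth_x p])
      then have comb: "\<alpha> *\<^sub>R ?DG t \<phi> \<xi> ((1, 0), 0) + \<beta> *\<^sub>R ?DG t \<phi> \<xi> ((0, 1), 0) = 0" for \<xi>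
        by (intro continuous_AE_zero_imp_zero[OF _ AE] continuous_intros)
      have comb3: "\<alpha> * ?DG t \<phi> \<xi> ((1, 0), 0) $ 3 + \<beta> * ?DG t \<phi> \<xi> ((0, 1), 0) $ 3 = 0" for \<xi>
        using arg_cong[OF comb[of \<xi>], of "\<lambda>v. v $ 3"] by simp
      have eq: "R * (\<eta> * \<alpha> * frechet_derivative z (at (\<eta> * t, \<omega> t * \<xi> - \<phi>)) (1, 0)
        + (\<alpha> * deriv \<omega> t * \<xi> - \<beta>) * z' (\<eta> * t, \<omega> t * \<xi> - \<phi>)) = 0" for \<xi>
        using comb3[of \<xi>] unfolding DG3[OF t(1)] by (simp add: algebra_simps)
      \<comment> \<open>At \<xi> = \<phi> / \<omega> t the rescaled time is 0, a turning point: the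
        terms with z' drop out, and only \<alpha> times the nonzero e-derivative of the height
        remains.\<close>
      have "\<alpha> = 0"
        using eq[of "\<phi> / \<omega> t"] \<omega>_pos[OF t(1)] z'0[OF \<eta>I[OF t(1)]] Dz_neq[OF \<eta>I[OF t(1)]] R_pos \<eta> by simp
      \<comment> \<open>With \<alpha> = 0 the height equation is \<beta> z' = 0 up to a nonzero
        factor, so any point off the turning points gives \<beta> = 0.\<close>
      moreover obtain s where s: "z' (\<eta> * t, s) \<noteq> 0" using z'_neq[OF \<eta>I[OF t(1)]] t(2) \<eta> by auto
      ultimately show "\<alpha> = 0" "\<beta> = 0"
        using eq[of "(s + \<phi>) / \<omega> t"] \<omega>_pos[OF t(1)] R_pos by simp_all
    qed
    \<comment> \<open>Both reference terms carry \<omega> t instead of \<omega> 0, so that the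
      first-order effect of the varying frequency, which grows with \<xi>, cancels in the
      remainder.\<close>
    define Er where "Er p = x (fst p) (fst (snd p)) (snd (snd p)) - equatorial R (\<omega> (fst p)) 0 (snd (snd p))
        - fst p *\<^sub>R first_order_mode k (\<omega> (fst p)) (fst (snd p)) (snd (snd p))" for p
    have opnI2: "open (?I \<times> (UNIV :: (real \<times> real) set))" by (intro open_Times) auto
    have smEr: "smooth_on (?I \<times> UNIV) Er"
    proof -
      have sm_fst: "smooth_on (?I \<times> (UNIV :: (real \<times> real) set)) fst"
        using smooth_on_fst[OF smooth_on_id[OF opnI2]] by simp
      have *: "smooth_on (?I \<times> (UNIV :: (real \<times> real) set)) (\<lambda>p. \<omega> (fst p))"
        by (rule smooth_on_compose[OF sm\<omega> sm_fst]) auto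
      have **: "smooth_on (?I \<times> (UNIV :: (real \<times> real) set)) (\<lambda>p. x (fst p) (fst (snd p)) (snd (snd p)))"
        by (intro smZH(3) smooth_intros opnI2) auto
      show ?thesis
        unfolding Er_def equatorial_def first_order_mode_def by (intro smooth_intros * ** opnI2)
    qed
    have Er0: "Er (0, p) = 0" for p by (simp add: Er_def x0)
    have Er1: "frechet_derivative Er (at (0, p)) (1, 0) = 0" for p
    proof (rule frechet_derivative_along_line)
      obtain \<phi> \<xi> where p: "p = (\<phi>, \<xi>)" by (cases p)
      show "Er differentiable at (0, p)" by (rule smooth_on_differentiable[OF smEr]) (use \<open>0 \<in> ?I\<close> in simp)
      define s0 where "s0 = \<omega> 0 * \<xi> - \<phi>"
      obtain \<omega>1 where d\<omega>: "(\<omega> has_real_derivative \<omega>1) (at 0)"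
        using smooth_on_differentiable[OF sm\<omega> \<open>0 \<in> ?I\<close>] real_differentiable_def by blast
      have "0 \<in> ?Ie" using \<open>\<delta>e > 0\<close> by simp
      then have q: "(0, s0) \<in> ?Ie \<times> UNIV" by simp
      have "((\<lambda>r. \<omega> r * \<xi> - \<phi>) has_real_derivative \<omega>1 * \<xi>) (at 0)"
        by (auto intro!: derivative_eq_intros d\<omega>)
      moreover have "((\<lambda>r. \<eta> * r) has_real_derivative \<eta>) (at 0)"
        by (auto intro!: derivative_eq_intros)
      ultimately have path: "((\<lambda>r. (\<eta> * r, \<omega> r * \<xi> - \<phi>)) has_vector_derivative (\<eta>, \<omega>1 * \<xi>)) (at 0)"
        unfolding has_real_derivative_iff_has_vector_derivative by (intro has_vector_derivative_Pair)
      \<comment> \<open>The second summand is the drift of the rescaled time with t. At e = 0 it is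
        weighted by the s-derivative f1, which is 0 for the height and 1 for the longitude.\<close>
      have split: "frechet_derivative f (at (0, s0)) (\<eta>, \<omega>1 * \<xi>) = \<eta> * frechet_derivative f (at (0, s0)) (1, 0) +
          (\<omega>1 * \<xi>) * f1"
        if f: "smooth_on (?Ie \<times> UNIV) f" and f1: "((\<lambda>s. f (0, s)) has_real_derivative f1) (at s0)"
        for f :: "real \<times> real \<Rightarrow> real" and f1
      proof -
        have "linear (frechet_derivative f (at (0, s0)))"
          using smooth_on_has_derivative[OF f q] has_derivative_linear by blast
        note lin = linear_add[OF this] linear_scale[OF this]
        have "frechet_derivative f (at (0, s0)) (0, 1) = f1"
          using vector_derivative_unique_at[OF smooth_on_has_vector_derivative_snd[OF f \<open>0 \<in> ?Ie\<close>]] f1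
          by (simp add: has_real_derivative_iff_has_vector_derivative)
        moreover have "(\<eta>, \<omega>1 * \<xi>) = \<eta> *\<^sub>R (1, 0) + (\<omega>1 * \<xi>) *\<^sub>R (0, 1)" by simp
        ultimately show ?thesis by (simp only: lin real_scaleR_def)
      qed
      have comp: "((\<lambda>r. f (\<eta> * r, \<omega> r * \<xi> - \<phi>)) has_real_derivative frechet_derivative f (at (0, s0)) (\<eta>, \<omega>1 * \<xi>)) (at 0)"
        if "smooth_on (?Ie \<times> UNIV) f" for f :: "real \<times> real \<Rightarrow> real"
        using has_vector_derivative_compose_frechet[of f, OF _ path] smooth_on_differentiable[OF that q]
        by (simp add: s0_def has_real_derivative_iff_has_vector_derivative)
      \<comment> \<open>Here \<eta> \<kappa>^2 / (2 \<mu>0) = - \<kappa> / (R \<mu>0), which after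
        multiplication by R is the vertical coefficient of \<open>first_order_mode\<close>.\<close>
      have dZ: "((\<lambda>r. Z r \<phi> \<xi>) has_real_derivative - (\<kappa> / (R * \<mu>0)) * cos (\<kappa> * s0)) (at 0)"
      proof -
        have "frechet_derivative z (at (0, s0)) (\<eta>, \<omega>1 * \<xi>) = - (\<kappa> / (R * \<mu>0)) * cos (\<kappa> * s0)"
          using split[OF smz, of 0] \<kappa> R_pos \<mu>0 unfolding Dz \<mu>0_def[symmetric]
          by (simp add: z0 \<eta>_def power2_eq_square)
        then show ?thesis using comp[OF smz] by (simp add: Z_def)
      qed
      have dH: "((\<lambda>r. H r \<phi> \<xi>) has_real_derivative sin (\<kappa> * s0) / R + \<omega>1 * \<xi>) (at 0)"
      proof -
        have "frechet_derivative \<theta> (at (0, s0)) (\<eta>, \<omega>1 * \<xi>) = sin (\<kappa> * s0) / R + \<omega>1 * \<xi>"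
          using split[OF sm\<theta>, of 1] \<kappa> R_pos unfolding D\<theta>
          by (simp add: \<theta>0 \<eta>_def)
        then show ?thesis using DERIV_add[OF comp[OF sm\<theta>] DERIV_const] by (simp add: H_def)
      qed
      have Z0: "Z 0 \<phi> \<xi> = 0" and H0: "H 0 \<phi> \<xi> = \<omega> 0 * \<xi>" by (simp_all add: Z_def H_def z0 \<theta>0)
      let ?m1 = "\<lambda>r. - sin (\<kappa> * (\<omega> r * \<xi> - \<phi>)) * sin (\<omega> r * \<xi>)"
      let ?m2 = "\<lambda>r. sin (\<kappa> * (\<omega> r * \<xi> - \<phi>)) * cos (\<omega> r * \<xi>)"
      let ?m3 = "\<lambda>r. - (\<kappa> / \<mu>0) * cos (\<kappa> * (\<omega> r * \<xi> - \<phi>))"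
      have "((\<lambda>r. vector [R * (sqrt (1 - (Z r \<phi> \<xi>)\<^sup>2) * cos (H r \<phi> \<xi>)) - R * cos (\<omega> r * \<xi>) - r * ?m1 r,
          R * (sqrt (1 - (Z r \<phi> \<xi>)\<^sup>2) * sin (H r \<phi> \<xi>)) - R * sin (\<omega> r * \<xi>) - r * ?m2 r,
          R * Z r \<phi> \<xi> - r * ?m3 r] :: real^3) has_vector_derivative vector [0, 0, 0]) (at 0)"
      proof (rule has_vector_derivative_vector3)
        have dr: "((\<lambda>r. sqrt (1 - (Z r \<phi> \<xi>)\<^sup>2)) has_real_derivative 0) (at 0)"
          by (auto intro!: derivative_eq_intros dZ simp: Z0)
        \<comment> \<open>At r = 0 the derivative of r f(r) is f(0), so the values D1, D2, D3 do not
          enter the result.\<close>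
        have dm: "((\<lambda>r. r * f r) has_real_derivative f 0) (at 0)" if "(f has_real_derivative D) (at 0)" for f :: "real \<Rightarrow> real" and D
          by (auto intro!: derivative_eq_intros that)
        have "\<exists>D. (?m1 has_real_derivative D) (at 0)" "\<exists>D. (?m2 has_real_derivative D) (at 0)"
          "\<exists>D. (?m3 has_real_derivative D) (at 0)"
          by (rule exI, (rule d\<omega> refl derivative_eq_intros)+)+
        then obtain D1 D2 D3 where "(?m1 has_real_derivative D1) (at 0)" "(?m2 has_real_derivative D2) (at 0)"
          "(?m3 has_real_derivative D3) (at 0)" by blast
        note dm' = this[THEN dm]
        show "((\<lambda>r. R * (sqrt (1 - (Z r \<phi> \<xi>)\<^sup>2) * cos (H r \<phi> \<xi>)) - R * cos (\<omega> r * \<xi>) - r * ?m1 r) has_real_derivative 0) (at 0)"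
          by (rule derivative_eq_intros dr dH d\<omega> dm'(1) refl)+
            (use R_pos in \<open>simp add: Z0 H0 s0_def field_simps\<close>)
        show "((\<lambda>r. R * (sqrt (1 - (Z r \<phi> \<xi>)\<^sup>2) * sin (H r \<phi> \<xi>)) - R * sin (\<omega> r * \<xi>) - r * ?m2 r) has_real_derivative 0) (at 0)"
          by (rule derivative_eq_intros dr dH d\<omega> dm'(2) refl)+
            (use R_pos in \<open>simp add: Z0 H0 s0_def field_simps\<close>)
        show "((\<lambda>r. R * Z r \<phi> \<xi> - r * ?m3 r) has_real_derivative 0) (at 0)"
          by (rule derivative_eq_intros dZ dm'(3) refl)+
            (use R_pos in \<open>simp add: s0_def field_simps\<close>)
      qed
      moreover have "vector [0, 0, 0] = (0 :: real^3)" by (simp add: vec_eq_iff forall_3)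
      moreover have "Er ((0, p) + r *\<^sub>R (1, 0)) = vector [R * (sqrt (1 - (Z r \<phi> \<xi>)\<^sup>2) * cos (H r \<phi> \<xi>)) - R * cos (\<omega> r * \<xi>) - r * ?m1 r,
          R * (sqrt (1 - (Z r \<phi> \<xi>)\<^sup>2) * sin (H r \<phi> \<xi>)) - R * sin (\<omega> r * \<xi>) - r * ?m2 r,
          R * Z r \<phi> \<xi> - r * ?m3 r]" for r
        by (simp add: Er_def p x_def equatorial_def first_order_mode_def vec_eq_iff forall_3 \<kappa>_def \<mu>0_def)
      ultimately show "((\<lambda>r. Er ((0, p) + r *\<^sub>R (1, 0))) has_vector_derivative 0) (at 0)" by simp
    qed
    have Er_per: "Er (t, \<phi> + 2 * pi, \<xi>) = Er (t, \<phi>, \<xi>)" if t: "t \<in> ?I" for t \<phi> \<xi>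
    proof -
      have "real k * (\<omega> t * \<xi> - (\<phi> + 2 * pi)) = real k * (\<omega> t * \<xi> - \<phi>) - real k * (2 * pi)"
        by (simp add: algebra_simps)
      moreover have "sin (y - real k * (2 * pi)) = sin y" "cos (y - real k * (2 * pi)) = cos y" for y
        using periodic_int_multiple[of sin "2 * pi" y "- int k"] periodic_int_multiple[of cos "2 * pi" y "- int k"]
        by simp_all
      ultimately show ?thesis
        by (simp add: Er_def \<phi>_period[OF t] first_order_mode_def)
    qed
    have expansion: "\<forall>\<^sub>F t in at 0. \<forall>\<phi>. H2_norm {c<..<d}
        (\<lambda>\<xi>. x t \<phi> \<xi> - equatorial R (\<omega> t) 0 \<xi> - t *\<^sub>R first_order_mode k (\<omega> t) \<phi> \<xi>) \<le> \<epsilon> * \<bar>t\<bar>"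
      if "c < d" "\<epsilon> > 0" for c d \<epsilon>
      using H2_norm_second_order_family[OF smEr open_greaterThanLessThan \<open>0 \<in> ?I\<close> Er0 Er1 Er_per _ that]
      by (simp add: Er_def)
    have "H2_loc_smooth_on {p. fst p \<in> ?I} (\<lambda>(t, \<phi>). x t \<phi>)"
    proof -
      have "{p. fst p \<in> ?I} = ?I \<times> (UNIV :: real set)" by auto
      then show ?thesis
        using H2_loc_smooth_on_smooth_family[OF smooth_x opnI] by (simp add: case_prod_unfold)
    qed
    moreover have "(\<Lambda> \<longlongrightarrow> crit_lambda R k) (at 0)"
      using smooth_on_isCont[OF sm\<Lambda> \<open>0 \<in> ?I\<close>] by (simp add: isCont_def lk)
    ultimately show ?thesis
      unfolding Let_def
      using \<open>\<delta> > 0\<close> smooth_on_imp_smooth_real_on[OF sm\<Lambda>] \<Lambda>_pos lk \<phi>_period solves period norm_x x0 expansion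
        smooth_on_imp_smooth_real_on[OF sm\<Omega>] nonequatorial immersive
      by (intro exI[of _ \<delta>] exI[of _ \<Lambda>] exI[of _ x])
        (auto simp: \<Omega>_def[abs_def] \<omega>_def T_def fun_eq_iff)
  qed
qed

end
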